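(* Let $n\ge 2$, $n=n_1+n_2$ with $n_1,n_2\ge 1$, and let $$R=\begin{pmatrix} R_{11} & R_{12}\\ R_{21} & R_{22}\end{pmatrix}$$ be a non-singular $n\times n$ correlation matrix partitioned into blocks, where $R_{ii}$ is $n_i\times n_i$ ($i=1,2$), $R_{21}=R_{12}^T$, and $R_{12}$ has positive rank (i.e. $R_{12}\neq 0$). Let $\alpha>0$ satisfy $2\alpha\in\mathbb{N}$ or $2\alpha>n-2$. Then for all positive numbers $x_1,\ldots,x_n$, $$F(x_1,\ldots,x_n;\alpha,R) > F(x_1,\ldots,x_{n_1};\alpha,R_{11})\,F(x_{n_1+1},\ldots,x_n;\alpha,R_{22}),$$ where $F(\cdot;\alpha,Q)$ denotes the cumulative distribution function of the $\Gamma_m(\alpha,Q)$-distribution for an $m\times m$ correlation matrix $Q$.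
   Context: Multivariate gamma distribution (in the sense of Krishnamoorthy and Parthasarathy): for an $m\times m$ non-singular correlation matrix $Q$ and $\alpha>0$ with $2\alpha\in\mathbb{N}$ or $2\alpha>m-2$, the $\Gamma_m(\alpha,Q)$-distribution is the probability distribution of a random vector $(X_1,\ldots,X_m)$ with values in $[0,\infty)^m$ whose Laplace transform is $$E\Big(\exp\big(-\textstyle\sum_{j=1}^m t_jX_j\big)\Big)=|I_m+QT|^{-\alpha},\qquad T=\mathrm{diag}(t_1,\ldots,t_m),\ t_1,\ldots,t_m\ge 0,$$ where $I_m$ is the identity matrix and $|\cdot|$ denotes the determinant (such a distribution exists for these values of $\alpha$; for $2\alpha\in\mathbb{N}$ it is the joint distribution of the diagonal elements of a Wishart matrix $W_m(2\alpha,Q)$ divided by $2$). Its cumulative distribution function is $F(x_1,\ldots,x_m;\alpha,Q)=P(X_1\le x_1,\ldots,X_m\le x_m)$. The case $\alpha=1/2$ corresponds to $X_j=Z_j^2/2$ for a centered Gaussian vector $(Z_1,\ldots,Z_m)$ with correlation matrix $Q$. *)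

theory Defs
  imports "HOL-Probability.Probability" "Jordan_Normal_Form.Determinant"
begin

definition correlation_matrix :: "nat \<Rightarrow> real mat \<Rightarrow> bool" where
  "correlation_matrix m Q \<longleftrightarrow>
     Q \<in> carrier_mat m m \<and>
     (\<forall>i<m. \<forall>j<m. Q $$ (i,j) = Q $$ (j,i)) \<and>
     (\<forall>i<m. Q $$ (i,i) = 1) \<and>
     (\<forall>v :: nat \<Rightarrow> real. 0 \<le> (\<Sum>i<m. \<Sum>j<m. v i * Q $$ (i,j) * v j))"

definition diag_of_fun :: "nat \<Rightarrow> (nat \<Rightarrow> real) \<Rightarrow> real mat" where
  "diag_of_fun m t = mat m m (\<lambda>(i,j). if i = j then t i else 0)"

definition is_mgamma :: "nat \<Rightarrow> real \<Rightarrow> real mat \<Rightarrow> (nat \<Rightarrow> real) measure \<Rightarrow> bool" where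
  "is_mgamma m \<alpha> Q M \<longleftrightarrow>
     prob_space M \<and>
     sets M = sets (PiM {..<m} (\<lambda>_. borel)) \<and>
     (AE x in M. \<forall>i<m. 0 \<le> x i) \<and>
     (\<forall>t :: nat \<Rightarrow> real. (\<forall>i<m. 0 \<le> t i) \<longrightarrow>
        (\<integral>x. exp (- (\<Sum>i<m. t i * x i)) \<partial>M) =
        det (1\<^sub>m m + Q * diag_of_fun m t) powr (- \<alpha>))"

definition mgamma_cdf :: "nat \<Rightarrow> real \<Rightarrow> real mat \<Rightarrow> (nat \<Rightarrow> real) \<Rightarrow> real" where
  "mgamma_cdf m \<alpha> Q y =
     (let M = (THE M. is_mgamma m \<alpha> Q M)
      in measure M {x \<in> space M. \<forall>i<m. x i \<le> y i})"

end

theory Submission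
  imports Defs
begin

text \<open>Interpolate between \<open>R\<close> and its block diagonal part by \<open>R\<^sub>\<tau>\<close>, whose off-diagonal blocks are scaled by
  \<open>\<tau>\<close>. Expanding \<open>|I + R\<^sub>\<tau> T|\<close> into principal minors, the \<open>\<tau>\<close>-derivative of the Laplace transform of
  \<open>\<Gamma>(\<alpha>, R\<^sub>\<tau>)\<close> is a sum over index sets \<open>J\<close> of \<open>- \<alpha>\<close> times the derivative of the principal minor on \<open>J\<close>
  times the monomial \<open>t\<^sub>J\<close> times the Laplace transform of \<open>\<Gamma>(\<alpha> + 1, R\<^sub>\<tau>)\<close>; the principal minors decrease in
  \<open>\<tau>\<close> (Royen). To avoid densities, the indicator of \<open>[0, a]\<close> is replaced by the decreasing functions
  \<open>1 - (1 - exp (- k x)) ^ m\<close>, which are polynomials in \<open>exp (- k x)\<close>: expectations of their products are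
  finite combinations of values of the Laplace transform, multiplication by \<open>t\<^sub>J\<close> turns into differentiation
  of the factors with index in \<open>J\<close>, and each term of the derivative is visibly nonnegative. Strictness comes
  from a two-element \<open>J\<close>, using that \<open>\<Gamma>(\<alpha> + 1, R\<^sub>\<tau>)\<close> is a convolution with the law of half the squares of a
  nondegenerate Gaussian vector. Existence for \<open>2 \<alpha> > n - 2\<close> is a Bartlett type recursion replacing \<open>(\<alpha>, n)\<close>
  by \<open>(\<alpha> - 1/2, n - 1)\<close> and ending in Kibble's bivariate gamma distribution.\<close>

section \<open>Determinants and positive definite matrices\<close>

text \<open>Letting k tend to infinity keeps only weak inequalities, so a positive term for each k
  is not enough: the contribution of the pair must exceed a constant independent of k and \<tau>.
  The differentiated cut-offs peak ever higher near a_i. Hence a small isotropic Gaussian part s^2 I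
  is split off the covariance; integrating it out turns a peak into a difference of cut-off values
  on either side of a_i, and this difference tends to 1. What remains is confined to a small box,
  whose mass is bounded below uniformly in \<tau> through the Laplace transform alone. The
  alternative 2 \<alpha> \<in> \<nat> or 2 \<alpha> > n - 2 enters through existence: the terms of
  the derivative are nonnegative because they are expectations under \<Gamma>(\<alpha> + 1,
  R_\<tau>), so this law has to exist for every \<tau> in [0, 1]. The same cut-offs invert the
  Laplace transform, which settles the uniqueness behind the definite description in
  \<open>mgamma_cdf\<close>.\<close>

definition fdet :: "nat \<Rightarrow> (nat \<Rightarrow> nat \<Rightarrow> real) \<Rightarrow> real" where
  "fdet n A = det (mat n n (\<lambda>(i,j). A i j))"

definition lapdet :: "nat \<Rightarrow> (nat \<Rightarrow> nat \<Rightarrow> real) \<Rightarrow> (nat \<Rightarrow> real) \<Rightarrow> real" where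
  "lapdet n Q t = fdet n (\<lambda>i j. of_bool (i = j) + Q i j * t j)"

text \<open>Filling up with the identity outside J makes \<open>fdet n (pmask J Q)\<close> the
  principal minor of Q on J while the size stays n, so minors for different J are added without
  renumbering rows.\<close>

definition pmask :: "nat set \<Rightarrow> (nat \<Rightarrow> nat \<Rightarrow> real) \<Rightarrow> nat \<Rightarrow> nat \<Rightarrow> real" where
  "pmask J Q = (\<lambda>i j. if i \<in> J \<and> j \<in> J then Q i j else of_bool (i = j))"

definition bilin :: "nat \<Rightarrow> (nat \<Rightarrow> nat \<Rightarrow> real) \<Rightarrow> (nat \<Rightarrow> real) \<Rightarrow> (nat \<Rightarrow> real) \<Rightarrow> real" where
  "bilin n K u v = (\<Sum>i<n. \<Sum>j<n. u i * K i j * v j)"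

definition pos_def :: "nat \<Rightarrow> (nat \<Rightarrow> nat \<Rightarrow> real) \<Rightarrow> bool" where
  "pos_def n K \<longleftrightarrow> (\<forall>i<n. \<forall>j<n. K i j = K j i) \<and> (\<forall>v. (\<exists>i<n. v i \<noteq> 0) \<longrightarrow> 0 < bilin n K v v)"

text \<open>Indices below m form the first block. \<tau> = 1 gives K, \<tau> = 0 its block diagonal
  part, and \<tau> = -1 the conjugate of K by a diagonal matrix of signs.\<close>

definition offscale :: "nat \<Rightarrow> real \<Rightarrow> (nat \<Rightarrow> nat \<Rightarrow> real) \<Rightarrow> nat \<Rightarrow> nat \<Rightarrow> real" where
  "offscale m \<tau> K = (\<lambda>i j. if (i < m) = (j < m) then K i j else \<tau> * K i j)"

section \<open>Leibniz expansions and principal minors\<close>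

lemma fdet_row: "fdet n A = (\<Sum>p | p permutes {..<n}. signof p * (\<Prod>i<n. A i (p i)))"
  unfolding fdet_def
  by (subst det_def'[of _ n]) (auto simp: lessThan_atLeast0 permutes_in_image intro!: sum.cong prod.cong)

lemma fdet_col: "fdet n A = (\<Sum>p | p permutes {..<n}. signof p * (\<Prod>j<n. A (p j) j))"
  unfolding fdet_def
  by (subst det_col[of _ n]) (auto simp: lessThan_atLeast0 permutes_in_image intro!: sum.cong prod.cong)

lemma fdet_cong: "(\<And>i j. i < n \<Longrightarrow> j < n \<Longrightarrow> A i j = B i j) \<Longrightarrow> fdet n A = fdet n B"
  unfolding fdet_def by (rule arg_cong[where f=det]) auto

lemma fdet_scale_col: "fdet n (\<lambda>i j. A i j * c j) = (\<Prod>j<n. c j) * fdet n A"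
  unfolding fdet_col by (simp add: prod.distrib sum_distrib_left algebra_simps)

lemma fdet_diag: "fdet n (\<lambda>i j. of_bool (i = j)) = 1"
proof -
  have "mat n n (\<lambda>(i,j). of_bool (i = j)) = (1\<^sub>m n :: real mat)" by auto
  thus ?thesis unfolding fdet_def by simp
qed

text \<open>A permutation fixing every index outside J maps J into itself, so the mask reads entries
  of Q exactly there; one that moves an index outside J puts a zero factor on both sides.\<close>

lemma pmask_prod:
  assumes p: "p permutes {..<n}" and J: "J \<subseteq> {..<n}"
  shows "(\<Prod>j\<in>J. Q (p j) j) * (\<Prod>j\<in>{..<n}-J. of_bool (p j = j)) = (\<Prod>j<n. pmask J Q (p j) j)"
proof (cases "\<forall>j\<in>{..<n}-J. p j = j")
  case True
  have pJ: "p j \<in> J" if "j \<in> J" for j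
  proof (rule ccontr)
    assume "p j \<notin> J"
    moreover have "p j \<in> {..<n}" using that J permutes_in_image[OF p, of j] by auto
    ultimately have "p (p j) = p j" using True by simp
    hence "p j = j" using injD[OF permutes_inj[OF p]] by auto
    thus False using that \<open>p j \<notin> J\<close> by simp
  qed
  have "(\<Prod>j<n. pmask J Q (p j) j) = (\<Prod>j\<in>J. pmask J Q (p j) j) * (\<Prod>j\<in>{..<n}-J. pmask J Q (p j) j)"
    using prod.subset_diff[OF J finite_lessThan] by (simp add: mult.commute)
  also have "(\<Prod>j\<in>J. pmask J Q (p j) j) = (\<Prod>j\<in>J. Q (p j) j)"
    by (rule prod.cong) (auto simp: pmask_def pJ)
  also have "(\<Prod>j\<in>{..<n}-J. pmask J Q (p j) j) = (\<Prod>j\<in>{..<n}-J. of_bool (p j = j))"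
    by (rule prod.cong) (auto simp: pmask_def)
  finally show ?thesis by simp
next
  case False
  then obtain j where j: "j < n" "j \<notin> J" "p j \<noteq> j" by auto
  have "(\<Prod>j\<in>{..<n}-J. of_bool (p j = j)) = (0::real)"
    by (rule prod_zero) (use j in auto)
  moreover have "(\<Prod>j<n. pmask J Q (p j) j) = 0"
    by (rule prod_zero) (use j in \<open>auto simp: pmask_def\<close>)
  ultimately show ?thesis by (simp only: mult_zero_right)
qed

text \<open>Each column of I + Q T is a sum of two columns. After multiplying out the Leibniz
  products, J collects the columns where the Q T part was chosen.\<close>

lemma lapdet_expand:
  "lapdet n Q t = (\<Sum>J\<in>Pow {..<n}. (\<Prod>j\<in>J. t j) * fdet n (pmask J Q))"
proof -
  have "lapdet n Q t = (\<Sum>p | p permutes {..<n}. signof p *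
          (\<Prod>j<n. Q (p j) j * t j + of_bool (p j = j)))"
    unfolding lapdet_def fdet_col by (simp add: add.commute)
  also have "\<dots> = (\<Sum>p | p permutes {..<n}. \<Sum>J\<in>Pow {..<n}. signof p *
      ((\<Prod>j\<in>J. Q (p j) j * t j) * (\<Prod>j\<in>{..<n}-J. of_bool (p j = j))))"
    by (simp add: prod_add sum_distrib_left)
  also have "\<dots> = (\<Sum>p | p permutes {..<n}. \<Sum>J\<in>Pow {..<n}. (\<Prod>j\<in>J. t j) *
      (signof p * (\<Prod>j<n. pmask J Q (p j) j)))"
    by (intro sum.cong refl)
       (auto simp: prod.distrib pmask_prod[symmetric] algebra_simps)
  also have "\<dots> = (\<Sum>J\<in>Pow {..<n}. (\<Prod>j\<in>J. t j) * fdet n (pmask J Q))"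
    by (subst sum.swap) (simp add: fdet_col sum_distrib_left)
  finally show ?thesis .
qed

text \<open>Only permutations of J contribute, and for them each \<open>s j\<close> with j in J
  occurs once as a row factor and once as a column factor.\<close>

lemma fdet_pmask_scale:
  assumes J: "J \<subseteq> {..<n}"
  shows "fdet n (pmask J (\<lambda>i j. s i * Q i j * s j)) = (\<Prod>j\<in>J. (s j)\<^sup>2) * fdet n (pmask J Q)"
proof -
  have "(\<Prod>j<n. pmask J (\<lambda>i j. s i * Q i j * s j) (p j) j) =
      (\<Prod>j\<in>J. (s j)\<^sup>2) * (\<Prod>j<n. pmask J Q (p j) j)" if p: "p permutes {..<n}" for p
  proof (cases "\<forall>j\<in>{..<n}-J. p j = j")
    case True
    hence pJ: "p permutes J" using p J
      by (metis (no_types, lifting) Diff_iff permutes_superset)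
    have "(\<Prod>j\<in>J. s (p j)) = (\<Prod>j\<in>J. s j)"
      using prod.permute[OF pJ, of s] by (simp add: o_def)
    thus ?thesis
      by (simp add: pmask_prod[OF p J, symmetric] prod.distrib power2_eq_square algebra_simps)
  next
    case False
    then obtain j where j: "j < n" "j \<notin> J" "p j \<noteq> j" by auto
    have "(\<Prod>j\<in>{..<n}-J. of_bool (p j = j)) = (0::real)"
      by (rule prod_zero) (use j in auto)
    thus ?thesis by (simp add: pmask_prod[OF p J, symmetric])
  qed
  thus ?thesis unfolding fdet_col by (simp add: sum_distrib_left algebra_simps)
qed

text \<open>Compared minor by minor. This links the symmetric matrix I + S Q S of the Gaussian
  integrals with |I + Q T| at T = S^2.\<close>

lemma lapdet_scale:
  "lapdet n (\<lambda>i j. s i * Q i j * s j) (\<lambda>_. 1) = lapdet n Q (\<lambda>i. (s i)\<^sup>2)"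
  unfolding lapdet_expand by (intro sum.cong refl) (simp add: fdet_pmask_scale)

lemma lapdet_cong:
  "(\<And>i j. i < n \<Longrightarrow> j < n \<Longrightarrow> Q i j = Q' i j) \<Longrightarrow> (\<And>i. i < n \<Longrightarrow> t i = t' i) \<Longrightarrow> lapdet n Q t = lapdet n Q' t'"
  unfolding lapdet_def by (rule fdet_cong) simp

lemma det_lapdet:
  assumes "Q \<in> carrier_mat n n"
  shows "det (1\<^sub>m n + Q * diag_of_fun n t) = lapdet n (\<lambda>i j. Q $$ (i,j)) t"
proof -
  have "1\<^sub>m n + Q * diag_of_fun n t = mat n n (\<lambda>(i,j). of_bool (i = j) + Q $$ (i,j) * t j)"
  proof (rule eq_matI)
    fix i j assume ij: "i < dim_row (mat n n (\<lambda>(i,j). of_bool (i = j) + Q $$ (i,j) * t j))"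
      "j < dim_col (mat n n (\<lambda>(i,j). of_bool (i = j) + Q $$ (i,j) * t j))"
    have "(\<Sum>ia = 0..<n. Q $$ (i, ia) * (if ia = j then t ia else 0)) = Q $$ (i,j) * t j"
      using ij by (simp add: if_distrib[of "\<lambda>x. Q $$ (i,_) * x"] cong: if_cong)
    thus "(1\<^sub>m n + Q * diag_of_fun n t) $$ (i, j) = mat n n (\<lambda>(i,j). of_bool (i = j) + Q $$ (i,j) * t j) $$ (i, j)"
      using ij assms by (auto simp: diag_of_fun_def scalar_prod_def)
  qed (use assms in \<open>auto simp: diag_of_fun_def\<close>)
  thus ?thesis by (simp add: lapdet_def fdet_def)
qed

text \<open>Every permutation other than the identity and the transposition of i and j moves an
  index outside {i, j}, where the mask makes the product vanish.\<close>

lemma fdet_pair: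
  assumes "i < n" "j < n" "i \<noteq> j"
  shows "fdet n (pmask {i,j} Q) = Q i i * Q j j - Q i j * Q j i"
proof -
  let ?T = "Transposition.transpose i j"
  let ?f = "\<lambda>p. signof p * (\<Prod>k<n. pmask {i,j} Q (p k) k)"
  have J: "{i,j} \<subseteq> {..<n}" using assms by auto
  have tr: "?T permutes {..<n}" using assms by (intro permutes_swap_id) auto
  have "?T \<noteq> id" using assms by (metis id_apply transpose_apply_first)
  have "fdet n (pmask {i,j} Q) = (\<Sum>p\<in>{id, ?T}. ?f p)"
    unfolding fdet_col
  proof (rule sum.mono_neutral_right)
    show "\<forall>p\<in>{p. p permutes {..<n}} - {id, ?T}. ?f p = 0"
    proof
      fix p assume p: "p \<in> {p. p permutes {..<n}} - {id, ?T}"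
      have "\<not> p permutes {i,j}" using p by (auto simp: permutes_doubleton_iff)
      then obtain k where k: "k \<in> {..<n} - {i,j}" "p k \<noteq> k"
        using p by (metis (no_types, lifting) Diff_iff mem_Collect_eq permutes_superset)
      have "(\<Prod>k<n. pmask {i,j} Q (p k) k) = 0"
        by (rule prod_zero) (use k in \<open>auto simp: pmask_def\<close>)
      thus "?f p = 0" by simp
    qed
  qed (use tr in \<open>auto simp: finite_permutations permutes_id\<close>)
  also have "\<dots> = ?f id + ?f ?T" using \<open>?T \<noteq> id\<close> by simp
  also have "?f id = Q i i * Q j j"
    using pmask_prod[OF permutes_id J, of Q] assms by (simp add: sign_id)
  also have "?f ?T = - (Q i j * Q j i)"
  proof -
    have "(\<Prod>k\<in>{..<n}-{i,j}. of_bool (?T k = k)) = (1::real)"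
      by (rule prod.neutral) (auto simp: transpose_apply_other)
    hence "(\<Prod>k<n. pmask {i,j} Q (?T k) k) = Q i j * Q j i"
      using pmask_prod[OF tr J, of Q] assms by (simp add: mult.commute)
    moreover have "signof ?T = (-1::real)" using assms by (simp add: sign_swap_id)
    ultimately show ?thesis by simp
  qed
  finally show ?thesis by simp
qed

section \<open>Quadratic forms and leading minors\<close>

lemma bilin_add_left: "bilin n K (\<lambda>i. u i + u' i) v = bilin n K u v + bilin n K u' v"
  unfolding bilin_def by (simp add: algebra_simps sum.distrib)

lemma bilin_add_right: "bilin n K u (\<lambda>i. v i + v' i) = bilin n K u v + bilin n K u v'"
  unfolding bilin_def by (simp add: algebra_simps sum.distrib)

lemma bilin_scale_left: "bilin n K (\<lambda>i. c * u i) v = c * bilin n K u v"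
  unfolding bilin_def by (simp add: algebra_simps sum_distrib_left)

lemma bilin_scale_right: "bilin n K u (\<lambda>i. c * v i) = c * bilin n K u v"
  unfolding bilin_def by (simp add: algebra_simps sum_distrib_left)

lemma bilin_sym:
  assumes "\<And>i j. i < n \<Longrightarrow> j < n \<Longrightarrow> K i j = K j i"
  shows "bilin n K u v = bilin n K v u"
proof -
  have "bilin n K u v = (\<Sum>j<n. \<Sum>i<n. u i * K i j * v j)"
    unfolding bilin_def by (rule sum.swap)
  also have "\<dots> = bilin n K v u"
    unfolding bilin_def by (intro sum.cong refl) (simp add: assms mult_ac)
  finally show ?thesis .
qed

lemma pos_def_sym: "pos_def n K \<Longrightarrow> i < n \<Longrightarrow> j < n \<Longrightarrow> K i j = K j i"
  by (auto simp: pos_def_def)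

lemma pos_def_pos: "pos_def n K \<Longrightarrow> i < n \<Longrightarrow> v i \<noteq> 0 \<Longrightarrow> 0 < bilin n K v v"
  by (auto simp: pos_def_def)

lemma bilin_zero: "(\<And>i. i < n \<Longrightarrow> v i = 0) \<Longrightarrow> bilin n K v v = 0"
  by (simp add: bilin_def)

lemma pos_def_nonneg: "pos_def n K \<Longrightarrow> 0 \<le> bilin n K v v"
  using bilin_zero[of n v K] by (cases "\<exists>i<n. v i \<noteq> 0") (auto simp: pos_def_def intro: less_imp_le)

lemma pos_def_leading:
  assumes "pos_def (Suc n) K" shows "pos_def n K"
  unfolding pos_def_def
proof safe
  fix v i assume i: "i < n" "v i \<noteq> (0::real)"
  have "0 < bilin (Suc n) K (\<lambda>i. if i < n then v i else 0) (\<lambda>i. if i < n then v i else 0)"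
    by (rule pos_def_pos[OF assms, of i]) (use i in auto)
  thus "0 < bilin n K v v" by (simp add: bilin_def)
qed (use assms in \<open>auto simp: pos_def_def\<close>)

text \<open>c is the last column of the adjugate: it solves K c = |K| e_n without inverting K, and
  its last entry is the preceding leading minor, the denominator in
  \<open>leading_ratio\<close>.\<close>

lemma last_cofactors:
  "\<exists>c. c n = fdet n K \<and> (\<forall>i\<le>n. (\<Sum>j\<le>n. K i j * c j) = (if i = n then fdet (Suc n) K else 0))"
proof -
  define A where "A = mat (Suc n) (Suc n) (\<lambda>(i,j). K i j)"
  have A: "A \<in> carrier_mat (Suc n) (Suc n)" by (simp add: A_def)
  define c where "c j = cofactor A n j" for j
  have "mat_delete A n n = mat n n (\<lambda>(i,j). K i j)"
    unfolding mat_delete_def A_def by (rule eq_matI) auto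
  hence "c n = fdet n K" by (simp add: c_def cofactor_def fdet_def)
  moreover have "(\<Sum>j\<le>n. K i j * c j) = (if i = n then fdet (Suc n) K else 0)" if i: "i \<le> n" for i
  proof -
    have "(A * adj_mat A) $$ (i,n) = (\<Sum>j\<le>n. K i j * c j)"
      using i A by (auto simp: adj_mat_def scalar_prod_def c_def A_def atLeast0LessThan
          lessThan_Suc_atMost intro!: sum.cong)
    moreover have "(A * adj_mat A) $$ (i,n) = (if i = n then fdet (Suc n) K else 0)"
      using i by (simp add: adj_mat(2)[OF A]) (simp add: A_def fdet_def)
    ultimately show ?thesis by simp
  qed
  ultimately show ?thesis by blast
qed

lemma bilin_row: "bilin n K u v = (\<Sum>i<n. u i * (\<Sum>j<n. K i j * v j))"
  unfolding bilin_def by (simp add: sum_distrib_left algebra_simps)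

text \<open>The minimiser z is the column of \<open>last_cofactors\<close> divided by its last
  entry. As K z is a multiple of the last unit vector, \<open>bilin (Suc n) K y z\<close> depends on
  \<open>y n\<close> alone, and expanding the form at y - z gives minimality.\<close>

lemma leading_ratio:
  assumes K: "pos_def (Suc n) K" and pos: "0 < fdet n K"
  shows "\<exists>z. z n = 1 \<and> fdet (Suc n) K = fdet n K * bilin (Suc n) K z z"
    and "y n = 1 \<Longrightarrow> fdet (Suc n) K \<le> fdet n K * bilin (Suc n) K y y"
proof -
  obtain c where c: "c n = fdet n K"
    "\<And>i. i \<le> n \<Longrightarrow> (\<Sum>j\<le>n. K i j * c j) = (if i = n then fdet (Suc n) K else 0)"
    using last_cofactors by blast
  define z where "z j = c j / c n" for j
  have z1: "z n = 1" using c(1) pos by (simp add: z_def)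
  have row: "(\<Sum>j<Suc n. K i j * z j) = (if i = n then fdet (Suc n) K / fdet n K else 0)"
    if "i < Suc n" for i
  proof -
    have "(\<Sum>j<Suc n. K i j * z j) = (\<Sum>j\<le>n. K i j * c j) / c n"
      by (simp add: z_def lessThan_Suc_atMost sum_divide_distrib)
    thus ?thesis using that c by simp
  qed
  have blz: "bilin (Suc n) K u z = u n * (fdet (Suc n) K / fdet n K)" for u
  proof -
    have "bilin (Suc n) K u z = (\<Sum>i<Suc n. u i * (if i = n then fdet (Suc n) K / fdet n K else 0))"
      unfolding bilin_row by (intro sum.cong refl) (simp only: row lessThan_iff)
    thus ?thesis by simp
  qed
  show "\<exists>z. z n = 1 \<and> fdet (Suc n) K = fdet n K * bilin (Suc n) K z z"
    using z1 blz[of z] pos by (intro exI[of _ z]) simp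
  assume y: "y n = 1"
  define w where "w i = y i + (-1) * z i" for i
  have sym: "\<And>u v. bilin (Suc n) K u v = bilin (Suc n) K v u"
    by (rule bilin_sym) (rule pos_def_sym[OF K])
  have "0 \<le> bilin (Suc n) K w w" by (rule pos_def_nonneg[OF K])
  also have "\<dots> = bilin (Suc n) K y y - 2 * bilin (Suc n) K y z + bilin (Suc n) K z z"
    unfolding w_def bilin_add_left bilin_add_right bilin_scale_left bilin_scale_right using sym[of y z] by simp
  also have "\<dots> = bilin (Suc n) K y y - fdet (Suc n) K / fdet n K"
    by (simp add: blz y z1)
  finally show "fdet (Suc n) K \<le> fdet n K * bilin (Suc n) K y y"
    using pos by (simp add: field_simps)
qed

lemma pos_def_fdet_pos: "pos_def n K \<Longrightarrow> 0 < fdet n K"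
proof (induction n)
  case 0
  show ?case by (simp add: fdet_def)
next
  case (Suc n)
  have pos: "0 < fdet n K" using Suc pos_def_leading by blast
  obtain z where z: "z n = 1" "fdet (Suc n) K = fdet n K * bilin (Suc n) K z z"
    using leading_ratio(1)[OF Suc.prems pos] by blast
  have "0 < bilin (Suc n) K z z" by (rule pos_def_pos[OF Suc.prems, of n]) (simp_all add: z)
  thus ?case using pos z by simp
qed

section \<open>Minors under scaling of the off-diagonal blocks\<close>

definition flip :: "nat \<Rightarrow> (nat \<Rightarrow> real) \<Rightarrow> nat \<Rightarrow> real" where
  "flip m v = (\<lambda>i. if i < m then v i else - v i)"

lemma bilin_offscale:
  "bilin n (offscale m \<tau> K) v v =
     (1 + \<tau>) / 2 * bilin n K v v + (1 - \<tau>) / 2 * bilin n K (flip m v) (flip m v)"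
  unfolding bilin_def sum_distrib_left sum.distrib[symmetric]
  by (intro sum.cong refl) (auto simp: offscale_def flip_def field_simps)

lemma pos_def_offscale:
  assumes K: "pos_def n K" and t: "\<bar>\<tau>\<bar> \<le> 1"
  shows "pos_def n (offscale m \<tau> K)"
  unfolding pos_def_def
proof safe
  fix v i assume i: "i < n" "v i \<noteq> (0::real)"
  have a: "0 < bilin n K v v" by (rule pos_def_pos[OF K i(1)]) (rule i)
  have b: "0 < bilin n K (flip m v) (flip m v)"
    by (rule pos_def_pos[OF K i(1)]) (use i in \<open>auto simp: flip_def\<close>)
  show "0 < bilin n (offscale m \<tau> K) v v"
  proof (cases "\<tau> = -1")
    case True thus ?thesis using a b by (simp add: bilin_offscale)
  next
    case False
    hence "0 < (1 + \<tau>) / 2 * bilin n K v v" "0 \<le> (1 - \<tau>) / 2 * bilin n K (flip m v) (flip m v)"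
      using a b t by (auto intro!: mult_pos_pos mult_nonneg_nonneg)
    thus ?thesis unfolding bilin_offscale by linarith
  qed
qed (use pos_def_sym[OF K] in \<open>auto simp: offscale_def\<close>)

lemma bilin_flip_neg: "bilin n K (\<lambda>i. - v i) (\<lambda>i. - v i) = bilin n K v v"
  by (simp add: bilin_def)

text \<open>Each ratio of consecutive leading minors is a minimum of the quadratic form over an affine
  set, hence a concave function of the matrix; it is moreover invariant under the sign flip of one
  block, and the scaled matrix is a convex combination of the matrix and its flipped version.\<close>

lemma fdet_offscale_ge:
  assumes "pos_def n K" and t: "\<bar>\<tau>\<bar> \<le> 1"
  shows "fdet n K \<le> fdet n (offscale m \<tau> K)"
  using assms(1)
proof (induction n)
  case 0
  show ?case by (simp add: fdet_def)
next
  case (Suc n)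
  let ?P = "offscale m \<tau> K"
  have K: "pos_def n K" and P': "pos_def (Suc n) ?P" and P: "pos_def n ?P"
    using Suc.prems pos_def_leading pos_def_offscale t by blast+
  have pos: "0 < fdet n K" "0 < fdet n ?P" using K P by (auto intro: pos_def_fdet_pos)
  obtain z where z: "z n = 1" "fdet (Suc n) ?P = fdet n ?P * bilin (Suc n) ?P z z"
    using leading_ratio(1)[OF P' pos(2)] by blast
  let ?r = "fdet (Suc n) K / fdet n K"
  have r0: "0 < ?r" using pos(1) pos_def_fdet_pos[OF Suc.prems] by simp
  have r: "?r \<le> bilin (Suc n) K y y" if "y n = 1" for y
    using leading_ratio(2)[of n K y, OF Suc.prems pos(1)] that pos(1) by (simp add: field_simps)
  have "?r \<le> bilin (Suc n) K (flip m z) (flip m z)"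
  proof (cases "n < m")
    case True thus ?thesis by (intro r) (simp add: flip_def z)
  next
    case False
    \<comment> \<open>The flip has turned the last coordinate of z into -1. A global change of sign
      restores the normalisation and leaves the quadratic form unchanged.\<close>
    have "?r \<le> bilin (Suc n) K (\<lambda>i. - flip m z i) (\<lambda>i. - flip m z i)"
      by (intro r) (simp add: flip_def z False)
    thus ?thesis by (simp only: bilin_flip_neg)
  qed
  hence "(1 - \<tau>) / 2 * ?r \<le> (1 - \<tau>) / 2 * bilin (Suc n) K (flip m z) (flip m z)"
    using t by (intro mult_left_mono) auto
  moreover have "(1 + \<tau>) / 2 * ?r \<le> (1 + \<tau>) / 2 * bilin (Suc n) K z z"
    using t by (intro mult_left_mono r z) auto
  moreover have "?r = (1 - \<tau>) / 2 * ?r + (1 + \<tau>) / 2 * ?r"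
    unfolding distrib_right[symmetric] by (simp add: add_divide_distrib[symmetric])
  ultimately have "?r \<le> bilin (Suc n) ?P z z"
    unfolding bilin_offscale by linarith
  hence "fdet n K * ?r \<le> fdet n ?P * bilin (Suc n) ?P z z"
    using Suc.IH[OF K] pos r0 by (intro mult_mono) auto
  thus ?case using z pos(1) by simp
qed

text \<open>The padded matrix is the direct sum of a principal submatrix and an identity: its form
  at v is the form of K at v cut down to J plus the squares of the other coordinates.\<close>

lemma pos_def_pmask:
  assumes K: "pos_def n K" shows "pos_def n (pmask J K)"
  unfolding pos_def_def
proof safe
  fix v i assume i: "i < n" "v i \<noteq> (0::real)"
  let ?w = "\<lambda>i. if i \<in> J then v i else 0"
  have eq: "bilin n (pmask J K) v v = bilin n K ?w ?w + (\<Sum>i<n. (if i \<in> J then 0 else (v i)\<^sup>2))"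
  proof -
    have "bilin n (pmask J K) v v = (\<Sum>i<n. \<Sum>j<n. ?w i * K i j * ?w j + (if i \<in> J \<or> i \<noteq> j then 0 else (v i)\<^sup>2))"
      unfolding bilin_def by (intro sum.cong refl) (auto simp: pmask_def power2_eq_square)
    also have "\<dots> = bilin n K ?w ?w + (\<Sum>i<n. \<Sum>j<n. (if i \<in> J \<or> i \<noteq> j then 0 else (v i)\<^sup>2))"
      unfolding bilin_def by (simp add: sum.distrib)
    also have "(\<Sum>i<n. \<Sum>j<n. (if i \<in> J \<or> i \<noteq> j then 0 else (v i)\<^sup>2)) =
        (\<Sum>i<n. \<Sum>j<n. if i = j then (if i \<in> J then 0 else (v i)\<^sup>2) else 0)"
      by (intro sum.cong refl) auto
    also have "\<dots> = (\<Sum>i<n. (if i \<in> J then 0 else (v i)\<^sup>2))"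
      by (intro sum.cong refl) (simp add: sum.delta)
    finally show ?thesis .
  qed
  show "0 < bilin n (pmask J K) v v"
  proof (cases "i \<in> J")
    case True
    have "0 < bilin n K ?w ?w" by (rule pos_def_pos[OF K i(1)]) (simp add: True i)
    moreover have "0 \<le> (\<Sum>i<n. (if i \<in> J then 0 else (v i)\<^sup>2))" by (intro sum_nonneg) auto
    ultimately show ?thesis unfolding eq by linarith
  next
    case False
    have "0 < (\<Sum>i<n. (if i \<in> J then 0 else (v i)\<^sup>2))"
      by (rule sum_pos2[of _ i]) (use i False in auto)
    thus ?thesis unfolding eq using pos_def_nonneg[OF K, of ?w] by linarith
  qed
qed (use pos_def_sym[OF K] in \<open>auto simp: pmask_def\<close>)

lemma pmask_offscale: "pmask J (offscale m \<tau> K) = offscale m \<tau> (pmask J K)"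
  by (auto simp: pmask_def offscale_def fun_eq_iff)

lemma offscale_offscale: "offscale m \<sigma> (offscale m \<tau> K) = offscale m (\<sigma> * \<tau>) K"
  by (auto simp: offscale_def fun_eq_iff)

text \<open>Scalings compose, so passing from \<tau> to \<sigma> is a further scaling by \<sigma> /
  \<tau>, to which \<open>fdet_offscale_ge\<close> applies; \<tau> = 0 forces \<sigma> = 0.\<close>

lemma minor_offscale_antimono:
  assumes K: "pos_def n K" and "0 \<le> \<sigma>" "\<sigma> \<le> \<tau>" "\<tau> \<le> 1"
  shows "fdet n (pmask J (offscale m \<tau> K)) \<le> fdet n (pmask J (offscale m \<sigma> K))"
proof (cases "\<tau> = 0")
  case False
  have "pos_def n (pmask J (offscale m \<tau> K))" using assms by (intro pos_def_pmask pos_def_offscale) auto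
  from fdet_offscale_ge[OF this, of "\<sigma> / \<tau>" m]
  show ?thesis using assms False by (simp add: pmask_offscale offscale_offscale)
qed (use assms in auto)

lemma minor_pos: "pos_def n K \<Longrightarrow> 0 < fdet n (pmask J K)"
  by (intro pos_def_fdet_pos pos_def_pmask)

text \<open>The empty set J contributes 1 and all other terms are nonnegative. This keeps the bases
  of the real powers positive.\<close>

lemma lapdet_ge_1:
  assumes "pos_def n K" "\<And>i. i < n \<Longrightarrow> 0 \<le> t i"
  shows "1 \<le> lapdet n K t"
proof -
  have "1 = (\<Sum>J\<in>{{}}. (\<Prod>j\<in>J. t j) * fdet n (pmask J K))"
    by (simp add: pmask_def fdet_diag)
  also have "\<dots> \<le> lapdet n K t" unfolding lapdet_expand
    by (rule sum_mono2) (use assms in \<open>auto intro!: mult_nonneg_nonneg prod_nonneg less_imp_le[OF minor_pos]\<close>)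
  finally show ?thesis .
qed

text \<open>Compares transforms along the whole path with the one at the block diagonal end, hence
  gives bounds uniform in \<tau>.\<close>

lemma lapdet_offscale_le:
  assumes "pos_def n K" "\<And>i. i < n \<Longrightarrow> 0 \<le> t i" "0 \<le> \<tau>" "\<tau> \<le> 1"
  shows "lapdet n (offscale m \<tau> K) t \<le> lapdet n (offscale m 0 K) t"
  unfolding lapdet_expand
  by (intro sum_mono mult_left_mono minor_offscale_antimono prod_nonneg) (use assms in auto)

section \<open>Schur complements and coercivity\<close>

lemma schur_pos_def:
  assumes Q: "pos_def (Suc s) Q"
  defines "a \<equiv> \<lambda>i. Q i s / sqrt (Q s s)"
  shows "0 < Q s s" "pos_def s (\<lambda>i j. Q i j - a i * a j)"
    "i < Suc s \<Longrightarrow> a i * a s = Q i s" 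
proof -
  let ?e = "\<lambda>i. if i = s then 1 else 0::real"
  have "0 < bilin (Suc s) Q ?e ?e" by (rule pos_def_pos[OF Q, of s]) auto
  also have "bilin (Suc s) Q ?e ?e = Q s s" by (simp add: bilin_def)
  finally show qs: "0 < Q s s" .
  show "i < Suc s \<Longrightarrow> a i * a s = Q i s" using qs by (simp add: a_def)
  show "pos_def s (\<lambda>i j. Q i j - a i * a j)"
    unfolding pos_def_def
  proof safe
    fix v i assume i: "i < s" "v i \<noteq> (0::real)"
    define L where "L = (\<Sum>i<s. v i * Q i s)"
    \<comment> \<open>The last coordinate that minimises the form of Q once the first s coordinates
      are v; the minimum is the form of the Schur complement.\<close>
    define c where "c = - L / Q s s"
    define w where "w i = (if i < s then v i else c)" for i
    have w: "w i = v i" if "i < s" for i using that by (simp add: w_def)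
    have ws: "w s = c" by (simp add: w_def)
    have "0 < bilin (Suc s) Q w w" by (rule pos_def_pos[OF Q, of i]) (use i in \<open>auto simp: w_def\<close>)
    also have "\<dots> = bilin s Q v v + (\<Sum>i<s. v i * Q i s * c) + (\<Sum>j<s. c * Q s j * v j) + c * Q s s * c"
      by (simp add: bilin_def w ws sum.distrib)
    also have "(\<Sum>j<s. c * Q s j * v j) = (\<Sum>i<s. v i * Q i s * c)"
      by (intro sum.cong refl) (use pos_def_sym[OF Q] in simp)
    also have "(\<Sum>i<s. v i * Q i s * c) = L * c" by (simp add: L_def sum_distrib_right)
    also have "bilin s Q v v + L * c + L * c + c * Q s s * c = bilin s Q v v - L * L / Q s s"
      using qs by (simp add: c_def field_simps)
    also have "\<dots> = bilin s (\<lambda>i j. Q i j - a i * a j) v v"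
    proof -
      have "bilin s (\<lambda>i j. a i * a j) v v = L * L / Q s s"
        using qs unfolding bilin_def L_def sum_product sum_divide_distrib
        by (intro sum.cong refl) (simp add: a_def field_simps)
      moreover have "bilin s (\<lambda>i j. Q i j - a i * a j) v v = bilin s Q v v - bilin s (\<lambda>i j. a i * a j) v v"
        unfolding bilin_def by (simp add: algebra_simps sum_subtractf)
      ultimately show ?thesis by simp
    qed
    finally show "0 < bilin s (\<lambda>i j. Q i j - a i * a j) v v" .
  qed (use pos_def_sym[OF Q] in \<open>auto simp: algebra_simps\<close>)
qed

text \<open>One rank-one summand is peeled off and the support shrinks by one index, as an identity
  between functions on all indices. The size n of the random vectors can therefore stay fixed in the
  recursions on s.\<close>

lemma schur_support:
  assumes Q: "pos_def (Suc s) Q" and z: "\<And>i j. Suc s \<le> i \<or> Suc s \<le> j \<Longrightarrow> Q i j = 0"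
  shows "\<exists>a Q'. pos_def s Q' \<and> (\<forall>i j. s \<le> i \<or> s \<le> j \<longrightarrow> Q' i j = 0) \<and> Q = (\<lambda>i j. Q' i j + a i * a j)"
proof -
  define a where "a i = (if i \<le> s then Q i s / sqrt (Q s s) else 0)" for i
  define Q' where "Q' i j = Q i j - a i * a j" for i j
  note S = schur_pos_def[OF Q]
  have "pos_def s (\<lambda>i j. Q i j - Q i s / sqrt (Q s s) * (Q j s / sqrt (Q s s)))" by (rule S(2))
  hence pos_def: "pos_def s Q'"
    by (auto simp: pos_def_def bilin_def Q'_def a_def)
  have "Q' i j = 0" if ij: "s \<le> i \<or> s \<le> j" for i j
  proof (cases "i < Suc s \<and> j < Suc s")
    case True
    show ?thesis
    proof (cases "j = s")
      case j: True thus ?thesis using S(3)[of i] True by (simp add: Q'_def a_def)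
    next
      case False
      hence "i = s" using ij True by auto
      thus ?thesis using S(3)[of j] True pos_def_sym[OF Q, of s j]
        by (simp add: Q'_def a_def mult.commute)
    qed
  next
    case False
    thus ?thesis using z[of i j] by (auto simp: Q'_def a_def)
  qed
  moreover have "Q = (\<lambda>i j. Q' i j + a i * a j)" by (simp add: Q'_def fun_eq_iff)
  ultimately show ?thesis using pos_def by blast
qed

text \<open>Induction by Schur complements in place of compactness of the unit sphere: with the last
  variable completed to a square, the form is X + Y, where X controls the first s coordinates and Y
  is the square of a linear form containing the last one.\<close>

lemma pos_def_coercive:
  assumes "pos_def n Q" shows "\<exists>\<epsilon>>0. \<forall>v. \<epsilon> * (\<Sum>i<n. (v i)\<^sup>2) \<le> bilin n Q v v"
  using assms
proof (induction n arbitrary: Q)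
  case 0
  show ?case by (intro exI[of _ 1]) (simp add: bilin_def)
next
  case (Suc s)
  define a where "a i = Q i s / sqrt (Q s s)" for i
  note S = schur_pos_def[OF Suc.prems, folded a_def]
  have as: "a s * a s = Q s s" "a s \<noteq> 0" using S(1) by (simp_all add: a_def)
  obtain e where e: "e > 0" "\<And>v. e * (\<Sum>i<s. (v i)\<^sup>2) \<le> bilin s (\<lambda>i j. Q i j - a i * a j) v v"
    using Suc.IH[OF S(2)] by blast
  define A where "A = (\<Sum>i<s. (a i)\<^sup>2)"
  have A0: "0 \<le> A" by (simp add: A_def sum_nonneg)
  \<comment> \<open>The sum of the coefficients of X and Y in the final bound, which come from N
    \<le> X / e and (a_s v_s)^2 \<le> 2 Y + 2 l^2 with l^2 \<le> A N.\<close>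
  define C where "C = 1 / e + 2 / Q s s + 2 * A / (Q s s * e)"
  have C0: "C > 0" using e(1) S(1) A0 by (simp add: C_def add_pos_nonneg)
  have "(\<Sum>i<Suc s. (v i)\<^sup>2) \<le> C * bilin (Suc s) Q v v" for v
  proof -
    define X where "X = bilin s (\<lambda>i j. Q i j - a i * a j) v v"
    define N where "N = (\<Sum>i<s. (v i)\<^sup>2)"
    define l where "l = (\<Sum>i<s. a i * v i)"
    define Y where "Y = (l + a s * v s)\<^sup>2"
    have bilin: "bilin (Suc s) Q v v = X + Y"
    proof -
      have "bilin (Suc s) (\<lambda>i j. a i * a j) v v = (\<Sum>i<Suc s. a i * v i) * (\<Sum>i<Suc s. a i * v i)"
        unfolding bilin_def sum_product by (intro sum.cong refl) simp
      also have "\<dots> = Y" by (simp add: Y_def l_def power2_eq_square)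
      finally have 1: "bilin (Suc s) (\<lambda>i j. a i * a j) v v = Y" .
      have "bilin (Suc s) (\<lambda>i j. Q i j - a i * a j) v v =
         (\<Sum>i<Suc s. \<Sum>j<Suc s. if i < s \<and> j < s then v i * (Q i j - a i * a j) * v j else 0)"
        unfolding bilin_def
      proof (intro sum.cong refl)
        fix i j assume ij: "i \<in> {..<Suc s}" "j \<in> {..<Suc s}"
        have "Q i j - a i * a j = 0" if "\<not> (i < s \<and> j < s)"
        proof (cases "j = s")
          case True thus ?thesis using S(3)[of i] ij by simp
        next
          case False
          hence "i = s" using that ij by auto
          thus ?thesis using S(3)[of j] ij pos_def_sym[OF Suc.prems, of s j] by (simp add: mult.commute)
        qed
        thus "v i * (Q i j - a i * a j) * v j = (if i < s \<and> j < s then v i * (Q i j - a i * a j) * v j else 0)"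
          by simp
      qed
      also have "\<dots> = X" by (simp add: X_def bilin_def)
      finally have 2: "bilin (Suc s) (\<lambda>i j. Q i j - a i * a j) v v = X" .
      have "bilin (Suc s) Q v v = bilin (Suc s) (\<lambda>i j. Q i j - a i * a j) v v + bilin (Suc s) (\<lambda>i j. a i * a j) v v"
        unfolding bilin_def sum.distrib[symmetric] by (intro sum.cong refl) (simp add: algebra_simps)
      thus ?thesis using 1 2 by simp
    qed
    have XN: "N \<le> X / e" using e(2)[of v] e(1) by (simp add: X_def N_def field_simps)
    have X0: "0 \<le> X" using e(1) XN by (smt (verit) N_def divide_neg_pos sum_nonneg zero_le_power2)
    have Y0: "0 \<le> Y" by (simp add: Y_def)
    have l2: "l\<^sup>2 \<le> A * N" unfolding l_def A_def N_def by (rule Cauchy_Schwarz_ineq_sum)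
    have "Q s s * (v s)\<^sup>2 = (a s * v s)\<^sup>2" using as by (simp add: power2_eq_square algebra_simps)
    also have "\<dots> \<le> 2 * Y + 2 * l\<^sup>2"
    proof -
      have "0 \<le> (2 * l + a s * v s)\<^sup>2" by simp
      thus ?thesis unfolding Y_def by (simp add: power2_eq_square algebra_simps)
    qed
    also have "\<dots> \<le> 2 * Y + 2 * (A * (X / e))"
      using l2 XN A0 by (smt (verit) mult_left_mono)
    finally have "(v s)\<^sup>2 \<le> (2 * Y + 2 * (A * (X / e))) / Q s s"
      using S(1) by (simp add: field_simps)
    hence "(\<Sum>i<Suc s. (v i)\<^sup>2) \<le> X / e + (2 * Y + 2 * (A * (X / e))) / Q s s"
      using XN by (simp add: N_def)
    also have "\<dots> = (1 / e + 2 * A / (Q s s * e)) * X + (2 / Q s s) * Y"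
      by (simp add: field_simps add_divide_distrib)
    also have "\<dots> \<le> C * X + C * Y"
      using X0 Y0 A0 e(1) S(1) by (intro add_mono mult_right_mono) (auto simp: C_def)
    finally show ?thesis by (simp add: bilin algebra_simps)
  qed
  thus ?case using C0
    by (intro exI[of _ "1 / C"]) (auto simp: field_simps)
qed

text \<open>Makes room for noise: a Gaussian vector with matrix Q is one with the shrunken matrix
  plus independent isotropic noise of variance \<epsilon>. Half the coercivity constant keeps the
  inequality strict.\<close>

lemma pos_def_shrink:
  assumes Q: "pos_def n Q" shows "\<exists>\<epsilon>>0. pos_def n (\<lambda>i j. Q i j - \<epsilon> * of_bool (i = j))"
proof -
  obtain e where e: "e > 0" "\<And>v. e * (\<Sum>i<n. (v i)\<^sup>2) \<le> bilin n Q v v"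
    using pos_def_coercive[OF Q] by blast
  have "pos_def n (\<lambda>i j. Q i j - e / 2 * of_bool (i = j))"
    unfolding pos_def_def
  proof safe
    fix v i assume i: "i < n" "v i \<noteq> (0::real)"
    have "bilin n (\<lambda>i j. Q i j - e / 2 * of_bool (i = j)) v v
        = (\<Sum>i<n. \<Sum>j<n. v i * Q i j * v j - (if i = j then e / 2 * (v i)\<^sup>2 else 0))"
      unfolding bilin_def by (intro sum.cong refl) (auto simp: algebra_simps power2_eq_square)
    also have "\<dots> = bilin n Q v v - e / 2 * (\<Sum>i<n. (v i)\<^sup>2)"
      by (simp add: bilin_def sum_subtractf sum_distrib_left)
    also have "\<dots> > 0"
    proof -
      have "0 < (\<Sum>i<n. (v i)\<^sup>2)" by (rule sum_pos2[of _ i]) (use i in auto)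
      hence "e / 2 * (\<Sum>i<n. (v i)\<^sup>2) < e * (\<Sum>i<n. (v i)\<^sup>2)" using e(1) by simp
      thus ?thesis using e(2)[of v] by linarith
    qed
    finally show "0 < bilin n (\<lambda>i j. Q i j - e / 2 * of_bool (i = j)) v v" .
  qed (use pos_def_sym[OF Q] in auto)
  thus ?thesis using e(1) by (intro exI[of _ "e / 2"]) auto
qed

text \<open>A vector on which a positive semidefinite form vanishes is orthogonal to all vectors,
  hence in the kernel of R, which a nonzero determinant excludes.\<close>

lemma correlation_pos_def:
  assumes R: "correlation_matrix n R" and d: "det R \<noteq> 0"
  shows "pos_def n (\<lambda>i j. R $$ (i,j))"
proof -
  let ?K = "\<lambda>i j. R $$ (i,j)"
  have Rc: "R \<in> carrier_mat n n" and sym: "\<And>i j. i < n \<Longrightarrow> j < n \<Longrightarrow> R $$ (i,j) = R $$ (j,i)"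
    and psd: "\<And>v. 0 \<le> bilin n ?K v v"
    using R by (auto simp: correlation_matrix_def bilin_def)
  have bs: "\<And>u v. bilin n ?K u v = bilin n ?K v u" by (rule bilin_sym) (rule sym)
  show ?thesis unfolding pos_def_def
  proof safe
    fix v i assume i: "i < n" "v i \<noteq> (0::real)"
    show "0 < bilin n ?K v v"
    proof (rule ccontr)
      assume "\<not> 0 < bilin n ?K v v"
      hence z: "bilin n ?K v v = 0" using psd[of v] by simp
      have orth: "bilin n ?K w v = 0" for w
      proof (rule ccontr)
        assume b: "bilin n ?K w v \<noteq> 0"
        define c where "c = bilin n ?K w v"
        define q where "q = bilin n ?K w w"
        have ge: "0 \<le> 2 * s * c + s\<^sup>2 * q" for s
        proof -
          have "0 \<le> bilin n ?K (\<lambda>i. v i + s * w i) (\<lambda>i. v i + s * w i)" by (rule psd)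
          also have "\<dots> = 2 * s * c + s\<^sup>2 * q"
            unfolding bilin_add_left bilin_add_right bilin_scale_left bilin_scale_right
            using z bs[of v w] by (simp add: c_def q_def power2_eq_square)
          finally show ?thesis .
        qed
        have q0: "0 \<le> q" unfolding q_def by (rule psd)
        \<comment> \<open>A value of s close to the minimiser - c / q; the 1 added to q covers q =
          0.\<close>
        have "0 \<le> 2 * (- c / (q + 1)) * c + (- c / (q + 1))\<^sup>2 * q" by (rule ge)
        also have "\<dots> = - (c\<^sup>2 * (q + 2)) / (q + 1)\<^sup>2"
          using q0 by (simp add: divide_simps power2_eq_square) (simp add: algebra_simps)
        also have "\<dots> < 0" using q0 b by (simp add: c_def divide_neg_pos)
        finally show False by simp
      qed
      have "(\<Sum>j<n. R $$ (k,j) * v j) = 0" if k: "k < n" for k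
      proof -
        have "bilin n ?K (\<lambda>i. of_bool (i = k)) v = (\<Sum>j<n. R $$ (k,j) * v j)"
          unfolding bilin_row using k by (simp add: of_bool_def if_distrib[of "\<lambda>x. x * _"] cong: if_cong)
        thus ?thesis using orth by simp
      qed
      hence "R *\<^sub>v vec n v = 0\<^sub>v n"
        using Rc by (intro eq_vecI) (auto simp: scalar_prod_def atLeast0LessThan)
      moreover have "vec n v \<noteq> 0\<^sub>v n" using i by (metis index_vec index_zero_vec(1))
      ultimately have "det R = 0"
        using det_0_iff_vec_prod_zero[OF Rc] by (metis vec_carrier)
      thus False using d by simp
    qed
  qed (use sym in auto)
qed

section \<open>Rank-one updates and block triangular determinants\<close>

lemma det_mult3:
  fixes A B C :: "real mat"
  assumes "A \<in> carrier_mat n n" "B \<in> carrier_mat n n" "C \<in> carrier_mat n n"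
  shows "det (A * B * C) = det A * det B * det C"
  using assms by (simp add: det_mult[of _ n])

text \<open>Since M N = I, the matrix factors as M (I + x w^T) with x = N u, which leaves a rank-one
  update of the identity.\<close>

lemma fdet_rank_one:
  assumes NM: "\<And>i j. i < n \<Longrightarrow> j < n \<Longrightarrow> (\<Sum>k<n. M i k * N k j) = of_bool (i = j)"
  shows "fdet n (\<lambda>i j. M i j + u i * w j) = fdet n M * (1 + bilin n N w u)"
proof -
  define x where "x i = (\<Sum>k<n. N i k * u k)" for i
  let ?X = "mat n 1 (\<lambda>(i,j). x i)" and ?W = "mat 1 n (\<lambda>(i,j). w j)"
  let ?MM = "mat n n (\<lambda>(i,j). M i j)"
  let ?B = "mat n n (\<lambda>(i,j). of_bool (i = j) + x i * w j)"
  have dB: "det ?B = 1 + (\<Sum>i<n. w i * x i)"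
  proof -
    \<comment> \<open>Bordering by one row and column: \<open>?L\<close> and \<open>?L'\<close> are
      unit triangular, and the product of \<open>?L\<close>, \<open>?C\<close> and
      \<open>?L'\<close> is the block triangular \<open>?U\<close>, so |I + x w^T| = 1 + w^T
      x.\<close>
    let ?Y = "mat 1 n (\<lambda>(i,j). - w j)"
    let ?L = "four_block_mat (1\<^sub>m n) (0\<^sub>m n 1) ?W (1\<^sub>m 1)"
    let ?L' = "four_block_mat (1\<^sub>m n) (0\<^sub>m n 1) ?Y (1\<^sub>m 1)"
    let ?C = "four_block_mat ?B ?X (0\<^sub>m 1 n) (1\<^sub>m 1)"
    let ?U = "four_block_mat (1\<^sub>m n) ?X (0\<^sub>m 1 n) (mat 1 1 (\<lambda>_. 1 + (\<Sum>i<n. w i * x i)))"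
    have c: "?L \<in> carrier_mat (n+1) (n+1)" "?L' \<in> carrier_mat (n+1) (n+1)"
      "?C \<in> carrier_mat (n+1) (n+1)" by auto
    have e1: "?L * ?C = four_block_mat ?B ?X (?W * ?B) (?W * ?X + 1\<^sub>m 1)"
      by (subst mult_four_block_mat[of _ n n _ 1 _ 1]) auto
    have e2: "four_block_mat ?B ?X (?W * ?B) (?W * ?X + 1\<^sub>m 1) * ?L' = ?U"
    proof (subst mult_four_block_mat[of _ n n _ 1 _ 1])
      have XY: "?X * ?Y = mat n n (\<lambda>(i,j). - (x i * w j))"
        by (rule eq_matI) (auto simp: scalar_prod_def)
      have WX: "?W * ?X = mat 1 1 (\<lambda>_. \<Sum>i<n. w i * x i)"
        by (rule eq_matI) (auto simp: scalar_prod_def atLeast0LessThan)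
      have WB: "?W * ?B = mat 1 n (\<lambda>(i,j). w j * (1 + (\<Sum>i<n. w i * x i)))"
      proof (rule eq_matI)
        fix i j assume a: "i < dim_row (mat 1 n (\<lambda>(i,j). w j * (1 + (\<Sum>i<n. w i * x i))))"
          "j < dim_col (mat 1 n (\<lambda>(i,j). w j * (1 + (\<Sum>i<n. w i * x i))))"
        have "(?W * ?B) $$ (i,j) = (\<Sum>k<n. w k * (of_bool (k = j) + x k * w j))"
          using a by (auto simp: scalar_prod_def atLeast0LessThan)
        also have "\<dots> = (\<Sum>k<n. (if k = j then w k else 0)) + (\<Sum>k<n. w k * x k) * w j"
          unfolding sum_distrib_right sum.distrib[symmetric]
          by (intro sum.cong refl) (auto simp: algebra_simps)
        also have "\<dots> = w j * (1 + (\<Sum>i<n. w i * x i))" using a by (simp add: algebra_simps)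
        finally show "(?W * ?B) $$ (i,j) = mat 1 n (\<lambda>(i,j). w j * (1 + (\<Sum>i<n. w i * x i))) $$ (i,j)"
          using a by simp
      qed auto
      have 1: "?B * 1\<^sub>m n + ?X * ?Y = 1\<^sub>m n"
        unfolding XY by (rule eq_matI) auto
      have 2: "?B * 0\<^sub>m n 1 + ?X * 1\<^sub>m 1 = ?X" by (rule eq_matI) auto
      have 3: "?W * ?B * 1\<^sub>m n + (?W * ?X + 1\<^sub>m 1) * ?Y = 0\<^sub>m 1 n"
        unfolding WB WX by (rule eq_matI) (auto simp: scalar_prod_def algebra_simps)
      have 4: "?W * ?B * 0\<^sub>m n 1 + (?W * ?X + 1\<^sub>m 1) * 1\<^sub>m 1 = mat 1 1 (\<lambda>_. 1 + (\<Sum>i<n. w i * x i))"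
        unfolding WB WX by (rule eq_matI) auto
      show "four_block_mat (?B * 1\<^sub>m n + ?X * ?Y) (?B * 0\<^sub>m n 1 + ?X * 1\<^sub>m 1)
         (?W * ?B * 1\<^sub>m n + (?W * ?X + 1\<^sub>m 1) * ?Y) (?W * ?B * 0\<^sub>m n 1 + (?W * ?X + 1\<^sub>m 1) * 1\<^sub>m 1) = ?U"
        unfolding 1 2 3 4 ..
    qed auto
    have e: "?L * ?C * ?L' = ?U" unfolding e1 by (rule e2)
    have L1: "det ?L = 1"
      using det_four_block_mat_upper_right_zero[OF one_carrier_mat refl mat_carrier one_carrier_mat] by (simp only: det_one mult_1)
    have L'1: "det ?L' = 1"
      using det_four_block_mat_upper_right_zero[OF one_carrier_mat refl mat_carrier one_carrier_mat] by (simp only: det_one mult_1)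
    have C1: "det ?C = det ?B"
      using det_four_block_mat_lower_left_zero[OF mat_carrier mat_carrier refl one_carrier_mat] by (simp only: det_one mult_1_right)
    have U1: "det ?U = 1 + (\<Sum>i<n. w i * x i)"
      unfolding det_four_block_mat_lower_left_zero[OF one_carrier_mat mat_carrier refl mat_carrier]
        det_single[OF mat_carrier] by simp
    have "det ?U = det ?L * det ?C * det ?L'"
      unfolding e[symmetric] by (rule det_mult3[OF c(1,3,2)])
    thus ?thesis unfolding L1 L'1 C1 U1 by simp
  qed
  have "mat n n (\<lambda>(i,j). M i j + u i * w j) = ?MM * ?B"
  proof (rule eq_matI)
    fix i j assume ij: "i < dim_row (?MM * ?B)" "j < dim_col (?MM * ?B)"
    hence ij: "i < n" "j < n" by auto
    have "(?MM * ?B) $$ (i,j) = (\<Sum>k<n. M i k * (of_bool (k = j) + x k * w j))"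
      using ij by (auto simp: scalar_prod_def atLeast0LessThan)
    also have "\<dots> = (\<Sum>k<n. (if k = j then M i k else 0)) + (\<Sum>k<n. M i k * x k) * w j"
      unfolding sum_distrib_right sum.distrib[symmetric]
      by (intro sum.cong refl) (auto simp: algebra_simps)
    also have "(\<Sum>k<n. M i k * x k) = (\<Sum>k<n. \<Sum>l<n. M i k * N k l * u l)"
      by (simp add: x_def sum_distrib_left algebra_simps)
    also have "\<dots> = (\<Sum>l<n. \<Sum>k<n. M i k * N k l * u l)" by (rule sum.swap)
    also have "\<dots> = (\<Sum>l<n. of_bool (i = l) * u l)"
      by (intro sum.cong refl) (use ij NM in \<open>simp add: sum_distrib_right[symmetric]\<close>)
    also have "\<dots> = u i" using ij by (simp add: of_bool_def if_distrib[of "\<lambda>x. x * _"] cong: if_cong)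
    finally show "mat n n (\<lambda>(i,j). M i j + u i * w j) $$ (i,j) = (?MM * ?B) $$ (i,j)"
      using ij by simp
  qed auto
  hence "fdet n (\<lambda>i j. M i j + u i * w j) = det ?MM * det ?B"
    unfolding fdet_def by (simp add: det_mult[of _ n])
  moreover have "(\<Sum>i<n. w i * x i) = bilin n N w u"
    by (simp add: bilin_row x_def)
  ultimately show ?thesis by (simp add: dB fdet_def)
qed

lemma fdet_upper_right_zero:
  assumes "\<And>i j. i < k \<Longrightarrow> j < m \<Longrightarrow> A i (k + j) = 0"
  shows "fdet (k + m) A = fdet k A * fdet m (\<lambda>i j. A (k + i) (k + j))"
proof -
  have e: "mat (k + m) (k + m) (\<lambda>(i,j). A i j) =
    four_block_mat (mat k k (\<lambda>(i,j). A i j)) (0\<^sub>m k m) (mat m k (\<lambda>(i,j). A (k + i) j))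
      (mat m m (\<lambda>(i,j). A (k + i) (k + j)))" (is "_ = ?F")
  proof (rule eq_matI)
    fix i j assume "i < dim_row ?F" "j < dim_col ?F"
    thus "mat (k + m) (k + m) (\<lambda>(i,j). A i j) $$ (i,j) = ?F $$ (i,j)"
      using assms[of i "j - k"] by auto
  qed auto
  show ?thesis unfolding fdet_def e
    by (rule det_four_block_mat_upper_right_zero[OF mat_carrier refl mat_carrier mat_carrier])
qed

lemma fdet_lower_left_zero:
  assumes "\<And>i j. i < m \<Longrightarrow> j < k \<Longrightarrow> A (k + i) j = 0"
  shows "fdet (k + m) A = fdet k A * fdet m (\<lambda>i j. A (k + i) (k + j))"
proof -
  have e: "mat (k + m) (k + m) (\<lambda>(i,j). A i j) =
    four_block_mat (mat k k (\<lambda>(i,j). A i j)) (mat k m (\<lambda>(i,j). A i (k + j))) (0\<^sub>m m k)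
      (mat m m (\<lambda>(i,j). A (k + i) (k + j)))" (is "_ = ?F")
  proof (rule eq_matI)
    fix i j assume "i < dim_row ?F" "j < dim_col ?F"
    thus "mat (k + m) (k + m) (\<lambda>(i,j). A i j) $$ (i,j) = ?F $$ (i,j)"
      using assms[of "i - k" j] by auto
  qed auto
  show ?thesis unfolding fdet_def e
    by (rule det_four_block_mat_lower_left_zero[OF mat_carrier mat_carrier refl mat_carrier])
qed

text \<open>Where t vanishes, the columns of I + Q T are unit columns. Together with
  \<open>lapdet_restrict_right\<close> this describes the transforms of the two marginal
  vectors.\<close>

lemma lapdet_restrict_left:
  assumes "\<And>j. j < m \<Longrightarrow> t (k + j) = 0"
  shows "lapdet (k + m) Q t = lapdet k Q t"
proof -
  have "fdet m (\<lambda>i j. of_bool (k + i = k + j) + Q (k + i) (k + j) * t (k + j)) = fdet m (\<lambda>i j. of_bool (i = j))"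
    by (rule fdet_cong) (use assms in auto)
  thus ?thesis unfolding lapdet_def
    by (subst fdet_upper_right_zero) (use assms in \<open>auto simp: fdet_diag\<close>)
qed

lemma lapdet_restrict_right:
  assumes "\<And>j. j < k \<Longrightarrow> t j = 0"
  shows "lapdet (k + m) Q t = lapdet m (\<lambda>i j. Q (k + i) (k + j)) (\<lambda>j. t (k + j))"
proof -
  have "fdet k (\<lambda>i j. of_bool (i = j) + Q i j * t j) = fdet k (\<lambda>i j. of_bool (i = j))"
    by (rule fdet_cong) (use assms in auto)
  thus ?thesis unfolding lapdet_def
    by (subst fdet_lower_left_zero) (use assms in \<open>auto simp: fdet_diag\<close>)
qed

text \<open>I + Q T is block diagonal at \<tau> = 0; the factorisation expresses independence of the
  two blocks.\<close>

lemma lapdet_offscale_0: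
  "lapdet (k + m) (offscale k 0 Q) t = lapdet k Q t * lapdet m (\<lambda>i j. Q (k + i) (k + j)) (\<lambda>j. t (k + j))"
  unfolding lapdet_def
  by (subst fdet_upper_right_zero) (auto simp: offscale_def intro!: arg_cong2[where f="(*)"] fdet_cong)

lemma fdet_2: "fdet 2 A = A 0 0 * A 1 1 - A 0 1 * A 1 0"
proof -
  have "fdet 2 A = fdet 2 (pmask {0,1} A)"
    by (rule fdet_cong) (auto simp: pmask_def)
  thus ?thesis by (simp add: fdet_pair)
qed

lemma lapdet_support_2:
  assumes n: "2 \<le> n" and z: "\<And>i j. 2 \<le> i \<or> 2 \<le> j \<Longrightarrow> Q i j = 0"
  shows "lapdet n Q t = (1 + Q 0 0 * t 0) * (1 + Q 1 1 * t 1) - Q 0 1 * Q 1 0 * t 0 * t 1"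
proof -
  have "lapdet n Q t = lapdet (2 + (n - 2)) Q t" by (simp only: le_add_diff_inverse[OF n])
  also have "\<dots> = lapdet 2 Q t"
  proof -
    have "fdet (n - 2) (\<lambda>i j. of_bool (2 + i = 2 + j) + Q (2 + i) (2 + j) * t (2 + j)) = fdet (n - 2) (\<lambda>i j. of_bool (i = j))"
      by (rule fdet_cong) (use z in auto)
    thus ?thesis unfolding lapdet_def
      by (subst fdet_upper_right_zero) (use z in \<open>auto simp: fdet_diag\<close>)
  qed
  also have "\<dots> = (1 + Q 0 0 * t 0) * (1 + Q 1 1 * t 1) - Q 0 1 * Q 1 0 * t 0 * t 1"
    unfolding lapdet_def fdet_2 by simp
  finally show ?thesis .
qed

text \<open>I + Q T = (I + \<epsilon> T) + (Q - \<epsilon> I) T, and the diagonal matrix I +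
  \<epsilon> T is divided out column by column. The new argument t / (1 + \<epsilon> t) is the one
  that averaging over Gaussian noise of variance \<epsilon> produces in
  \<open>smooth_exp\<close>.\<close>

lemma lapdet_shift_diag:
  assumes "\<And>i. i < n \<Longrightarrow> 0 \<le> t i" "0 < \<epsilon>"
  shows "(\<Prod>i<n. 1 + \<epsilon> * t i) * lapdet n (\<lambda>i j. Q i j - \<epsilon> * of_bool (i = j)) (\<lambda>i. t i / (1 + \<epsilon> * t i)) = lapdet n Q t"
proof -
  have p: "1 + \<epsilon> * t i \<noteq> 0" if "i < n" for i
    using assms(1)[OF that] assms(2) by (smt (verit) mult_nonneg_nonneg)
  have e: "(of_bool (i = j) + (Q i j - \<epsilon> * of_bool (i = j)) * (t j / (1 + \<epsilon> * t j))) * (1 + \<epsilon> * t j) =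
       of_bool (i = j) + Q i j * t j" if "j < n" for i j
    using p[OF that] by (simp add: field_simps)
  show ?thesis unfolding lapdet_def fdet_scale_col[symmetric]
    by (rule fdet_cong) (simp only: e)
qed

section \<open>Gaussian vectors\<close>

lemma
  fixes f :: "'a \<times> 'b \<Rightarrow> real"
  assumes A: "prob_space A" and B: "prob_space B" and f: "f \<in> borel_measurable (A \<Otimes>\<^sub>M B)"
    and bd: "\<And>z. z \<in> space (A \<Otimes>\<^sub>M B) \<Longrightarrow> \<bar>f z\<bar> \<le> C"
  shows integral_pair_fst: "(\<integral>z. f z \<partial>(A \<Otimes>\<^sub>M B)) = (\<integral>x. (\<integral>y. f (x,y) \<partial>B) \<partial>A)"
    and integral_pair_snd: "(\<integral>z. f z \<partial>(A \<Otimes>\<^sub>M B)) = (\<integral>y. (\<integral>x. f (x,y) \<partial>A) \<partial>B)"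
proof -
  interpret A: prob_space A by fact
  interpret B: prob_space B by fact
  interpret AB: pair_prob_space A B ..
  have i: "integrable (A \<Otimes>\<^sub>M B) f"
    using bd by (intro AB.P.integrable_const_bound[of _ C] f AE_I2) auto
  show "(\<integral>z. f z \<partial>(A \<Otimes>\<^sub>M B)) = (\<integral>x. (\<integral>y. f (x,y) \<partial>B) \<partial>A)"
    using AB.integral_fst'[OF i] by simp
  show "(\<integral>z. f z \<partial>(A \<Otimes>\<^sub>M B)) = (\<integral>y. (\<integral>x. f (x,y) \<partial>A) \<partial>B)"
    using AB.integral_snd[of "\<lambda>x y. f (x,y)"] i by simp
qed

lemma prob_space_pair: "prob_space A \<Longrightarrow> prob_space B \<Longrightarrow> prob_space (A \<Otimes>\<^sub>M B)"
proof -
  assume "prob_space A" "prob_space B"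
  interpret A: prob_space A by fact
  interpret B: prob_space B by fact
  interpret AB: pair_prob_space A B ..
  show ?thesis by unfold_locales
qed

definition std_normal :: "real measure" where
  "std_normal = density lborel (\<lambda>x. ennreal (normal_density 0 1 x))"

lemma prob_space_std_normal: "prob_space std_normal"
  unfolding std_normal_def by (rule prob_space_normal_density) simp

lemma sets_std_normal [measurable_cong]: "sets std_normal = sets borel"
  by (simp add: std_normal_def)

text \<open>After completing the square, the integrand against Lebesgue measure is a constant times
  the normal density with mean - B / (1 + A) and variance 1 / (1 + A).\<close>

lemma integral_std_normal_quadratic:
  assumes A: "0 \<le> A"
  shows "(\<integral>x. exp (- (A * x\<^sup>2 + 2 * B * x + C) / 2) \<partial>std_normal) =
     (1 + A) powr (- 1 / 2) * exp (- (C - B\<^sup>2 / (1 + A)) / 2)"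
proof -
  have p: "0 < 1 + A" using A by simp
  have e: "normal_density 0 1 x * exp (- (A * x\<^sup>2 + 2 * B * x + C) / 2) =
     (1 + A) powr (- 1 / 2) * exp (- (C - B\<^sup>2 / (1 + A)) / 2) *
       normal_density (- B / (1 + A)) (1 / sqrt (1 + A)) x" for x
  proof -
    have n1: "normal_density (- B / (1 + A)) (1 / sqrt (1 + A)) x =
      sqrt (1 + A) / sqrt (2 * pi) * exp (- ((1 + A) * (x + B / (1 + A))\<^sup>2) / 2)"
      using p by (simp add: normal_density_def power_divide real_sqrt_divide field_simps)
    have n2: "exp (- x\<^sup>2 / 2) * exp (- (A * x\<^sup>2 + 2 * B * x + C) / 2) =
      exp (- (C - B\<^sup>2 / (1 + A)) / 2) * exp (- ((1 + A) * (x + B / (1 + A))\<^sup>2) / 2)"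
    proof -
      have "(1 + A) * (x + B / (1 + A))\<^sup>2 = (1 + A) * x\<^sup>2 + 2 * B * x + B\<^sup>2 / (1 + A)"
        using p by (simp add: power2_eq_square divide_simps) (simp add: algebra_simps)
      thus ?thesis unfolding exp_add[symmetric]
        by (intro arg_cong[where f=exp]) (simp add: field_simps)
    qed
    have n3: "(1 + A) powr (- 1 / 2) * sqrt (1 + A) = 1"
      using p by (simp add: powr_minus powr_half_sqrt divide_simps)
    have n0: "normal_density 0 1 x = 1 / sqrt (2 * pi) * exp (- x\<^sup>2 / 2)"
      by (simp add: normal_density_def)
    have alg: "c * e1 * e2 = p * e3 * (q * c * e4)" if "e1 * e2 = e3 * e4" "p * q = 1" for c e1 e2 e3 e4 p q :: real
    proof -
      have "p * e3 * (q * c * e4) = (p * q) * c * (e3 * e4)" by (simp only: mult_ac)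
      thus ?thesis using that by (simp add: mult.assoc)
    qed
    show ?thesis unfolding n0 n1 using alg[OF n2 n3, of "1 / sqrt (2 * pi)"] by simp
  qed
  have "(\<integral>x. exp (- (A * x\<^sup>2 + 2 * B * x + C) / 2) \<partial>std_normal) =
    (\<integral>x. normal_density 0 1 x * exp (- (A * x\<^sup>2 + 2 * B * x + C) / 2) \<partial>lborel)"
    unfolding std_normal_def by (subst integral_real_density) auto
  also have "\<dots> = (1 + A) powr (- 1 / 2) * exp (- (C - B\<^sup>2 / (1 + A)) / 2)"
    unfolding e using p by simp
  finally show ?thesis .
qed

text \<open>Here \<open>N\<close> is the inverse of \<open>I + S Q S\<close> with \<open>S\<close> the diagonal matrix of \<open>s\<close>. Scaling by \<open>s\<close>, the square
  root of the argument of the Laplace transform, keeps this matrix symmetric, and the shift \<open>m\<close> is what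
  allows an induction over rank-one summands of \<open>Q\<close>.\<close>

definition gaussian_rv :: "nat \<Rightarrow> (nat \<Rightarrow> nat \<Rightarrow> real) \<Rightarrow> 'a measure \<Rightarrow> (nat \<Rightarrow> 'a \<Rightarrow> real) \<Rightarrow> bool" where
  "gaussian_rv n Q P Z \<longleftrightarrow> prob_space P \<and> (\<forall>i<n. Z i \<in> borel_measurable P) \<and>
     (\<forall>s. \<exists>N. (\<forall>i<n. \<forall>j<n. N i j = N j i) \<and> (\<forall>u. 0 \<le> bilin n N u u) \<and>
        (\<forall>i<n. \<forall>j<n. (\<Sum>k<n. (of_bool (i = k) + s i * Q i k * s k) * N k j) = of_bool (i = j)) \<and>
        0 < fdet n (\<lambda>i j. of_bool (i = j) + s i * Q i j * s j) \<and>
        (\<forall>m. (\<integral>\<omega>. exp (- (\<Sum>i<n. (m i + s i * Z i \<omega>)\<^sup>2) / 2) \<partial>P) =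
            fdet n (\<lambda>i j. of_bool (i = j) + s i * Q i j * s j) powr (- 1 / 2) * exp (- bilin n N m m / 2)))"

lemma gaussian_rv_cong:
  assumes "gaussian_rv n Q P Z" "\<And>i j. i < n \<Longrightarrow> j < n \<Longrightarrow> Q i j = Q' i j"
  shows "gaussian_rv n Q' P Z"
proof -
  have "fdet n (\<lambda>i j. of_bool (i = j) + s i * Q i j * s j) = fdet n (\<lambda>i j. of_bool (i = j) + s i * Q' i j * s j)" for s
    by (rule fdet_cong) (simp add: assms)
  moreover have "(\<Sum>k<n. (of_bool (i = k) + s i * Q i k * s k) * N k j) =
      (\<Sum>k<n. (of_bool (i = k) + s i * Q' i k * s k) * N k j)" if "i < n" for s i j and N :: "nat \<Rightarrow> nat \<Rightarrow> real"
    by (rule sum.cong) (use assms(2) that in auto)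
  ultimately show ?thesis using assms(1) unfolding gaussian_rv_def by simp
qed

lemma gaussian_rvE:
  assumes "gaussian_rv n Q P Z"
  obtains N where "\<And>i j. i < n \<Longrightarrow> j < n \<Longrightarrow> N i j = N j i" "\<And>u. 0 \<le> bilin n N u u"
    "\<And>i j. i < n \<Longrightarrow> j < n \<Longrightarrow> (\<Sum>k<n. (of_bool (i = k) + s i * Q i k * s k) * N k j) = of_bool (i = j)"
    "0 < fdet n (\<lambda>i j. of_bool (i = j) + s i * Q i j * s j)"
    "\<And>m. (\<integral>\<omega>. exp (- (\<Sum>i<n. (m i + s i * Z i \<omega>)\<^sup>2) / 2) \<partial>P) =
        fdet n (\<lambda>i j. of_bool (i = j) + s i * Q i j * s j) powr (- 1 / 2) * exp (- bilin n N m m / 2)"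
  using conjunct2[OF conjunct2[OF assms[unfolded gaussian_rv_def]], THEN spec, of s]
  by (elim exE conjE) (rule that; blast)

lemma gaussian_rv_zero: "gaussian_rv n (\<lambda>i j. 0) std_normal (\<lambda>i \<omega>. 0)"
proof -
  interpret prob_space std_normal by (rule prob_space_std_normal)
  let ?N = "\<lambda>i j. of_bool (i = j) :: real"
  have b: "bilin n ?N u u = (\<Sum>i<n. (u i)\<^sup>2)" for u
  proof -
    have "bilin n ?N u u = (\<Sum>i<n. \<Sum>j<n. if i = j then (u i)\<^sup>2 else 0)"
      unfolding bilin_def by (intro sum.cong refl) (auto simp: power2_eq_square)
    thus ?thesis by simp
  qed
  have c: "(\<Sum>k<n. of_bool (i = k) * of_bool (k = j)) = (of_bool (i = j) :: real)" if "i < n" for i j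
  proof -
    have "(\<Sum>k<n. of_bool (i = k) * of_bool (k = j)) = (\<Sum>k<n. if i = k then of_bool (i = j) else (0::real))"
      by (intro sum.cong refl) auto
    thus ?thesis using that by simp
  qed
  show ?thesis
    unfolding gaussian_rv_def
  proof (intro conjI allI impI exI[of _ ?N])
    show "prob_space std_normal" by (rule prob_space_std_normal)
  qed (auto simp: b c fdet_diag sum_nonneg prob_space)
qed

text \<open>Conditionally on the new coordinate the old formula applies with a shifted mean, and the
  remaining one-dimensional integral of a Gaussian quadratic reproduces the Sherman-Morrison update
  of the inverse together with the rank-one update of the determinant.\<close>

lemma gaussian_rv_add:
  assumes G: "gaussian_rv n Q P Z"
  shows "gaussian_rv n (\<lambda>i j. Q i j + a i * a j) (std_normal \<Otimes>\<^sub>M P) (\<lambda>i \<omega>. Z i (snd \<omega>) + a i * fst \<omega>)"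
proof -
  have P: "prob_space P" and [measurable]: "\<And>i. i < n \<Longrightarrow> Z i \<in> borel_measurable P"
    using G by (auto simp: gaussian_rv_def)
  show ?thesis unfolding gaussian_rv_def
  proof (intro conjI allI impI)
    show "prob_space (std_normal \<Otimes>\<^sub>M P)" by (intro prob_space_pair prob_space_std_normal P)
    show "(\<lambda>\<omega>. Z i (snd \<omega>) + a i * fst \<omega>) \<in> borel_measurable (std_normal \<Otimes>\<^sub>M P)" if "i < n" for i
      using that by measurable
    fix s
    let ?M = "\<lambda>i j. of_bool (i = j) + s i * Q i j * s j"
    let ?M' = "\<lambda>i j. of_bool (i = j) + s i * (Q i j + a i * a j) * s j"
    obtain N where sym: "\<And>i j. i < n \<Longrightarrow> j < n \<Longrightarrow> N i j = N j i" and psd: "\<And>u. 0 \<le> bilin n N u u"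
      and inv: "\<And>i j. i < n \<Longrightarrow> j < n \<Longrightarrow> (\<Sum>k<n. ?M i k * N k j) = of_bool (i = j)"
      and pos: "0 < fdet n ?M"
      and int: "\<And>m. (\<integral>\<omega>. exp (- (\<Sum>i<n. (m i + s i * Z i \<omega>)\<^sup>2) / 2) \<partial>P) =
            fdet n ?M powr (- 1 / 2) * exp (- bilin n N m m / 2)"
      by (rule gaussian_rvE[OF G, of s]) blast
    define b where "b i = s i * a i" for i
    define y where "y i = (\<Sum>j<n. N i j * b j)" for i
    define A where "A = bilin n N b b"
    have A0: "0 \<le> A" unfolding A_def by (rule psd)
    define N' where "N' i j = N i j - y i * y j / (1 + A)" for i j
    have bs: "bilin n N u v = bilin n N v u" for u v by (rule bilin_sym) (rule sym)
    have bly: "bilin n N u b = (\<Sum>i<n. u i * y i)" for u by (simp add: bilin_row y_def)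
    have blN': "bilin n N' u u = bilin n N u u - (bilin n N u b)\<^sup>2 / (1 + A)" for u
    proof -
      have "bilin n N' u u = bilin n N u u - bilin n (\<lambda>i j. y i * y j / (1 + A)) u u"
        unfolding bilin_def N'_def by (simp add: algebra_simps sum_subtractf)
      also have "bilin n (\<lambda>i j. y i * y j / (1 + A)) u u = (bilin n N u b)\<^sup>2 / (1 + A)"
        unfolding bly unfolding bilin_def power2_eq_square sum_product sum_divide_distrib
        by (intro sum.cong refl) simp
      finally show ?thesis .
    qed
    have My: "(\<Sum>k<n. ?M i k * y k) = b i" if i: "i < n" for i
    proof -
      have "(\<Sum>k<n. ?M i k * y k) = (\<Sum>k<n. \<Sum>j<n. ?M i k * N k j * b j)"
        by (simp add: y_def sum_distrib_left mult.assoc)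
      also have "\<dots> = (\<Sum>j<n. (\<Sum>k<n. ?M i k * N k j) * b j)"
        by (subst sum.swap) (simp add: sum_distrib_right)
      also have "\<dots> = (\<Sum>j<n. if i = j then b j else 0)"
        by (intro sum.cong refl) (simp add: inv[OF i])
      finally show ?thesis using i by simp
    qed
    have M': "?M' i j = ?M i j + b i * b j" for i j by (simp add: b_def algebra_simps)
    have det': "fdet n ?M' = fdet n ?M * (1 + A)"
      unfolding M' A_def by (rule fdet_rank_one) (rule inv)
    show "\<exists>N. (\<forall>i<n. \<forall>j<n. N i j = N j i) \<and> (\<forall>u. 0 \<le> bilin n N u u) \<and>
        (\<forall>i<n. \<forall>j<n. (\<Sum>k<n. ?M' i k * N k j) = of_bool (i = j)) \<and> 0 < fdet n ?M' \<and>
        (\<forall>m. (\<integral>\<omega>. exp (- (\<Sum>i<n. (m i + s i * (Z i (snd \<omega>) + a i * fst \<omega>))\<^sup>2) / 2) \<partial>(std_normal \<Otimes>\<^sub>M P)) =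
            fdet n ?M' powr (- 1 / 2) * exp (- bilin n N m m / 2))"
    proof (intro exI[of _ N'] conjI allI impI)
      show "N' i j = N' j i" if "i < n" "j < n" for i j using sym[OF that] by (simp add: N'_def)
      show "0 \<le> bilin n N' u u" for u
      proof -
        \<comment> \<open>This c minimises the form of N at u + c b plus c^2. The minimum is
          \<open>bilin n N' u u\<close>, which is thereby a sum of two nonnegative numbers.\<close>
        define c where "c = - bilin n N u b / (1 + A)"
        have "0 \<le> bilin n N (\<lambda>i. u i + c * b i) (\<lambda>i. u i + c * b i)" by (rule psd)
        also have "\<dots> = bilin n N u u + 2 * c * bilin n N u b + c\<^sup>2 * A"
          unfolding bilin_add_left bilin_add_right bilin_scale_left bilin_scale_right
          using bs[of b u] by (simp add: A_def power2_eq_square)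
        also have "\<dots> = bilin n N' u u - (bilin n N u b)\<^sup>2 / (1 + A)\<^sup>2"
          using A0 by (simp add: blN' c_def power2_eq_square divide_simps) (simp add: algebra_simps)
        finally show ?thesis by (smt (verit) divide_nonneg_nonneg zero_le_power2)
      qed
      show "0 < fdet n ?M'" using pos A0 by (simp add: det')
      show "(\<Sum>k<n. ?M' i k * N' k j) = of_bool (i = j)" if ij: "i < n" "j < n" for i j
      proof -
        have "(\<Sum>k<n. ?M' i k * N' k j) =
            (\<Sum>k<n. ?M i k * N k j) - (\<Sum>k<n. ?M i k * y k) * y j / (1 + A)
              + b i * (\<Sum>k<n. b k * N k j) - b i * (\<Sum>k<n. b k * y k) * y j / (1 + A)"
          unfolding M' N'_def sum_distrib_left sum_distrib_right sum_divide_distrib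
            sum.distrib[symmetric] sum_subtractf[symmetric]
          by (intro sum.cong refl) (simp add: algebra_simps add_divide_distrib diff_divide_distrib)
        also have "(\<Sum>k<n. b k * y k) = A" by (simp add: bly[symmetric] A_def)
        also have "(\<Sum>k<n. b k * N k j) = y j"
          unfolding y_def by (intro sum.cong refl) (use ij sym in \<open>simp add: mult.commute\<close>)
        also have "(\<Sum>k<n. ?M i k * N k j) = of_bool (i = j)" by (rule inv[OF ij])
        also have "(\<Sum>k<n. ?M i k * y k) = b i" by (rule My[OF ij(1)])
        also have "of_bool (i = j) - b i * y j / (1 + A) + b i * y j - b i * A * y j / (1 + A) = of_bool (i = j)"
        proof -
          have "b i * y j / (1 + A) + b i * A * y j / (1 + A) = b i * y j"
            using A0 by (simp add: divide_simps) (simp add: algebra_simps)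
          thus ?thesis by simp
        qed
        finally show ?thesis .
      qed
      fix m
      let ?f = "\<lambda>\<omega>. exp (- (\<Sum>i<n. (m i + s i * (Z i (snd \<omega>) + a i * fst \<omega>))\<^sup>2) / 2)"
      have "(\<integral>\<omega>. ?f \<omega> \<partial>(std_normal \<Otimes>\<^sub>M P)) = (\<integral>x. (\<integral>\<omega>. ?f (x,\<omega>) \<partial>P) \<partial>std_normal)"
        by (rule integral_pair_fst[OF prob_space_std_normal P, where C=1]) (auto intro!: sum_nonneg)
      also have "\<dots> = (\<integral>x. fdet n ?M powr (- 1 / 2) * exp (- (A * x\<^sup>2 + 2 * bilin n N m b * x + bilin n N m m) / 2) \<partial>std_normal)"
      proof (rule Bochner_Integration.integral_cong[OF refl])
        fix x
        have "(\<integral>\<omega>. ?f (x,\<omega>) \<partial>P) = (\<integral>\<omega>. exp (- (\<Sum>i<n. ((m i + x * b i) + s i * Z i \<omega>)\<^sup>2) / 2) \<partial>P)"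
          by (simp add: b_def algebra_simps)
        also have "\<dots> = fdet n ?M powr (- 1 / 2) * exp (- bilin n N (\<lambda>i. m i + x * b i) (\<lambda>i. m i + x * b i) / 2)"
          by (rule int)
        also have "bilin n N (\<lambda>i. m i + x * b i) (\<lambda>i. m i + x * b i) = A * x\<^sup>2 + 2 * bilin n N m b * x + bilin n N m m"
          unfolding bilin_add_left bilin_add_right bilin_scale_left bilin_scale_right
          using bs[of b m] by (simp add: A_def power2_eq_square)
        finally show "(\<integral>\<omega>. ?f (x,\<omega>) \<partial>P) =
          fdet n ?M powr (- 1 / 2) * exp (- (A * x\<^sup>2 + 2 * bilin n N m b * x + bilin n N m m) / 2)" .
      qed
      also have "\<dots> = fdet n ?M powr (- 1 / 2) * ((1 + A) powr (- 1 / 2) * exp (- (bilin n N m m - (bilin n N m b)\<^sup>2 / (1 + A)) / 2))"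
        by (simp only: integral_mult_right_zero integral_std_normal_quadratic[OF A0])
      also have "\<dots> = fdet n ?M' powr (- 1 / 2) * exp (- bilin n N' m m / 2)"
        using pos A0 by (simp add: det' blN' powr_mult)
      finally show "(\<integral>\<omega>. ?f \<omega> \<partial>(std_normal \<Otimes>\<^sub>M P)) = fdet n ?M' powr (- 1 / 2) * exp (- bilin n N' m m / 2)" .
    qed
  qed
qed

text \<open>Each recursion step forms a product space of a new type; passing to the image law on the
  coordinate space returns to the one type quantified in the existence statements.\<close>

lemma gaussian_rv_canonical:
  assumes G: "gaussian_rv n Q P Z"
  shows "gaussian_rv n Q (distr P (PiM {..<n} (\<lambda>_. borel)) (\<lambda>\<omega>. \<lambda>i\<in>{..<n}. Z i \<omega>)) (\<lambda>i x. x i)"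
proof -
  have P: "prob_space P" and [measurable]: "\<And>i. i < n \<Longrightarrow> Z i \<in> borel_measurable P"
    using G by (auto simp: gaussian_rv_def)
  have m: "(\<lambda>\<omega>. \<lambda>i\<in>{..<n}. Z i \<omega>) \<in> measurable P (PiM {..<n} (\<lambda>_. borel))"
    by (rule measurable_restrict) simp
  have c: "(\<lambda>x. x i) \<in> borel_measurable (PiM {..<n} (\<lambda>_. borel :: real measure))" if "i < n" for i
    using that by (intro measurable_component_singleton) auto
  have "(\<integral>x. exp (- (\<Sum>i<n. (m i + s i * x i)\<^sup>2) / 2) \<partial>distr P (PiM {..<n} (\<lambda>_. borel)) (\<lambda>\<omega>. \<lambda>i\<in>{..<n}. Z i \<omega>))
     = (\<integral>\<omega>. exp (- (\<Sum>i<n. (m i + s i * Z i \<omega>)\<^sup>2) / 2) \<partial>P)" for m s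
    by (subst integral_distr[OF m]) (use c in auto)
  thus ?thesis using G m c unfolding gaussian_rv_def
    by (simp add: prob_space.prob_space_distr)
qed

lemma gaussian_rv_exists_support:
  assumes "s \<le> n" "pos_def s Q" "\<And>i j. s \<le> i \<or> s \<le> j \<Longrightarrow> Q i j = 0"
  shows "\<exists>P :: (nat \<Rightarrow> real) measure. \<exists>Z. gaussian_rv n Q P Z"
  using assms
proof (induction s arbitrary: Q)
  case 0
  hence "gaussian_rv n Q std_normal (\<lambda>i \<omega>. 0)"
    by (intro gaussian_rv_cong[OF gaussian_rv_zero]) auto
  thus ?case using gaussian_rv_canonical by blast
next
  case (Suc s)
  obtain a Q' where Q': "pos_def s Q'" "\<And>i j. s \<le> i \<or> s \<le> j \<Longrightarrow> Q' i j = 0" and Q: "Q = (\<lambda>i j. Q' i j + a i * a j)"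
    using schur_support[OF Suc.prems(2)] Suc.prems(3) by blast
  obtain P :: "(nat \<Rightarrow> real) measure" and Z where "gaussian_rv n Q' P Z"
    using Suc.IH[of Q'] Suc.prems(1) Q' by auto
  from gaussian_rv_canonical[OF gaussian_rv_add[OF this, of a]]
  show ?case unfolding Q by blast
qed

lemma gaussian_rv_exists:
  assumes "pos_def n Q"
  shows "\<exists>P :: (nat \<Rightarrow> real) measure. \<exists>Z. gaussian_rv n Q P Z"
proof -
  let ?Q = "\<lambda>i j. if i < n \<and> j < n then Q i j else 0"
  have "pos_def n ?Q" using assms by (auto simp: pos_def_def bilin_def)
  hence "\<exists>P :: (nat \<Rightarrow> real) measure. \<exists>Z. gaussian_rv n ?Q P Z"
    by (intro gaussian_rv_exists_support[of n n ?Q]) auto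
  then obtain P :: "(nat \<Rightarrow> real) measure" and Z where PZ: "gaussian_rv n ?Q P Z" by blast
  have "gaussian_rv n Q P Z" by (rule gaussian_rv_cong[OF PZ]) simp
  thus ?thesis by blast
qed

text \<open>The same number b governs the determinant of the rank-one update and the exponent for
  the vector shifted by l a. This lets a gamma distributed l^2 / 2 turn the exponential into a power
  of 1 + b.\<close>

lemma gaussian_rv_laplace:
  assumes G: "gaussian_rv n Q P Z" and t: "\<And>i. i < n \<Longrightarrow> 0 \<le> t i"
  obtains b where "0 \<le> b" "0 < lapdet n Q t" "lapdet n (\<lambda>i j. Q i j + a i * a j) t = lapdet n Q t * (1 + b)"
    "\<And>l. (\<integral>\<omega>. exp (- (\<Sum>i<n. t i * (a i * l + Z i \<omega>)\<^sup>2) / 2) \<partial>P) = lapdet n Q t powr (- 1 / 2) * exp (- (l\<^sup>2 * b) / 2)"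
proof -
  define s where "s i = sqrt (t i)" for i
  let ?M = "\<lambda>i j. of_bool (i = j) + s i * Q i j * s j"
  obtain N where psd: "\<And>u. 0 \<le> bilin n N u u"
    and inv: "\<And>i j. i < n \<Longrightarrow> j < n \<Longrightarrow> (\<Sum>k<n. ?M i k * N k j) = of_bool (i = j)"
    and pos: "0 < fdet n ?M"
    and int: "\<And>m. (\<integral>\<omega>. exp (- (\<Sum>i<n. (m i + s i * Z i \<omega>)\<^sup>2) / 2) \<partial>P) =
          fdet n ?M powr (- 1 / 2) * exp (- bilin n N m m / 2)"
    by (rule gaussian_rvE[OF G, of s]) blast
  have lap: "lapdet n K t = fdet n (\<lambda>i j. of_bool (i = j) + s i * K i j * s j)" for K
  proof -
    have "lapdet n K t = lapdet n K (\<lambda>i. (s i)\<^sup>2)"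
      by (rule lapdet_cong) (use t in \<open>auto simp: s_def\<close>)
    also have "\<dots> = lapdet n (\<lambda>i j. s i * K i j * s j) (\<lambda>_. 1)" by (rule lapdet_scale[symmetric])
    finally show ?thesis by (simp add: lapdet_def)
  qed
  let ?b = "bilin n N (\<lambda>i. s i * a i) (\<lambda>i. s i * a i)"
  show ?thesis
  proof (rule that[of ?b])
    show "0 \<le> ?b" by (rule psd)
    show "0 < lapdet n Q t" unfolding lap by (rule pos)
    have "(\<lambda>i j. of_bool (i = j) + s i * (Q i j + a i * a j) * s j) = (\<lambda>i j. ?M i j + (s i * a i) * (s j * a j))"
      by (simp add: fun_eq_iff algebra_simps)
    thus "lapdet n (\<lambda>i j. Q i j + a i * a j) t = lapdet n Q t * (1 + ?b)"
      unfolding lap using fdet_rank_one[of n ?M N "\<lambda>i. s i * a i" "\<lambda>i. s i * a i", OF inv] by simp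
    fix l
    have "(\<Sum>i<n. t i * (a i * l + Z i \<omega>)\<^sup>2) = (\<Sum>i<n. (l * (s i * a i) + s i * Z i \<omega>)\<^sup>2)" for \<omega>
    proof (intro sum.cong refl)
      fix i assume "i \<in> {..<n}"
      hence "t i = (s i)\<^sup>2" using t by (simp add: s_def)
      thus "t i * (a i * l + Z i \<omega>)\<^sup>2 = (l * (s i * a i) + s i * Z i \<omega>)\<^sup>2"
        by (simp add: power2_eq_square algebra_simps)
    qed
    hence "(\<integral>\<omega>. exp (- (\<Sum>i<n. t i * (a i * l + Z i \<omega>)\<^sup>2) / 2) \<partial>P) =
        fdet n ?M powr (- 1 / 2) * exp (- bilin n N (\<lambda>i. l * (s i * a i)) (\<lambda>i. l * (s i * a i)) / 2)"
      using int[of "\<lambda>i. l * (s i * a i)"] by simp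
    thus "(\<integral>\<omega>. exp (- (\<Sum>i<n. t i * (a i * l + Z i \<omega>)\<^sup>2) / 2) \<partial>P) = lapdet n Q t powr (- 1 / 2) * exp (- (l\<^sup>2 * ?b) / 2)"
      unfolding bilin_scale_left bilin_scale_right lap by (simp add: power2_eq_square mult.assoc)
  qed
qed

section \<open>Existence of multivariate gamma distributions\<close>

lemma nn_integral_mult_separate:
  fixes f g :: "real \<Rightarrow> ennreal"
  assumes [measurable]: "f \<in> borel_measurable borel" "g \<in> borel_measurable borel"
  shows "(\<integral>\<^sup>+x. (\<integral>\<^sup>+y. f x * g y \<partial>lborel) \<partial>lborel) = (\<integral>\<^sup>+x. f x \<partial>lborel) * (\<integral>\<^sup>+y. g y \<partial>lborel)"
  by (simp add: nn_integral_cmult nn_integral_multc)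

definition gamma_density :: "real \<Rightarrow> real \<Rightarrow> real" where
  "gamma_density \<alpha> u = (if 0 < u then u powr (\<alpha> - 1) * exp (- u) / Gamma \<alpha> else 0)"

lemma borel_measurable_gamma_density [measurable]: "gamma_density \<alpha> \<in> borel_measurable borel"
  unfolding gamma_density_def by measurable

lemma gamma_density_nonneg: "0 < \<alpha> \<Longrightarrow> 0 \<le> gamma_density \<alpha> u"
  using Gamma_real_pos[of \<alpha>] by (simp add: gamma_density_def)

text \<open>The substitution u = v / (1 + b) leads to the Gamma integral; the two integrands differ
  at most at the point 0, a null set.\<close>

lemma nn_integral_gamma_density:
  assumes a: "0 < \<alpha>" and b: "0 \<le> b"
  shows "(\<integral>\<^sup>+u. ennreal (gamma_density \<alpha> u * exp (- b * u)) \<partial>lborel) = ennreal ((1 + b) powr - \<alpha>)"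
proof -
  let ?c = "1 / (1 + b)"
  have c: "0 < ?c" using b by simp
  have G: "0 < Gamma \<alpha>" using a by (rule Gamma_real_pos)
  have e: "?c * (gamma_density \<alpha> (?c * v) * exp (- b * (?c * v))) =
      ((1 + b) powr - \<alpha> / Gamma \<alpha>) * (indicator {0<..} v * v powr (\<alpha> - 1) / exp v)" for v
  proof (cases "0 < v")
    case True
    have "?c * (?c powr (\<alpha> - 1)) = ?c powr \<alpha>"
      using c powr_add[of ?c 1 "\<alpha> - 1"] by simp
    also have "\<dots> = (1 + b) powr - \<alpha>" using b by (simp add: powr_minus_divide powr_divide)
    finally have p: "?c * (?c powr (\<alpha> - 1)) = (1 + b) powr - \<alpha>" .
    have x: "exp (- (?c * v)) * exp (- b * (?c * v)) = 1 / exp v"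
    proof -
      have "- (?c * v) + - b * (?c * v) = - v" using b by (simp add: divide_simps) (simp add: algebra_simps)
      thus ?thesis unfolding exp_add[symmetric] by (simp only: exp_minus inverse_eq_divide)
    qed
    have pm: "(?c * v) powr (\<alpha> - 1) = ?c powr (\<alpha> - 1) * v powr (\<alpha> - 1)" by (rule powr_mult)
    have cv: "0 < ?c * v" using c True by (rule mult_pos_pos)
    have "?c * (gamma_density \<alpha> (?c * v) * exp (- b * (?c * v))) =
        (?c * (?c powr (\<alpha> - 1))) * v powr (\<alpha> - 1) / Gamma \<alpha> * (exp (- (?c * v)) * exp (- b * (?c * v)))"
      unfolding gamma_density_def pm if_P[OF cv] by (simp only: divide_inverse mult_ac)
    thus ?thesis unfolding p x using True by simp
  next
    case False
    hence "\<not> 0 < ?c * v" using c by (simp add: zero_less_divide_iff)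
    thus ?thesis using False by (simp add: gamma_density_def)
  qed
  have "(\<integral>\<^sup>+u. ennreal (gamma_density \<alpha> u * exp (- b * u)) \<partial>lborel) =
      ennreal ?c * (\<integral>\<^sup>+v. ennreal (gamma_density \<alpha> (?c * v) * exp (- b * (?c * v))) \<partial>lborel)"
    using c by (subst nn_integral_real_affine[where c="?c" and t=0]) auto
  also have "\<dots> = (\<integral>\<^sup>+v. ennreal (?c * (gamma_density \<alpha> (?c * v) * exp (- b * (?c * v)))) \<partial>lborel)"
    by (subst ennreal_mult'[OF less_imp_le[OF c]], subst nn_integral_cmult) auto
  also have "\<dots> = (\<integral>\<^sup>+v. ennreal ((1 + b) powr - \<alpha> / Gamma \<alpha>) * ennreal (indicator {0<..} v * v powr (\<alpha> - 1) / exp v) \<partial>lborel)"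
    unfolding e by (intro nn_integral_cong ennreal_mult') (use G in simp)
  also have "\<dots> = ennreal ((1 + b) powr - \<alpha> / Gamma \<alpha>) * (\<integral>\<^sup>+v. ennreal (indicator {0<..} v * v powr (\<alpha> - 1) / exp v) \<partial>lborel)"
    by (rule nn_integral_cmult) measurable
  also have "(\<integral>\<^sup>+v. ennreal (indicator {0<..} v * v powr (\<alpha> - 1) / exp v) \<partial>lborel) =
      (\<integral>\<^sup>+v. ennreal (indicator {0..} v * v powr (\<alpha> - 1) / exp v) \<partial>lborel)"
    by (rule nn_integral_cong_AE) (use AE_lborel_singleton[of 0] in eventually_elim, auto simp: indicator_def)
  also have "\<dots> = ennreal (Gamma \<alpha>)" by (rule Gamma_conv_nn_integral_real[symmetric, OF a])
  also have "ennreal ((1 + b) powr - \<alpha> / Gamma \<alpha>) * ennreal (Gamma \<alpha>) = ennreal ((1 + b) powr - \<alpha>)"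
    using G by (subst ennreal_mult'[symmetric]) auto
  finally show ?thesis .
qed

definition gamma_measure :: "real \<Rightarrow> real measure" where
  "gamma_measure \<alpha> = density lborel (\<lambda>u. ennreal (gamma_density \<alpha> u))"

lemma sets_gamma_measure [measurable_cong]: "sets (gamma_measure \<alpha>) = sets borel"
  by (simp add: gamma_measure_def)

lemma space_gamma_measure [simp]: "space (gamma_measure \<alpha>) = UNIV"
  by (simp add: gamma_measure_def)

lemma prob_space_gamma_measure: "0 < \<alpha> \<Longrightarrow> prob_space (gamma_measure \<alpha>)"
  using nn_integral_gamma_density[of \<alpha> 0]
  by (intro prob_spaceI) (simp add: gamma_measure_def emeasure_density)

lemma AE_gamma_measure_pos: "AE u in gamma_measure \<alpha>. 0 < u"
  unfolding gamma_measure_def by (subst AE_density) (auto simp: gamma_density_def)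

lemma integral_gamma_measure_exp:
  assumes "0 < \<alpha>" "0 \<le> b"
  shows "(\<integral>u. exp (- b * u) \<partial>gamma_measure \<alpha>) = (1 + b) powr - \<alpha>"
proof -
  have "(\<integral>u. exp (- b * u) \<partial>gamma_measure \<alpha>) = enn2real (\<integral>\<^sup>+u. ennreal (exp (- b * u)) \<partial>gamma_measure \<alpha>)"
    by (rule integral_eq_nn_integral) auto
  also have "(\<integral>\<^sup>+u. ennreal (exp (- b * u)) \<partial>gamma_measure \<alpha>) = (\<integral>\<^sup>+u. ennreal (gamma_density \<alpha> u * exp (- b * u)) \<partial>lborel)"
    unfolding gamma_measure_def
    by (subst nn_integral_density) (auto simp: ennreal_mult' gamma_density_nonneg assms intro!: nn_integral_cong)
  finally show ?thesis by (simp only: nn_integral_gamma_density[OF assms] enn2real_ennreal powr_ge_zero)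
qed

text \<open>Random vectors on an arbitrary space rather than laws on the coordinate space, so that
  convolutions can be written down on product measures. Nonnegativity at every point spares the
  later estimates exceptional null sets.\<close>

definition mgamma_rv :: "nat \<Rightarrow> real \<Rightarrow> (nat \<Rightarrow> nat \<Rightarrow> real) \<Rightarrow> 'a measure \<Rightarrow> (nat \<Rightarrow> 'a \<Rightarrow> real) \<Rightarrow> bool" where
  "mgamma_rv n \<alpha> Q P X \<longleftrightarrow> prob_space P \<and> (\<forall>i<n. X i \<in> borel_measurable P) \<and>
     (\<forall>i<n. \<forall>\<omega>\<in>space P. 0 \<le> X i \<omega>) \<and>
     (\<forall>t. (\<forall>i<n. 0 \<le> t i) \<longrightarrow> (\<integral>\<omega>. exp (- (\<Sum>i<n. t i * X i \<omega>)) \<partial>P) = lapdet n Q t powr - \<alpha>)"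

lemma mgamma_rvD:
  assumes "mgamma_rv n \<alpha> Q P X"
  shows "prob_space P" "\<And>i. i < n \<Longrightarrow> X i \<in> borel_measurable P"
    "\<And>i \<omega>. i < n \<Longrightarrow> \<omega> \<in> space P \<Longrightarrow> 0 \<le> X i \<omega>"
    "\<And>t. (\<And>i. i < n \<Longrightarrow> 0 \<le> t i) \<Longrightarrow> (\<integral>\<omega>. exp (- (\<Sum>i<n. t i * X i \<omega>)) \<partial>P) = lapdet n Q t powr - \<alpha>"
  using assms by (auto simp: mgamma_rv_def)

lemma mgamma_rv_cong:
  assumes "mgamma_rv n \<alpha> Q P X" "\<And>i j. i < n \<Longrightarrow> j < n \<Longrightarrow> Q i j = Q' i j"
  shows "mgamma_rv n \<alpha> Q' P X"
  using assms(1) lapdet_cong[of n Q Q', OF assms(2) refl] unfolding mgamma_rv_def by simp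

text \<open>Points outside the image of X may have negative coordinates; \<open>max 0\<close>
  restores nonnegativity everywhere and changes nothing almost surely.\<close>

lemma mgamma_rv_canonical:
  assumes G: "mgamma_rv n \<alpha> Q P X"
  shows "mgamma_rv n \<alpha> Q (distr P (PiM {..<n} (\<lambda>_. borel)) (\<lambda>\<omega>. \<lambda>i\<in>{..<n}. X i \<omega>)) (\<lambda>i x. max 0 (x i))"
proof -
  note [measurable] = mgamma_rvD(2)[OF G]
  have m: "(\<lambda>\<omega>. \<lambda>i\<in>{..<n}. X i \<omega>) \<in> measurable P (PiM {..<n} (\<lambda>_. borel))"
    by (rule measurable_restrict) simp
  have c: "(\<lambda>x. max 0 (x i)) \<in> borel_measurable (PiM {..<n} (\<lambda>_. borel :: real measure))" if "i < n" for i
    using that by (intro borel_measurable_max measurable_component_singleton) auto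
  have "(\<integral>x. exp (- (\<Sum>i<n. t i * max 0 (x i))) \<partial>distr P (PiM {..<n} (\<lambda>_. borel)) (\<lambda>\<omega>. \<lambda>i\<in>{..<n}. X i \<omega>))
     = (\<integral>\<omega>. exp (- (\<Sum>i<n. t i * X i \<omega>)) \<partial>P)" for t
    by (subst integral_distr[OF m])
       (use c mgamma_rvD(3)[OF G] in \<open>auto simp: max_def intro!: Bochner_Integration.integral_cong sum.cong\<close>)
  thus ?thesis using G m c unfolding mgamma_rv_def
    by (simp add: prob_space.prob_space_distr)
qed

lemma mgamma_rv_convolve:
  assumes X: "mgamma_rv n \<alpha> Q P X" and Y: "mgamma_rv n \<beta> Q P' Y"
  shows "mgamma_rv n (\<alpha> + \<beta>) Q (P \<Otimes>\<^sub>M P') (\<lambda>i \<omega>. X i (fst \<omega>) + Y i (snd \<omega>))"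
  unfolding mgamma_rv_def
proof (intro conjI allI impI ballI)
  note [measurable] = mgamma_rvD(2)[OF X] mgamma_rvD(2)[OF Y]
  show "prob_space (P \<Otimes>\<^sub>M P')" by (intro prob_space_pair mgamma_rvD(1)[OF X] mgamma_rvD(1)[OF Y])
  show "(\<lambda>\<omega>. X i (fst \<omega>) + Y i (snd \<omega>)) \<in> borel_measurable (P \<Otimes>\<^sub>M P')" if "i < n" for i
    using that by measurable
  show "0 \<le> X i (fst \<omega>) + Y i (snd \<omega>)" if "i < n" "\<omega> \<in> space (P \<Otimes>\<^sub>M P')" for i \<omega>
    using that mgamma_rvD(3)[OF X] mgamma_rvD(3)[OF Y] by (auto simp: space_pair_measure)
  fix t :: "nat \<Rightarrow> real" assume t: "\<forall>i<n. 0 \<le> t i"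
  let ?f = "\<lambda>\<omega>. exp (- (\<Sum>i<n. t i * (X i (fst \<omega>) + Y i (snd \<omega>))))"
  have "(\<integral>\<omega>. ?f \<omega> \<partial>(P \<Otimes>\<^sub>M P')) = (\<integral>x. (\<integral>y. ?f (x,y) \<partial>P') \<partial>P)"
    by (rule integral_pair_fst[OF mgamma_rvD(1)[OF X] mgamma_rvD(1)[OF Y], where C=1])
       (use t mgamma_rvD(3)[OF X] mgamma_rvD(3)[OF Y] in
         \<open>auto simp: space_pair_measure intro!: sum_nonneg mult_nonneg_nonneg add_nonneg_nonneg\<close>)
  also have "\<dots> = (\<integral>x. exp (- (\<Sum>i<n. t i * X i x)) * (\<integral>y. exp (- (\<Sum>i<n. t i * Y i y)) \<partial>P') \<partial>P)"
    by (simp add: distrib_left sum.distrib exp_diff exp_minus divide_inverse mult.commute)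
  also have "\<dots> = lapdet n Q t powr - (\<alpha> + \<beta>)"
    using t by (simp add: mgamma_rvD(4)[OF X] mgamma_rvD(4)[OF Y] powr_add[symmetric])
  finally show "(\<integral>\<omega>. ?f \<omega> \<partial>(P \<Otimes>\<^sub>M P')) = lapdet n Q t powr - (\<alpha> + \<beta>)" .
qed

lemma mgamma_rv_half:
  assumes G: "gaussian_rv n Q P Z"
  shows "mgamma_rv n (1 / 2) Q P (\<lambda>i \<omega>. (Z i \<omega>)\<^sup>2 / 2)"
proof -
  have "(\<integral>\<omega>. exp (- (\<Sum>i<n. t i * ((Z i \<omega>)\<^sup>2 / 2))) \<partial>P) = lapdet n Q t powr - (1 / 2)"
    if t: "\<forall>i<n. 0 \<le> t i" for t
  proof -
    obtain b where "\<And>l. (\<integral>\<omega>. exp (- (\<Sum>i<n. t i * (0 * l + Z i \<omega>)\<^sup>2) / 2) \<partial>P) = lapdet n Q t powr (- 1 / 2) * exp (- (l\<^sup>2 * b) / 2)"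
      by (rule gaussian_rv_laplace[OF G, of t "\<lambda>_. 0"]) (use t in auto)
    from this[of 0] show ?thesis by (simp add: sum_divide_distrib)
  qed
  moreover have "prob_space P" "\<And>i. i < n \<Longrightarrow> Z i \<in> borel_measurable P"
    using G by (auto simp: gaussian_rv_def)
  ultimately show ?thesis unfolding mgamma_rv_def by auto
qed

text \<open>Given u, the shifted Gaussian part contributes |I + Q T|^(-1/2) exp (- b u) and X
  contributes |I + Q T|^(-(\<alpha> - 1/2)). Averaging over a gamma variable u of shape \<alpha>
  replaces exp (- b u) by (1 + b)^(-\<alpha>), and |I + Q T| (1 + b) is the determinant for Q + a
  a^T.\<close>

lemma mgamma_rv_add:
  assumes Z: "gaussian_rv n Q PZ Z" and X: "mgamma_rv n (\<alpha> - 1 / 2) Q P X" and \<alpha>: "0 < \<alpha>"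
  shows "mgamma_rv n \<alpha> (\<lambda>i j. Q i j + a i * a j) (gamma_measure \<alpha> \<Otimes>\<^sub>M (PZ \<Otimes>\<^sub>M P))
     (\<lambda>i \<omega>. (a i * sqrt (2 * fst \<omega>) + Z i (fst (snd \<omega>)))\<^sup>2 / 2 + X i (snd (snd \<omega>)))"
  unfolding mgamma_rv_def
proof (intro conjI allI impI ballI)
  have PZ: "prob_space PZ" and [measurable]: "\<And>i. i < n \<Longrightarrow> Z i \<in> borel_measurable PZ"
    using Z by (auto simp: gaussian_rv_def)
  note [measurable] = mgamma_rvD(2)[OF X]
  note PG = prob_space_gamma_measure[OF \<alpha>]
  note PP = prob_space_pair[OF PZ mgamma_rvD(1)[OF X]]
  show "prob_space (gamma_measure \<alpha> \<Otimes>\<^sub>M (PZ \<Otimes>\<^sub>M P))" by (rule prob_space_pair[OF PG PP])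
  show "(\<lambda>\<omega>. (a i * sqrt (2 * fst \<omega>) + Z i (fst (snd \<omega>)))\<^sup>2 / 2 + X i (snd (snd \<omega>))) \<in> borel_measurable (gamma_measure \<alpha> \<Otimes>\<^sub>M (PZ \<Otimes>\<^sub>M P))"
    if "i < n" for i using that by measurable
  show "0 \<le> ((a i * sqrt (2 * fst \<omega>) + Z i (fst (snd \<omega>)))\<^sup>2 / 2 + X i (snd (snd \<omega>)))"
    if "i < n" "\<omega> \<in> space (gamma_measure \<alpha> \<Otimes>\<^sub>M (PZ \<Otimes>\<^sub>M P))" for i \<omega>
    using that mgamma_rvD(3)[OF X] by (auto simp: space_pair_measure)
  fix t :: "nat \<Rightarrow> real" assume t: "\<forall>i<n. 0 \<le> t i"
  obtain b where b: "0 \<le> b" "0 < lapdet n Q t" "lapdet n (\<lambda>i j. Q i j + a i * a j) t = lapdet n Q t * (1 + b)"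
    and int: "\<And>l. (\<integral>\<omega>. exp (- (\<Sum>i<n. t i * (a i * l + Z i \<omega>)\<^sup>2) / 2) \<partial>PZ) = lapdet n Q t powr (- 1 / 2) * exp (- (l\<^sup>2 * b) / 2)"
    by (rule gaussian_rv_laplace[OF Z, of t a]) (use t in auto)
  let ?f = "\<lambda>\<omega>. exp (- (\<Sum>i<n. t i * ((a i * sqrt (2 * fst \<omega>) + Z i (fst (snd \<omega>)))\<^sup>2 / 2 + X i (snd (snd \<omega>)))))"
  have bd: "\<bar>?f (u,z,x)\<bar> \<le> 1" if "x \<in> space P" for u z x
    using that t mgamma_rvD(3)[OF X]
    by (auto intro!: sum_nonneg mult_nonneg_nonneg add_nonneg_nonneg)
  have "(\<integral>\<omega>. ?f \<omega> \<partial>(gamma_measure \<alpha> \<Otimes>\<^sub>M (PZ \<Otimes>\<^sub>M P))) = (\<integral>u. (\<integral>v. ?f (u,v) \<partial>(PZ \<Otimes>\<^sub>M P)) \<partial>gamma_measure \<alpha>)"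
    by (rule integral_pair_fst[OF PG PP, where C=1]) (measurable, use bd in \<open>auto simp: space_pair_measure\<close>)
  also have "\<dots> = (\<integral>u. lapdet n Q t powr - \<alpha> * exp (- b * u) \<partial>gamma_measure \<alpha>)"
  proof (rule integral_cong_AE)
    \<comment> \<open>Only almost everywhere, because (sqrt (2 u))^2 = 2 u fails for negative
      u.\<close>
    show "AE u in gamma_measure \<alpha>. (\<integral>v. ?f (u,v) \<partial>(PZ \<Otimes>\<^sub>M P)) = lapdet n Q t powr - \<alpha> * exp (- b * u)"
      using AE_gamma_measure_pos
    proof eventually_elim
      fix u :: real assume u: "0 < u"
      have mu: "(\<lambda>v. ?f (u,v)) \<in> borel_measurable (PZ \<Otimes>\<^sub>M P)" unfolding fst_conv snd_conv by measurable
      have "(\<integral>v. ?f (u,v) \<partial>(PZ \<Otimes>\<^sub>M P)) = (\<integral>z. (\<integral>x. ?f (u,z,x) \<partial>P) \<partial>PZ)"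
        by (rule integral_pair_fst[OF PZ mgamma_rvD(1)[OF X] mu, where C=1]) (use bd in \<open>auto simp: space_pair_measure\<close>)
      also have "\<dots> = (\<integral>z. exp (- (\<Sum>i<n. t i * (a i * sqrt (2 * u) + Z i z)\<^sup>2) / 2) * (\<integral>x. exp (- (\<Sum>i<n. t i * X i x)) \<partial>P) \<partial>PZ)"
        unfolding integral_mult_right_zero[symmetric] exp_add[symmetric]
        by (simp add: distrib_left sum.distrib sum_divide_distrib)
      also have "\<dots> = lapdet n Q t powr - (\<alpha> - 1 / 2) * (lapdet n Q t powr (- 1 / 2) * exp (- ((sqrt (2 * u))\<^sup>2 * b) / 2))"
      proof -
        have LX: "(\<integral>x. exp (- (\<Sum>i<n. t i * X i x)) \<partial>P) = lapdet n Q t powr - (\<alpha> - 1 / 2)"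
          by (rule mgamma_rvD(4)[OF X]) (use t in auto)
        show ?thesis unfolding LX integral_mult_left_zero int by (rule mult.commute)
      qed
      also have "\<dots> = lapdet n Q t powr - \<alpha> * exp (- b * u)"
        using u b(2) by (simp add: powr_add[symmetric] mult.commute)
      finally show "(\<integral>v. ?f (u,v) \<partial>(PZ \<Otimes>\<^sub>M P)) = lapdet n Q t powr - \<alpha> * exp (- b * u)" .
    qed
    interpret PZP: prob_space "PZ \<Otimes>\<^sub>M P" by (rule PP)
    show "(\<lambda>u. \<integral>v. ?f (u,v) \<partial>(PZ \<Otimes>\<^sub>M P)) \<in> borel_measurable (gamma_measure \<alpha>)"
      by (rule PZP.borel_measurable_lebesgue_integral) measurable
  qed measurable
  also have "\<dots> = lapdet n Q t powr - \<alpha> * (1 + b) powr - \<alpha>"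
    using integral_gamma_measure_exp[OF \<alpha> b(1)] by simp
  also have "\<dots> = lapdet n (\<lambda>i j. Q i j + a i * a j) t powr - \<alpha>"
    using b by (simp add: powr_mult)
  finally show "(\<integral>\<omega>. ?f \<omega> \<partial>(gamma_measure \<alpha> \<Otimes>\<^sub>M (PZ \<Otimes>\<^sub>M P))) = lapdet n (\<lambda>i j. Q i j + a i * a j) t powr - \<alpha>" .
qed

lemma negative_binomial_sums:
  fixes r z \<beta> :: real
  assumes "\<bar>r * z\<bar> < 1"
  shows "(\<lambda>k. (1 - r) powr \<beta> * (pochhammer \<beta> k / fact k) * r ^ k * z ^ k) sums ((1 - r) powr \<beta> * (1 - r * z) powr - \<beta>)"
proof -
  have "(\<lambda>k. (1 - r) powr \<beta> * ((- \<beta> gchoose k) * (- (r * z)) ^ k)) sums ((1 - r) powr \<beta> * (1 + - (r * z)) powr - \<beta>)"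
    by (intro sums_mult gen_binomial_real) (use assms in simp)
  moreover have "(- \<beta> gchoose k) * (- (r * z)) ^ k = (pochhammer \<beta> k / fact k) * r ^ k * z ^ k" for k
    unfolding gbinomial_pochhammer power_minus[of "r * z"] by (simp add: power_mult_distrib power_mult[symmetric])
  ultimately show ?thesis by (simp add: mult.assoc)
qed

text \<open>Kibble's bivariate gamma distribution as a negative binomial mixture of products of gamma
  distributions; unlike the Wishart construction it needs no lower bound on the shape parameter.\<close>

lemma mgamma_rv_kibble:
  assumes n: "2 \<le> n" and z: "\<And>i j. 2 \<le> i \<or> 2 \<le> j \<Longrightarrow> Q i j = 0" and Q: "pos_def 2 Q" and \<beta>: "0 < \<beta>"
  shows "\<exists>P :: (real \<times> real) measure. \<exists>X. mgamma_rv n \<beta> Q P X"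
proof -
  have sym: "Q 1 0 = Q 0 1" using pos_def_sym[OF Q, of 1 0] by simp
  have p1: "0 < Q 1 1"
  proof -
    have "0 < bilin 2 Q (\<lambda>i. if i = 1 then 1 else 0) (\<lambda>i. if i = 1 then 1 else 0)"
      by (rule pos_def_pos[OF Q, of 1]) auto
    thus ?thesis by (simp add: bilin_def numeral_2_eq_2)
  qed
  have p2: "Q 0 1 * Q 0 1 < Q 0 0 * Q 1 1"
  proof -
    have "0 < bilin 2 Q (\<lambda>i. if i = 0 then Q 1 1 else - Q 0 1) (\<lambda>i. if i = 0 then Q 1 1 else - Q 0 1)"
      by (rule pos_def_pos[OF Q, of 0]) (use p1 in auto)
    also have "\<dots> = Q 1 1 * (Q 0 0 * Q 1 1 - Q 0 1 * Q 0 1)"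
      by (simp add: bilin_def numeral_2_eq_2 sym[simplified]) (simp add: algebra_simps)
    finally show ?thesis using p1 by (simp add: zero_less_mult_iff)
  qed
  have p0: "0 < Q 0 0"
    using p2 p1 by (smt (verit) mult_nonneg_nonneg zero_less_mult_pos2 not_square_less_zero)
  \<comment> \<open>The squared correlation of the pair, below 1 by positive definiteness; it is the
    parameter of the negative binomial weights \<open>w\<close>.\<close>
  define r where "r = Q 0 1 * Q 0 1 / (Q 0 0 * Q 1 1)"
  have r: "0 \<le> r" "r < 1" using p0 p1 p2 by (auto simp: r_def divide_simps)
  define w where "w k = (1 - r) powr \<beta> * (pochhammer \<beta> k / fact k) * r ^ k" for k
  have w0: "0 \<le> w k" for k
    using r \<beta> by (auto simp: w_def intro!: mult_nonneg_nonneg divide_nonneg_nonneg pochhammer_nonneg)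
  define g where "g \<omega> = (\<Sum>k. ennreal (w k * gamma_density (\<beta> + k) (fst \<omega>) * gamma_density (\<beta> + k) (snd \<omega>)))" for \<omega>
  have gm [measurable]: "g \<in> borel_measurable (lborel \<Otimes>\<^sub>M lborel)" unfolding g_def by measurable
  define P where "P = density (lborel \<Otimes>\<^sub>M lborel) g"
  have gz: "g (x,y) = 0" if "x \<le> 0 \<or> y \<le> 0" for x y
    using that by (auto simp: g_def gamma_density_def)
  have lap: "(\<integral>\<^sup>+\<omega>. g \<omega> * ennreal (exp (- (s * fst \<omega> + t * snd \<omega>))) \<partial>(lborel \<Otimes>\<^sub>M lborel)) =
      ennreal ((((1 + s) * (1 + t) - r) / (1 - r)) powr - \<beta>)" if st: "0 \<le> s" "0 \<le> t" for s t
  proof -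
    \<comment> \<open>The two gamma transforms of the k-th component multiply to y^(\<beta> + k), so
      the sum over k is the generating function of the weights at y.\<close>
    define y where "y = 1 / ((1 + s) * (1 + t))"
    have y: "0 < y" "y \<le> 1" using st by (auto simp: y_def divide_simps intro!: mult_ge1_I)
    have "0 \<le> r * y" "r * y \<le> r" using r y by (auto simp: mult_left_le)
    hence ry: "\<bar>r * y\<bar> < 1" using r by simp
    have "(\<integral>\<^sup>+\<omega>. g \<omega> * ennreal (exp (- (s * fst \<omega> + t * snd \<omega>))) \<partial>(lborel \<Otimes>\<^sub>M lborel)) =
      (\<integral>\<^sup>+\<omega>. (\<Sum>k. ennreal (w k) * (ennreal (gamma_density (\<beta> + k) (fst \<omega>) * exp (- s * fst \<omega>)) *
          ennreal (gamma_density (\<beta> + k) (snd \<omega>) * exp (- t * snd \<omega>)))) \<partial>(lborel \<Otimes>\<^sub>M lborel))"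
      unfolding g_def ennreal_suminf_multc[symmetric]
      using \<beta> by (intro nn_integral_cong suminf_cong)
        (simp add: w0 gamma_density_nonneg ennreal_mult'[symmetric] ennreal_mult[symmetric] exp_diff exp_minus exp_add field_simps)
    also have "\<dots> = (\<Sum>k. (\<integral>\<^sup>+\<omega>. ennreal (w k) * (ennreal (gamma_density (\<beta> + k) (fst \<omega>) * exp (- s * fst \<omega>)) *
          ennreal (gamma_density (\<beta> + k) (snd \<omega>) * exp (- t * snd \<omega>))) \<partial>(lborel \<Otimes>\<^sub>M lborel)))"
      by (rule nn_integral_suminf) measurable
    also have "\<dots> = (\<Sum>k. ennreal (w k * (y powr \<beta> * y ^ k)))"
    proof (rule suminf_cong)
      fix k :: nat
      have bk: "0 < \<beta> + k" using \<beta> by simp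
      have "(\<integral>\<^sup>+\<omega>. ennreal (w k) * (ennreal (gamma_density (\<beta> + k) (fst \<omega>) * exp (- s * fst \<omega>)) *
          ennreal (gamma_density (\<beta> + k) (snd \<omega>) * exp (- t * snd \<omega>))) \<partial>(lborel \<Otimes>\<^sub>M lborel))
        = ennreal (w k) * (\<integral>\<^sup>+x. (\<integral>\<^sup>+y. ennreal (gamma_density (\<beta> + k) x * exp (- s * x)) *
          ennreal (gamma_density (\<beta> + k) y * exp (- t * y)) \<partial>lborel) \<partial>lborel)"
        by (subst nn_integral_cmult) (measurable, subst lborel.nn_integral_fst[symmetric], measurable)
      also have "\<dots> = ennreal (w k) * (ennreal ((1 + s) powr - (\<beta> + k)) * ennreal ((1 + t) powr - (\<beta> + k)))"
        by (subst nn_integral_mult_separate)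
          (measurable, simp only: nn_integral_gamma_density[OF bk st(1)] nn_integral_gamma_density[OF bk st(2)])
      also have "\<dots> = ennreal (w k * ((1 + s) powr - (\<beta> + k) * (1 + t) powr - (\<beta> + k)))"
        by (simp add: ennreal_mult' w0)
      also have "(1 + s) powr - (\<beta> + k) * (1 + t) powr - (\<beta> + k) = y powr (\<beta> + k)"
        unfolding powr_mult[symmetric] y_def powr_minus_divide powr_divide powr_one_eq_one by (simp add: powr_mult)
      also have "\<dots> = y powr \<beta> * y ^ k" using y by (simp add: powr_add powr_realpow)
      finally show "(\<integral>\<^sup>+\<omega>. ennreal (w k) * (ennreal (gamma_density (\<beta> + k) (fst \<omega>) * exp (- s * fst \<omega>)) *
          ennreal (gamma_density (\<beta> + k) (snd \<omega>) * exp (- t * snd \<omega>))) \<partial>(lborel \<Otimes>\<^sub>M lborel)) = ennreal (w k * (y powr \<beta> * y ^ k))" .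
    qed
    also have "\<dots> = ennreal (y powr \<beta> * ((1 - r) powr \<beta> * (1 - r * y) powr - \<beta>))"
    proof (rule suminf_ennreal_eq)
      show "0 \<le> w k * (y powr \<beta> * y ^ k)" for k using w0 y by simp
      show "(\<lambda>k. w k * (y powr \<beta> * y ^ k)) sums (y powr \<beta> * ((1 - r) powr \<beta> * (1 - r * y) powr - \<beta>))"
        using sums_mult[OF negative_binomial_sums[OF ry, of \<beta>], of "y powr \<beta>"]
        by (simp add: w_def mult_ac)
    qed
    also have "y powr \<beta> * ((1 - r) powr \<beta> * (1 - r * y) powr - \<beta>) = (((1 + s) * (1 + t) - r) / (1 - r)) powr - \<beta>"
    proof -
      have ry1: "0 < 1 - r * y" using ry by linarith
      have "((1 + s) * (1 + t) - r) / (1 - r) = (1 - r * y) / (y * (1 - r))"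
      proof -
        have "y * ((1 + s) * (1 + t)) = 1" using st by (simp add: y_def)
        hence "1 - r * y = y * ((1 + s) * (1 + t) - r)" by (simp add: right_diff_distrib mult.commute)
        thus ?thesis using y by simp
      qed
      hence "(((1 + s) * (1 + t) - r) / (1 - r)) powr - \<beta> = (1 - r * y) powr - \<beta> / (y * (1 - r)) powr - \<beta>"
        using ry1 y r by (simp add: powr_divide)
      also have "\<dots> = (1 - r * y) powr - \<beta> * (y powr \<beta> * (1 - r) powr \<beta>)"
        using y r by (simp add: powr_mult powr_minus divide_simps)
      finally show ?thesis by (simp add: mult_ac)
    qed
    finally show ?thesis .
  qed
  have PP: "prob_space P"
  proof (rule prob_spaceI)
    have "emeasure P (space P) = (\<integral>\<^sup>+\<omega>. 1 \<partial>P)" by simp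
    also have "\<dots> = (\<integral>\<^sup>+\<omega>. g \<omega> * 1 \<partial>(lborel \<Otimes>\<^sub>M lborel))"
      unfolding P_def by (rule nn_integral_density) auto
    finally show "emeasure P (space P) = 1" using lap[of 0 0] r by simp
  qed
  \<comment> \<open>The mixture has marginals of scale 1 / (1 - r), which the factor 1 - r
    compensates; the further coordinates, where Q vanishes, are set to 0.\<close>
  define c where "c i = (if i < 2 then Q i i * (1 - r) else 0)" for i :: nat
  define X where "X i \<omega> = c i * (if i = 0 then max 0 (fst \<omega>) else max 0 (snd \<omega>))" for i :: nat and \<omega> :: "real \<times> real"
  have c0: "0 \<le> c i" for i
    using p0 p1 r by (auto simp: c_def less_2_cases_iff)
  have "mgamma_rv n \<beta> Q P X"
    unfolding mgamma_rv_def
  proof (intro conjI allI impI ballI PP)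
    show "X i \<in> borel_measurable P" for i
      unfolding X_def P_def measurable_density_eq1 by (cases "i = 0") auto
    show "0 \<le> X i \<omega>" for i \<omega> using c0 by (simp add: X_def)
    fix t :: "nat \<Rightarrow> real" assume t: "\<forall>i<n. 0 \<le> t i"
    let ?s = "t 0 * c 0" and ?t = "t 1 * c 1"
    have st: "0 \<le> ?s" "0 \<le> ?t" using t n c0 by auto
    have sum: "(\<Sum>i<n. t i * X i \<omega>) = ?s * max 0 (fst \<omega>) + ?t * max 0 (snd \<omega>)" for \<omega>
    proof -
      have "(\<Sum>i<n. t i * X i \<omega>) = (\<Sum>i<2. t i * X i \<omega>)"
        by (rule sum.mono_neutral_right) (use n in \<open>auto simp: X_def c_def\<close>)
      thus ?thesis by (simp add: numeral_2_eq_2 X_def)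
    qed
    have m: "(\<lambda>\<omega>. exp (- (?s * max 0 (fst \<omega>) + ?t * max 0 (snd \<omega>)))) \<in> borel_measurable (lborel \<Otimes>\<^sub>M lborel)"
      by measurable
    have "(\<integral>\<omega>. exp (- (\<Sum>i<n. t i * X i \<omega>)) \<partial>P) = (\<integral>\<omega>. exp (- (?s * max 0 (fst \<omega>) + ?t * max 0 (snd \<omega>))) \<partial>P)"
      unfolding sum ..
    also have "\<dots> = enn2real (\<integral>\<^sup>+\<omega>. ennreal (exp (- (?s * max 0 (fst \<omega>) + ?t * max 0 (snd \<omega>)))) \<partial>P)"
      by (rule integral_eq_nn_integral) (use m in \<open>auto simp: P_def\<close>)
    also have "(\<integral>\<^sup>+\<omega>. ennreal (exp (- (?s * max 0 (fst \<omega>) + ?t * max 0 (snd \<omega>)))) \<partial>P) =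
        (\<integral>\<^sup>+\<omega>. g \<omega> * ennreal (exp (- (?s * max 0 (fst \<omega>) + ?t * max 0 (snd \<omega>)))) \<partial>(lborel \<Otimes>\<^sub>M lborel))"
      unfolding P_def by (rule nn_integral_density) (use m in measurable)
    also have "\<dots> = (\<integral>\<^sup>+\<omega>. g \<omega> * ennreal (exp (- (?s * fst \<omega> + ?t * snd \<omega>))) \<partial>(lborel \<Otimes>\<^sub>M lborel))"
    proof (rule nn_integral_cong)
      fix \<omega> :: "real \<times> real"
      obtain x y where \<omega>: "\<omega> = (x,y)" by fastforce
      show "g \<omega> * ennreal (exp (- (?s * max 0 (fst \<omega>) + ?t * max 0 (snd \<omega>)))) = g \<omega> * ennreal (exp (- (?s * fst \<omega> + ?t * snd \<omega>)))"
        unfolding \<omega> by (cases "x \<le> 0 \<or> y \<le> 0") (simp_all only: gz mult_zero_left, simp add: max_def)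
    qed
    also have "\<dots> = ennreal ((((1 + ?s) * (1 + ?t) - r) / (1 - r)) powr - \<beta>)" by (rule lap[OF st])
    also have "((1 + ?s) * (1 + ?t) - r) / (1 - r) = lapdet n Q t"
    proof -
      have rr: "r * (Q 0 0 * Q 1 1) = Q 0 1 * Q 0 1" using p0 p1 by (simp add: r_def)
      have "((1 + ?s) * (1 + ?t) - r) / (1 - r) = 1 + Q 0 0 * t 0 + Q 1 1 * t 1 + (Q 0 0 * Q 1 1 - r * (Q 0 0 * Q 1 1)) * t 0 * t 1"
        using r by (simp add: c_def divide_simps) (simp add: algebra_simps)
      moreover have "lapdet n Q t = (1 + Q 0 0 * t 0) * (1 + Q 1 1 * t 1) - Q 0 1 * Q 1 0 * t 0 * t 1"
        by (rule lapdet_support_2[OF n]) (rule z)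
      ultimately show ?thesis unfolding rr sym by (simp add: algebra_simps)
    qed
    finally show "(\<integral>\<omega>. exp (- (\<Sum>i<n. t i * X i \<omega>)) \<partial>P) = lapdet n Q t powr - \<beta>" by simp
  qed
  thus ?thesis by blast
qed

text \<open>Lowering the size by 1 and the shape by 1/2 preserves the bound on the shape, and as
  long as the new size is at least 2 the new shape is positive. The recursion thus reaches size 2
  with some positive shape, which Kibble's distribution covers.\<close>

lemma mgamma_rv_exists_support:
  assumes "2 \<le> s" "s \<le> n" "pos_def s Q" "\<And>i j. s \<le> i \<or> s \<le> j \<Longrightarrow> Q i j = 0" "0 < \<alpha>" "real s - 2 < 2 * \<alpha>"
  shows "\<exists>P :: (nat \<Rightarrow> real) measure. \<exists>X. mgamma_rv n \<alpha> Q P X"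
  using assms
proof (induction s arbitrary: Q \<alpha> rule: dec_induct)
  case base
  then obtain P :: "(real \<times> real) measure" and X where "mgamma_rv n \<alpha> Q P X"
    using mgamma_rv_kibble[of n Q \<alpha>] by blast
  from mgamma_rv_canonical[OF this] show ?case by blast
next
  case (step s)
  obtain a Q' where Q': "pos_def s Q'" "\<And>i j. s \<le> i \<or> s \<le> j \<Longrightarrow> Q' i j = 0" and Q: "Q = (\<lambda>i j. Q' i j + a i * a j)"
    using schur_support[OF step.prems(2)] step.prems(3) by blast
  have "\<exists>P :: (nat \<Rightarrow> real) measure. \<exists>X. mgamma_rv n (\<alpha> - 1 / 2) Q' P X"
    using step.IH[of Q' "\<alpha> - 1 / 2"] step.prems step.hyps Q' by auto
  moreover have "\<exists>P :: (nat \<Rightarrow> real) measure. \<exists>Z. gaussian_rv n Q' P Z"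
    by (rule gaussian_rv_exists_support[of s]) (use step.prems Q' in auto)
  ultimately obtain P PZ :: "(nat \<Rightarrow> real) measure" and X Z
    where "mgamma_rv n (\<alpha> - 1 / 2) Q' P X" "gaussian_rv n Q' PZ Z" by blast
  from mgamma_rv_canonical[OF mgamma_rv_add[OF this(2,1) step.prems(4), of a]]
  show ?case unfolding Q by blast
qed

text \<open>Sums of independent vectors of half squares: the diagonal of a Wishart matrix divided by
  2.\<close>

lemma mgamma_rv_exists_half_integer:
  assumes "pos_def n Q"
  shows "\<exists>P :: (nat \<Rightarrow> real) measure. \<exists>X. mgamma_rv n (real (Suc k) / 2) Q P X"
proof (induction k)
  case 0
  show ?case using gaussian_rv_exists[OF assms] mgamma_rv_half by force
next
  case (Suc k)
  obtain P P' :: "(nat \<Rightarrow> real) measure" and X X' where "mgamma_rv n (real (Suc k) / 2) Q P X" "mgamma_rv n (1 / 2) Q P' X'"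
    using Suc gaussian_rv_exists[OF assms] mgamma_rv_half by metis
  from mgamma_rv_canonical[OF mgamma_rv_convolve[OF this]]
  show ?case by (intro exI) (auto simp: add_divide_distrib add.commute)
qed

theorem mgamma_rv_exists:
  assumes Q: "pos_def n Q" and n: "2 \<le> n" and \<alpha>: "0 < \<alpha>" "2 * \<alpha> \<in> \<nat> \<or> real n - 2 < 2 * \<alpha>"
  shows "\<exists>P :: (nat \<Rightarrow> real) measure. \<exists>X. mgamma_rv n \<alpha> Q P X"
  using \<alpha>(2)
proof
  assume "2 * \<alpha> \<in> \<nat>"
  then obtain m where m: "2 * \<alpha> = real m" by (auto elim: Nats_cases)
  then obtain k where "m = Suc k" using \<alpha>(1) by (cases m) auto
  hence "\<alpha> = real (Suc k) / 2" using m by simp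
  thus ?thesis using mgamma_rv_exists_half_integer[OF Q] by blast
next
  assume a: "real n - 2 < 2 * \<alpha>"
  let ?Q = "\<lambda>i j. if i < n \<and> j < n then Q i j else 0"
  have "pos_def n ?Q" using Q by (auto simp: pos_def_def bilin_def)
  hence "\<exists>P :: (nat \<Rightarrow> real) measure. \<exists>X. mgamma_rv n \<alpha> ?Q P X"
    by (intro mgamma_rv_exists_support[of n n ?Q]) (use n \<alpha> a in auto)
  then obtain P :: "(nat \<Rightarrow> real) measure" and X where "mgamma_rv n \<alpha> ?Q P X" by blast
  from mgamma_rv_cong[OF this, of Q] show ?thesis by auto
qed

section \<open>Exponential sums, distribution functions and uniqueness\<close>

definition expsum :: "nat \<Rightarrow> nat \<Rightarrow> (nat \<Rightarrow> real) \<Rightarrow> real \<Rightarrow> real" where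
  "expsum k m c x = (\<Sum>l\<le>m. c l * exp (- (real k * real l * x)))"

text \<open>The linear extension of exp (- t.x) to L t on products of exponential sums. For L t =
  exp (- t.x) it is the product itself, for a Laplace transform it is the expectation, and it is
  always a finite sum that can be differentiated termwise.\<close>

definition expsum_lap :: "nat \<Rightarrow> nat \<Rightarrow> (nat \<Rightarrow> nat) \<Rightarrow> (nat \<Rightarrow> nat \<Rightarrow> real) \<Rightarrow> ((nat \<Rightarrow> real) \<Rightarrow> real) \<Rightarrow> real" where
  "expsum_lap n k m c L =
     (\<Sum>l\<in>PiE {..<n} (\<lambda>i. {..m i}). (\<Prod>i<n. c i (l i)) * L (\<lambda>i. real k * real (l i)))"

lemma prod_expsum:
  "(\<Prod>i<n. expsum k (m i) (c i) (x i)) =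
     expsum_lap n k m c (\<lambda>t. exp (- (\<Sum>i<n. t i * x i)))"
  unfolding expsum_def expsum_lap_def
  by (subst prod_sum_PiE) (auto simp: prod.distrib exp_sum[symmetric] sum_negf)

lemma expsum_lap_cong:
  assumes "\<And>t. (\<And>i. i < n \<Longrightarrow> 0 \<le> t i) \<Longrightarrow> L t = L' t"
  shows "expsum_lap n k m c L = expsum_lap n k m c L'"
  unfolding expsum_lap_def by (intro sum.cong refl) (simp add: assms)

lemma (in prob_space)
  fixes f :: "(nat \<Rightarrow> real) \<Rightarrow> 'a \<Rightarrow> real"
  assumes "\<And>t. (\<And>i. i < n \<Longrightarrow> 0 \<le> t i) \<Longrightarrow> f t \<in> borel_measurable M"
    and "\<And>t \<omega>. (\<And>i. i < n \<Longrightarrow> 0 \<le> t i) \<Longrightarrow> \<omega> \<in> space M \<Longrightarrow> \<bar>f t \<omega>\<bar> \<le> 1"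
  shows integrable_expsum_lap: "integrable M (\<lambda>\<omega>. expsum_lap n k m c (\<lambda>t. f t \<omega>))"
    and integral_expsum_lap:
      "(\<integral>\<omega>. expsum_lap n k m c (\<lambda>t. f t \<omega>) \<partial>M) = expsum_lap n k m c (\<lambda>t. \<integral>\<omega>. f t \<omega> \<partial>M)"
proof -
  have "integrable M (\<lambda>\<omega>. f t \<omega>)" if "\<And>i. i < n \<Longrightarrow> 0 \<le> t i" for t
    using that assms by (intro integrable_const_bound[of _ 1] AE_I2) auto
  hence i: "integrable M (\<lambda>\<omega>. (\<Prod>i<n. c i (l i)) * f (\<lambda>i. real k * real (l i)) \<omega>)" for l
    by auto
  show "integrable M (\<lambda>\<omega>. expsum_lap n k m c (\<lambda>t. f t \<omega>))"
    unfolding expsum_lap_def by (intro Bochner_Integration.integrable_sum i)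
  show "(\<integral>\<omega>. expsum_lap n k m c (\<lambda>t. f t \<omega>) \<partial>M) = expsum_lap n k m c (\<lambda>t. \<integral>\<omega>. f t \<omega> \<partial>M)"
    unfolding expsum_lap_def by (subst Bochner_Integration.integral_sum[OF i]) simp
qed

lemma mgamma_rv_expsum:
  assumes X: "mgamma_rv n \<alpha> Q P X"
  shows "(\<integral>\<omega>. (\<Prod>i<n. expsum k (m i) (c i) (X i \<omega>)) \<partial>P) =
    expsum_lap n k m c (\<lambda>t. lapdet n Q t powr - \<alpha>)"
proof -
  interpret prob_space P by (rule mgamma_rvD(1)[OF X])
  note [measurable] = mgamma_rvD(2)[OF X]
  have "(\<integral>\<omega>. (\<Prod>i<n. expsum k (m i) (c i) (X i \<omega>)) \<partial>P) =
      expsum_lap n k m c (\<lambda>t. \<integral>\<omega>. exp (- (\<Sum>i<n. t i * X i \<omega>)) \<partial>P)"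
    unfolding prod_expsum
    by (rule integral_expsum_lap) (auto intro!: sum_nonneg mult_nonneg_nonneg mgamma_rvD(3)[OF X])
  also have "\<dots> = expsum_lap n k m c (\<lambda>t. lapdet n Q t powr - \<alpha>)"
    by (rule expsum_lap_cong) (rule mgamma_rvD(4)[OF X])
  finally show ?thesis .
qed

section \<open>Cut-offs approximating the indicator of an interval\<close>

lemma exp_neg_mult_limits:
  assumes "0 < (d::real)"
  shows "(\<lambda>k. exp (- (real k * d))) \<longlonglongrightarrow> 0" "(\<lambda>k. real k * exp (- (real k * d))) \<longlonglongrightarrow> 0"
proof -
  have e: "exp (- (real k * d)) = exp (- d) ^ k" for k
    by (simp add: exp_of_nat_mult[symmetric])
  show "(\<lambda>k. exp (- (real k * d))) \<longlonglongrightarrow> 0" "(\<lambda>k. real k * exp (- (real k * d))) \<longlonglongrightarrow> 0"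
    unfolding e using assms by (auto intro!: LIMSEQ_realpow_zero powser_times_n_limit_0)
qed

text \<open>With y = exp (- k x) and this m, (1 - y)^m is close to exp (- m y), and m y is about k
  exp (k (a - x)). This tends to infinity for x \<le> a and to 0 for x > a; the factor k decides the
  boundary case x = a.\<close>

definition cut_deg :: "nat \<Rightarrow> real \<Rightarrow> nat" where
  "cut_deg k a = nat \<lceil>real k * exp (real k * a)\<rceil>"

definition cut_coeff :: "nat \<Rightarrow> nat \<Rightarrow> real" where
  "cut_coeff m l = of_bool (l = 0) - real (m choose l) * (-1) ^ l"

definition soft_cut :: "nat \<Rightarrow> real \<Rightarrow> real \<Rightarrow> real" where
  "soft_cut k a x = 1 - (1 - exp (- (real k * x))) ^ cut_deg k a"

lemma cut_expsum: "soft_cut k a x = expsum k (cut_deg k a) (cut_coeff (cut_deg k a)) x"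
proof -
  let ?m = "cut_deg k a" and ?y = "exp (- (real k * x))"
  have "(1 - ?y) ^ ?m = (\<Sum>l\<le>?m. real (?m choose l) * (- ?y) ^ l)"
    using binomial_ring[of "- ?y" 1 ?m] by simp
  also have "\<dots> = (\<Sum>l\<le>?m. real (?m choose l) * (-1) ^ l * exp (- (real k * real l * x)))"
    by (intro sum.cong refl, subst power_minus) (simp add: exp_of_nat_mult[symmetric] mult_ac)
  moreover have "1 = (\<Sum>l\<le>?m. of_bool (l = 0) * exp (- (real k * real l * x)))"
  proof -
    have "(\<Sum>l\<le>?m. of_bool (l = 0) * exp (- (real k * real l * x))) = (\<Sum>l\<in>{0}. of_bool (l = 0) * exp (- (real k * real l * x)))"
      by (rule sum.mono_neutral_right) auto
    thus ?thesis by simp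
  qed
  ultimately show ?thesis
    by (simp add: soft_cut_def expsum_def cut_coeff_def left_diff_distrib sum_subtractf)
qed

lemma cut_bounds:
  assumes "0 \<le> x" shows "0 \<le> soft_cut k a x" "soft_cut k a x \<le> 1"
  using assms by (auto simp: soft_cut_def power_le_one)

lemma cut_antimono:
  assumes "0 \<le> x" "x \<le> y" shows "soft_cut k a y \<le> soft_cut k a x"
  using assms unfolding soft_cut_def by (auto intro!: power_mono mult_left_mono)

lemma cut_deg_bounds: "real k * exp (real k * a) \<le> real (cut_deg k a)"
  "real (cut_deg k a) \<le> real k * exp (real k * a) + 1"
proof -
  have "0 \<le> real k * exp (real k * a)" by simp
  thus "real k * exp (real k * a) \<le> real (cut_deg k a)" "real (cut_deg k a) \<le> real k * exp (real k * a) + 1"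
    unfolding cut_deg_def by linarith+
qed

text \<open>With y = exp (- k x): for x \<le> a the power is bounded through 1 - y \<le> exp (- y);
  for x > a Bernoulli's inequality bounds the cut-off by the degree times y.\<close>

lemma cut_limit:
  assumes x: "0 \<le> x" and a: "0 \<le> a"
  shows "(\<lambda>k. soft_cut k a x) \<longlonglongrightarrow> (if x \<le> a then 1 else 0)"
proof (cases "x \<le> a")
  case True
  have ub: "(1 - exp (- (real k * x))) ^ cut_deg k a \<le> exp (- real k)" for k
  proof -
    let ?y = "exp (- (real k * x))"
    have y1: "?y \<le> 1" using x by simp
    have "(1 - ?y) ^ cut_deg k a \<le> exp (- ?y) ^ cut_deg k a"
      using exp_ge_add_one_self[of "- ?y"] y1 by (intro power_mono) auto
    also have "\<dots> = exp (- (real (cut_deg k a) * ?y))"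
      by (simp add: exp_of_nat_mult[symmetric])
    also have "real k \<le> real (cut_deg k a) * ?y"
    proof -
      have "real k * x \<le> real k * a" using True by (intro mult_left_mono) auto
      hence "real k * 1 \<le> real k * (exp (real k * a) * ?y)"
        by (intro mult_left_mono) (auto simp: exp_add[symmetric])
      also have "\<dots> = (real k * exp (real k * a)) * ?y" by simp
      also have "\<dots> \<le> real (cut_deg k a) * ?y"
        by (intro mult_right_mono cut_deg_bounds) simp
      finally show ?thesis by simp
    qed
    hence "exp (- (real (cut_deg k a) * ?y)) \<le> exp (- real k)" by simp
    finally show ?thesis .
  qed
  have "(\<lambda>k. (1 - exp (- (real k * x))) ^ cut_deg k a) \<longlonglongrightarrow> 0"
  proof (rule tendsto_sandwich[where f="\<lambda>_. 0" and h="\<lambda>k. exp (- real k)"])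
    show "(\<lambda>k. exp (- real k)) \<longlonglongrightarrow> 0" using exp_neg_mult_limits(1)[of 1] by simp
  qed (use ub x in \<open>simp_all add: always_eventually\<close>)
  hence "(\<lambda>k. 1 - (1 - exp (- (real k * x))) ^ cut_deg k a) \<longlonglongrightarrow> 1 - 0"
    by (intro tendsto_diff tendsto_const)
  thus ?thesis using True by (simp add: soft_cut_def)
next
  case False
  define d where "d = x - a"
  have d: "0 < d" using False by (simp add: d_def)
  have x0: "0 < x" using False a by simp
  have ub: "soft_cut k a x \<le> real k * exp (- (real k * d)) + exp (- (real k * x))" for k
  proof -
    let ?y = "exp (- (real k * x))"
    have y1: "?y \<le> 1" using x by simp
    have "1 + real (cut_deg k a) * (- ?y) \<le> (1 + - ?y) ^ cut_deg k a"
      by (rule Bernoulli_inequality) (use y1 in linarith)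
    hence "soft_cut k a x \<le> real (cut_deg k a) * ?y" by (simp add: soft_cut_def)
    also have "\<dots> \<le> (real k * exp (real k * a) + 1) * ?y"
      by (intro mult_right_mono cut_deg_bounds) simp
    also have "\<dots> = real k * (exp (real k * a) * ?y) + ?y" by (simp only: distrib_right mult_1 mult.assoc)
    also have "exp (real k * a) * ?y = exp (- (real k * d))"
      unfolding exp_add[symmetric] by (simp add: d_def algebra_simps)
    finally show ?thesis .
  qed
  have "(\<lambda>k. soft_cut k a x) \<longlonglongrightarrow> 0"
  proof (rule tendsto_sandwich[where f="\<lambda>_. 0" and h="\<lambda>k. real k * exp (- (real k * d)) + exp (- (real k * x))"])
    show "(\<lambda>k. real k * exp (- (real k * d)) + exp (- (real k * x))) \<longlonglongrightarrow> 0"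
      using tendsto_add[OF exp_neg_mult_limits(2)[OF d] exp_neg_mult_limits(1)[OF x0]] by simp
  qed (use ub cut_bounds(1)[OF x] in \<open>simp_all add: always_eventually\<close>)
  thus ?thesis using False by simp
qed

text \<open>Depends on the law only through L, so with L a power of \<open>lapdet\<close> it is an
  explicit function of \<tau>, defined without any measure.\<close>

definition cut_lap :: "nat \<Rightarrow> (nat \<Rightarrow> real) \<Rightarrow> nat \<Rightarrow> ((nat \<Rightarrow> real) \<Rightarrow> real) \<Rightarrow> real" where
  "cut_lap n a k L = expsum_lap n k (\<lambda>i. cut_deg k (a i)) (\<lambda>i. cut_coeff (cut_deg k (a i))) L"

lemma mgamma_rv_cut:
  assumes X: "mgamma_rv n \<alpha> Q P X"
  shows "(\<integral>\<omega>. (\<Prod>i<n. soft_cut k (a i) (X i \<omega>)) \<partial>P) = cut_lap n a k (\<lambda>t. lapdet n Q t powr - \<alpha>)"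
  unfolding cut_expsum cut_lap_def by (rule mgamma_rv_expsum[OF X])

text \<open>Dominated convergence with bound 1. As the left side involves the transform only, this
  is an inversion formula for the distribution function.\<close>

lemma cut_lap_limit:
  assumes X: "mgamma_rv n \<alpha> Q P X" and a: "\<And>i. i < n \<Longrightarrow> 0 \<le> a i"
  shows "(\<lambda>k. cut_lap n a k (\<lambda>t. lapdet n Q t powr - \<alpha>)) \<longlonglongrightarrow> measure P {\<omega>\<in>space P. \<forall>i<n. X i \<omega> \<le> a i}"
proof -
  interpret prob_space P by (rule mgamma_rvD(1)[OF X])
  note [measurable] = mgamma_rvD(2)[OF X]
  let ?A = "{\<omega>\<in>space P. \<forall>i<n. X i \<omega> \<le> a i}"
  have ind: "indicator ?A \<omega> = (\<Prod>i<n. if X i \<omega> \<le> a i then 1 else 0 :: real)" if "\<omega> \<in> space P" for \<omega>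
  proof (cases "\<forall>i<n. X i \<omega> \<le> a i")
    case False
    then obtain i where "i < n" "\<not> X i \<omega> \<le> a i" by blast
    hence "(\<Prod>i<n. if X i \<omega> \<le> a i then 1 else 0 :: real) = 0" by (intro prod_zero) auto
    thus ?thesis using False by auto
  qed (use that in auto)
  have [measurable]: "soft_cut k b \<in> borel_measurable borel" for k b
    unfolding soft_cut_def by measurable
  have "(\<lambda>k. \<integral>\<omega>. (\<Prod>i<n. soft_cut k (a i) (X i \<omega>)) \<partial>P) \<longlonglongrightarrow> (\<integral>\<omega>. indicator ?A \<omega> \<partial>P)"
  proof (rule integral_dominated_convergence[where w="\<lambda>_. 1"])
    show "AE \<omega> in P. (\<lambda>k. \<Prod>i<n. soft_cut k (a i) (X i \<omega>)) \<longlonglongrightarrow> indicator ?A \<omega>"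
    proof (rule AE_I2)
      fix \<omega> assume \<omega>: "\<omega> \<in> space P"
      have "(\<lambda>k. \<Prod>i<n. soft_cut k (a i) (X i \<omega>)) \<longlonglongrightarrow> (\<Prod>i<n. if X i \<omega> \<le> a i then 1 else 0)"
        by (intro tendsto_prod cut_limit) (use \<omega> a mgamma_rvD(3)[OF X] in auto)
      thus "(\<lambda>k. \<Prod>i<n. soft_cut k (a i) (X i \<omega>)) \<longlonglongrightarrow> indicator ?A \<omega>" by (simp add: ind[OF \<omega>])
    qed
    show "AE \<omega> in P. norm (\<Prod>i<n. soft_cut k (a i) (X i \<omega>)) \<le> 1" for k
      by (rule AE_I2, unfold real_norm_def abs_prod, rule prod_le_1)
        (use cut_bounds mgamma_rvD(3)[OF X] in \<open>auto simp: abs_le_iff intro: order_trans[of _ 0]\<close>)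
  qed simp_all
  thus ?thesis by (simp add: mgamma_rv_cut[OF X])
qed

section \<open>From random vectors to laws; uniqueness of the law\<close>

lemma is_mgamma_mgamma_rv:
  assumes M: "is_mgamma n \<alpha> Q M" and Q: "Q \<in> carrier_mat n n"
  shows "mgamma_rv n \<alpha> (\<lambda>i j. Q $$ (i,j)) M (\<lambda>i x. max 0 (x i))"
proof -
  have s: "sets M = sets (PiM {..<n} (\<lambda>_. borel))" and P: "prob_space M"
    and nn: "AE x in M. \<forall>i<n. 0 \<le> x i"
    and L: "\<And>t. (\<forall>i<n. 0 \<le> t i) \<Longrightarrow> (\<integral>x. exp (- (\<Sum>i<n. t i * x i)) \<partial>M) = det (1\<^sub>m n + Q * diag_of_fun n t) powr - \<alpha>"
    using M by (auto simp: is_mgamma_def)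
  have c [measurable]: "(\<lambda>x. x i) \<in> borel_measurable M" if "i < n" for i
  proof -
    have "(\<lambda>x. x i) \<in> borel_measurable (PiM {..<n} (\<lambda>_. borel))" using that by simp
    thus ?thesis using measurable_cong_sets[OF s refl] by blast
  qed
  have "(\<integral>x. exp (- (\<Sum>i<n. t i * max 0 (x i))) \<partial>M) = (\<integral>x. exp (- (\<Sum>i<n. t i * x i)) \<partial>M)" for t
  proof (rule integral_cong_AE)
    show "AE x in M. exp (- (\<Sum>i<n. t i * max 0 (x i))) = exp (- (\<Sum>i<n. t i * x i))"
      using nn by eventually_elim (simp add: max_def)
  qed measurable
  thus ?thesis using P L det_lapdet[OF Q] by (simp add: mgamma_rv_def)
qed

lemma mgamma_rv_is_mgamma:
  assumes X: "mgamma_rv n \<alpha> (\<lambda>i j. Q $$ (i,j)) P X" and Q: "Q \<in> carrier_mat n n"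
  shows "is_mgamma n \<alpha> Q (distr P (PiM {..<n} (\<lambda>_. borel)) (\<lambda>\<omega>. \<lambda>i\<in>{..<n}. X i \<omega>))"
proof -
  interpret prob_space P by (rule mgamma_rvD(1)[OF X])
  note [measurable] = mgamma_rvD(2)[OF X]
  have m: "(\<lambda>\<omega>. \<lambda>i\<in>{..<n}. X i \<omega>) \<in> measurable P (PiM {..<n} (\<lambda>_. borel))"
    by (rule measurable_restrict) simp
  have "(\<integral>x. exp (- (\<Sum>i<n. t i * x i)) \<partial>distr P (PiM {..<n} (\<lambda>_. borel)) (\<lambda>\<omega>. \<lambda>i\<in>{..<n}. X i \<omega>)) =
     (\<integral>\<omega>. exp (- (\<Sum>i<n. t i * X i \<omega>)) \<partial>P)" for t
    by (subst integral_distr[OF m]) auto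
  moreover have "AE x in distr P (PiM {..<n} (\<lambda>_. borel)) (\<lambda>\<omega>. \<lambda>i\<in>{..<n}. X i \<omega>). \<forall>i<n. 0 \<le> x i"
    by (subst AE_distr_iff[OF m]) (use mgamma_rvD(3)[OF X] in \<open>auto intro!: AE_I2\<close>)
  ultimately show ?thesis
    using mgamma_rvD(4)[OF X] prob_space_distr[OF m] by (simp add: is_mgamma_def det_lapdet[OF Q])
qed

lemma mgamma_rv_cdf_unique:
  assumes "mgamma_rv n \<alpha> Q P X" "mgamma_rv n \<alpha> Q P' X'" "\<And>i. i < n \<Longrightarrow> 0 \<le> a i"
  shows "measure P {\<omega>\<in>space P. \<forall>i<n. X i \<omega> \<le> a i} = measure P' {\<omega>\<in>space P'. \<forall>i<n. X' i \<omega> \<le> a i}"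
  using LIMSEQ_unique[OF cut_lap_limit[OF assms(1,3)] cut_lap_limit[OF assms(2,3)]] by simp

lemma is_mgamma_box:
  assumes M: "is_mgamma n \<alpha> Q M" and Q: "Q \<in> carrier_mat n n" and X: "mgamma_rv n \<alpha> (\<lambda>i j. Q $$ (i,j)) P X"
    and a: "\<And>i. i < n \<Longrightarrow> 0 \<le> a i"
  shows "measure M {x\<in>space M. \<forall>i<n. x i \<le> a i} = measure P {\<omega>\<in>space P. \<forall>i<n. X i \<omega> \<le> a i}"
proof -
  have "{x\<in>space M. \<forall>i<n. x i \<le> a i} = {x\<in>space M. \<forall>i<n. max 0 (x i) \<le> a i}"
    using a by auto
  thus ?thesis using mgamma_rv_cdf_unique[OF is_mgamma_mgamma_rv[OF M Q] X a] by simp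
qed

text \<open>Lower orthants form the generator closed under intersections on which
  \<open>is_mgamma_unique\<close> compares two measures.\<close>

lemma sets_PiM_borel_boxes:
  fixes n :: nat
  shows "sets (PiM {..<n} (\<lambda>_. borel :: real measure)) =
     sigma_sets (PiE {..<n} (\<lambda>_. UNIV)) {{x \<in> PiE {..<n} (\<lambda>_. UNIV). \<forall>i<n. x i \<le> a i} | a. True}"
proof -
  have cover: "\<exists>S\<subseteq>range (\<lambda>a. {..a :: real}). countable S \<and> UNIV = \<Union>S"
    by (rule exI[of _ "range (\<lambda>k::nat. {..real k})"]) (auto intro: real_arch_simple)
  have "sets (PiM {..<n} (\<lambda>_. borel :: real measure)) = sets (PiM {..<n} (\<lambda>_. sigma UNIV (range (\<lambda>a. {..a :: real}))))"
    by (simp add: borel_eq_atMost)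
  also have "\<dots> = sets (sigma (PiE {..<n} (\<lambda>_. UNIV))
      {{f\<in>PiE {..<n} (\<lambda>_. UNIV). \<forall>i\<in>j. f i \<in> A i} | A j. j \<in> {{..<n}} \<and> A \<in> Pi j (\<lambda>_. range (\<lambda>a. {..a :: real}))})"
  proof (rule sets_PiM_sigma)
    show "\<exists>S\<subseteq>range (\<lambda>a. {..a :: real}). countable S \<and> UNIV = \<Union>S" by (rule cover)
  qed auto
  also have "{{f\<in>PiE {..<n} (\<lambda>_. UNIV). \<forall>i\<in>j. f i \<in> A i} | A j. j \<in> {{..<n}} \<and> A \<in> Pi j (\<lambda>_. range (\<lambda>a. {..a :: real}))} =
      {{x \<in> PiE {..<n} (\<lambda>_. UNIV). \<forall>i<n. x i \<le> a i} | a. True}" (is "?L = ?R")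
  proof safe
    fix A :: "nat \<Rightarrow> real set" assume "A \<in> Pi {..<n} (\<lambda>_. range (\<lambda>a. {..a}))"
    hence "\<forall>i\<in>{..<n}. \<exists>a. A i = {..a}" by auto
    from bchoice[OF this] obtain a where "\<forall>i\<in>{..<n}. A i = {..a i}" by blast
    thus "\<exists>a. {f\<in>PiE {..<n} (\<lambda>_. UNIV). \<forall>i\<in>{..<n}. f i \<in> A i} = {x \<in> PiE {..<n} (\<lambda>_. UNIV). \<forall>i<n. x i \<le> a i} \<and> True"
      by (intro exI[of _ a]) auto
  next
    fix a :: "nat \<Rightarrow> real"
    show "\<exists>A j. {x \<in> PiE {..<n} (\<lambda>_. UNIV). \<forall>i<n. x i \<le> a i} = {f\<in>PiE {..<n} (\<lambda>_. UNIV). \<forall>i\<in>j. f i \<in> A i} \<and>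
        j \<in> {{..<n}} \<and> A \<in> Pi j (\<lambda>_. range (\<lambda>a. {..a :: real}))"
      by (intro exI[of _ "\<lambda>i. {..a i}"] exI[of _ "{..<n}"]) auto
  qed
  also have "sets (sigma (PiE {..<n} (\<lambda>_. UNIV)) ?R) = sigma_sets (PiE {..<n} (\<lambda>_. UNIV)) ?R"
    by (rule sets_measure_of) auto
  finally show ?thesis .
qed

text \<open>Orthants with a negative corner coordinate are null for both measures, since the
  coordinates are nonnegative almost surely; on the others the inversion formula gives equal
  values.\<close>

lemma is_mgamma_unique:
  assumes M: "is_mgamma n \<alpha> Q M" and N: "is_mgamma n \<alpha> Q N" and Q: "Q \<in> carrier_mat n n"
  shows "M = N"
proof -
  let ?\<Omega> = "PiE {..<n} (\<lambda>_. UNIV :: real set)"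
  let ?B = "\<lambda>a. {x \<in> ?\<Omega>. \<forall>i<n. x i \<le> a i}"
  have s: "sets M = sets (PiM {..<n} (\<lambda>_. borel))" "sets N = sets (PiM {..<n} (\<lambda>_. borel))"
    and "prob_space M" "prob_space N"
    and nn: "AE x in M. \<forall>i<n. 0 \<le> x i" "AE x in N. \<forall>i<n. 0 \<le> x i"
    using M N by (auto simp: is_mgamma_def)
  interpret M: prob_space M by fact
  interpret N: prob_space N by fact
  have sp: "space M = ?\<Omega>" "space N = ?\<Omega>"
    using sets_eq_imp_space_eq[OF s(1)] sets_eq_imp_space_eq[OF s(2)] by (simp_all add: space_PiM)
  have null: "emeasure K (?B a) = 0" if K: "AE x in K. \<forall>i<n. 0 \<le> x i" "space K = ?\<Omega>" and "i < n" "a i < 0" for K :: "(nat \<Rightarrow> real) measure" and a i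
  proof -
    have "AE x in K. \<not> (\<forall>i<n. x i \<le> a i)"
      using K(1) by eventually_elim (use that(3,4) in force)
    from emeasure_eq_0_AE[OF this] show ?thesis unfolding K(2) .
  qed
  show ?thesis
  proof (rule measure_eqI_generator_eq[where \<Omega>="?\<Omega>" and E="{?B a | a. True}" and A="\<lambda>k. ?B (\<lambda>_. real k)"])
    show "Int_stable {?B a | a. True}"
    proof (rule Int_stableI)
      fix A B assume "A \<in> {?B a | a. True}" "B \<in> {?B a | a. True}"
      then obtain a b where "A = ?B a" "B = ?B b" by blast
      hence "A \<inter> B = ?B (\<lambda>i. min (a i) (b i))" by auto
      thus "A \<inter> B \<in> {?B a | a. True}" by (intro CollectI exI[of _ "\<lambda>i. min (a i) (b i)"]) simp
    qed
    fix X assume "X \<in> {?B a | a. True}"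
    then obtain a where X: "X = ?B a" by (elim CollectE exE conjE)
    show "emeasure M X = emeasure N X"
    proof -
      show ?thesis
      proof (cases "\<forall>i<n. 0 \<le> a i")
        case True
        have "measure M X = measure N X"
          using is_mgamma_box[OF M Q is_mgamma_mgamma_rv[OF N Q], of a] is_mgamma_box[OF N Q is_mgamma_mgamma_rv[OF N Q], of a] True
          by (simp add: X sp)
        thus ?thesis by (simp add: M.emeasure_eq_measure N.emeasure_eq_measure)
      next
        case False
        then obtain i where "i < n" "a i < 0" by (auto simp: not_le)
        thus ?thesis unfolding X using null[OF nn(1) sp(1), of i a] null[OF nn(2) sp(2), of i a] by simp
      qed
    qed
  next
    show "(\<Union>k. ?B (\<lambda>_. real k)) = ?\<Omega>"
    proof safe
      fix x assume x: "x \<in> ?\<Omega>"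
      obtain k :: nat where "Max (insert 0 (x ` {..<n})) \<le> real k" using real_arch_simple by blast
      moreover have "x i \<le> Max (insert 0 (x ` {..<n}))" if "i < n" for i
        using that by (intro Max_ge) auto
      ultimately have "\<forall>i<n. x i \<le> real k" by (meson order_trans)
      thus "x \<in> (\<Union>k. ?B (\<lambda>_. real k))" using x by (intro UN_I[of k] CollectI conjI) auto
    qed
    show "sets M = sigma_sets ?\<Omega> {?B a | a. True}" "sets N = sigma_sets ?\<Omega> {?B a | a. True}"
      unfolding s sets_PiM_borel_boxes by (rule refl)+
    show "{?B a | a. True} \<subseteq> Pow ?\<Omega>" by auto
    show "range (\<lambda>k. ?B (\<lambda>_. real k)) \<subseteq> {?B a | a. True}"
    proof (rule image_subsetI)
      fix k :: nat
      show "?B (\<lambda>_. real k) \<in> {?B a | a. True}" by (rule CollectI, rule exI[of _ "\<lambda>_. real k"]) simp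
    qed
  qed simp
qed

text \<open>Existence, supplied by X, and uniqueness resolve the definite description in
  \<open>mgamma_cdf\<close>, so that any realisation of the transform may be used to compute
  it.\<close>

theorem mgamma_cdf_eq:
  assumes X: "mgamma_rv n \<alpha> (\<lambda>i j. Q $$ (i,j)) P X" and Q: "Q \<in> carrier_mat n n" and a: "\<And>i. i < n \<Longrightarrow> 0 \<le> a i"
  shows "mgamma_cdf n \<alpha> Q a = measure P {\<omega>\<in>space P. \<forall>i<n. X i \<omega> \<le> a i}"
proof -
  note M = mgamma_rv_is_mgamma[OF X Q]
  have "(THE M. is_mgamma n \<alpha> Q M) = distr P (PiM {..<n} (\<lambda>_. borel)) (\<lambda>\<omega>. \<lambda>i\<in>{..<n}. X i \<omega>)"
  proof (rule the_equality)
    show "is_mgamma n \<alpha> Q (distr P (PiM {..<n} (\<lambda>_. borel)) (\<lambda>\<omega>. \<lambda>i\<in>{..<n}. X i \<omega>))" by (rule M)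
  qed (rule is_mgamma_unique[OF _ M Q])
  thus ?thesis unfolding mgamma_cdf_def Let_def
    using is_mgamma_box[OF M Q X, of a] a by (simp only:)
qed

section \<open>The derivative along the interpolation\<close>

lemma differentiable_prod:
  fixes f :: "'i \<Rightarrow> real \<Rightarrow> real"
  assumes "\<And>i. i \<in> I \<Longrightarrow> f i differentiable (at x)"
  shows "(\<lambda>x. \<Prod>i\<in>I. f i x) differentiable (at x)"
  using assms by (induction I rule: infinite_finite_induct) auto

lemma fdet_offscale_differentiable: "(\<lambda>\<tau>. fdet n (offscale m \<tau> K)) differentiable (at \<tau>)"
proof -
  have "(\<lambda>\<tau>. offscale m \<tau> K i j) differentiable (at \<tau>)" for i j
    by (cases "(i < m) = (j < m)") (auto simp: offscale_def)
  thus ?thesis unfolding fdet_row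
    by (intro differentiable_sum ballI differentiable_mult differentiable_const differentiable_prod)
      (auto simp: finite_permutations)
qed

text \<open>Left as an abstract derivative: its sign follows from monotonicity of the minors, and a
  value is computed for two-element J only.\<close>

definition dminor :: "nat \<Rightarrow> nat \<Rightarrow> (nat \<Rightarrow> nat \<Rightarrow> real) \<Rightarrow> nat set \<Rightarrow> real \<Rightarrow> real" where
  "dminor n m K J \<tau> = deriv (\<lambda>\<tau>. fdet n (pmask J (offscale m \<tau> K))) \<tau>"

lemma minor_DERIV:
  "((\<lambda>\<tau>. fdet n (pmask J (offscale m \<tau> K))) has_real_derivative dminor n m K J \<tau>) (at \<tau>)"
  unfolding dminor_def pmask_offscale
  by (rule DERIV_deriv_iff_real_differentiable[THEN iffD2]) (rule fdet_offscale_differentiable)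

text \<open>A positive derivative would make the minor increase just to the right of \<tau>; \<tau>
  < 1 leaves room there for \<open>minor_offscale_antimono\<close>.\<close>

lemma dminor_nonpos:
  assumes K: "pos_def n K" and t: "0 < \<tau>" "\<tau> < 1"
  shows "dminor n m K J \<tau> \<le> 0"
proof (rule ccontr)
  assume "\<not> dminor n m K J \<tau> \<le> 0"
  from DERIV_pos_inc_right[OF minor_DERIV this[unfolded not_le]]
  obtain d where d: "0 < d" "\<And>h. 0 < h \<Longrightarrow> h < d \<Longrightarrow>
      fdet n (pmask J (offscale m \<tau> K)) < fdet n (pmask J (offscale m (\<tau> + h) K))" by blast
  define h where "h = min (d / 2) (1 - \<tau>)"
  have h: "0 < h" "h < d" "\<tau> + h \<le> 1" using d(1) t by (auto simp: h_def min_def)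
  have "fdet n (pmask J (offscale m (\<tau> + h) K)) \<le> fdet n (pmask J (offscale m \<tau> K))"
    by (rule minor_offscale_antimono[OF K]) (use h t in auto)
  thus False using d(2)[OF h(1,2)] by simp
qed

lemma dminor_pair:
  assumes "i < m" "m \<le> j" "j < n" and sym: "K j i = K i j"
  shows "dminor n m K {i,j} \<tau> = - 2 * \<tau> * (K i j)\<^sup>2"
proof -
  have e: "fdet n (pmask {i,j} (offscale m \<tau> K)) = K i i * K j j - \<tau>\<^sup>2 * (K i j)\<^sup>2" for \<tau>
    using assms by (subst fdet_pair) (auto simp: offscale_def power2_eq_square)
  have "((\<lambda>\<tau>. K i i * K j j - \<tau>\<^sup>2 * (K i j)\<^sup>2) has_real_derivative - 2 * \<tau> * (K i j)\<^sup>2) (at \<tau>)"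
    by (auto intro!: derivative_eq_intros)
  thus ?thesis unfolding dminor_def e by (rule DERIV_imp_deriv)
qed

lemma lapdet_offscale_DERIV:
  "((\<lambda>\<tau>. lapdet n (offscale m \<tau> K) t) has_real_derivative
      (\<Sum>J\<in>Pow {..<n}. (\<Prod>j\<in>J. t j) * dminor n m K J \<tau>)) (at \<tau>)"
  unfolding lapdet_expand by (intro DERIV_sum DERIV_cmult minor_DERIV)

text \<open>Multiplying the l-th coefficient by its frequency k l is differentiation with reversed
  sign, applied in the coordinates of J only.\<close>

definition diff_coeff :: "nat \<Rightarrow> nat set \<Rightarrow> (nat \<Rightarrow> nat \<Rightarrow> real) \<Rightarrow> nat \<Rightarrow> nat \<Rightarrow> real" where
  "diff_coeff k J c i l = (if i \<in> J then c i l * (real k * real l) else c i l)"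

text \<open>Differentiating the Laplace transform along the path raises the shape parameter by one and
  multiplies it by monomials in the arguments; on exponential sums the monomial acts as a
  mixed partial derivative.\<close>

lemma expsum_lap_DERIV:
  assumes K: "pos_def n K" and \<tau>: "\<bar>\<tau>\<bar> \<le> 1"
  shows "((\<lambda>\<tau>. expsum_lap n k md c (\<lambda>t. lapdet n (offscale m \<tau> K) t powr - \<alpha>)) has_real_derivative
     \<alpha> * (\<Sum>J\<in>Pow {..<n}. - dminor n m K J \<tau> *
        expsum_lap n k md (diff_coeff k J c) (\<lambda>t. lapdet n (offscale m \<tau> K) t powr - (\<alpha> + 1)))) (at \<tau>)"
proof -
  let ?S = "PiE {..<n} (\<lambda>i. {..md i})"
  let ?t = "\<lambda>l i. real k * real (l i)"
  let ?h = "\<lambda>l. lapdet n (offscale m \<tau> K) (?t l)"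
  have h: "0 < ?h l" for l
    using lapdet_ge_1[OF pos_def_offscale[OF K \<tau>], of "?t l" m] by simp
  have "((\<lambda>\<tau>. expsum_lap n k md c (\<lambda>t. lapdet n (offscale m \<tau> K) t powr - \<alpha>)) has_real_derivative
     (\<Sum>l\<in>?S. (\<Prod>i<n. c i (l i)) * (- \<alpha> * ?h l powr (- \<alpha> - of_nat 1) *
        (\<Sum>J\<in>Pow {..<n}. (\<Prod>j\<in>J. ?t l j) * dminor n m K J \<tau>)))) (at \<tau>)"
    unfolding expsum_lap_def
    by (intro DERIV_sum DERIV_cmult DERIV_fun_powr lapdet_offscale_DERIV h)
  also have "(\<Sum>l\<in>?S. (\<Prod>i<n. c i (l i)) * (- \<alpha> * ?h l powr (- \<alpha> - of_nat 1) *
        (\<Sum>J\<in>Pow {..<n}. (\<Prod>j\<in>J. ?t l j) * dminor n m K J \<tau>))) =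
     (\<Sum>l\<in>?S. \<Sum>J\<in>Pow {..<n}. \<alpha> * (- dminor n m K J \<tau> * ((\<Prod>i<n. diff_coeff k J c i (l i)) * ?h l powr - (\<alpha> + 1))))"
  proof (intro sum.cong refl)
    fix l
    have p: "(\<Prod>i<n. c i (l i)) * (\<Prod>j\<in>J. ?t l j) = (\<Prod>i<n. diff_coeff k J c i (l i))" if "J \<in> Pow {..<n}" for J
    proof -
      have "(\<Prod>j\<in>J. ?t l j) = (\<Prod>i<n. if i \<in> J then ?t l i else 1)"
        using that by (simp add: prod.If_cases Int_absorb1)
      thus ?thesis unfolding diff_coeff_def
        by (simp add: prod.distrib[symmetric]) (intro prod.cong, auto)
    qed
    have "(\<Prod>i<n. c i (l i)) * (- \<alpha> * ?h l powr (- \<alpha> - of_nat 1) * (\<Sum>J\<in>Pow {..<n}. (\<Prod>j\<in>J. ?t l j) * dminor n m K J \<tau>))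
      = (\<Sum>J\<in>Pow {..<n}. \<alpha> * (- dminor n m K J \<tau> * (((\<Prod>i<n. c i (l i)) * (\<Prod>j\<in>J. ?t l j)) * ?h l powr (- \<alpha> - 1))))"
      by (simp add: sum_distrib_left mult_ac)
    also have "\<dots> = (\<Sum>J\<in>Pow {..<n}. \<alpha> * (- dminor n m K J \<tau> * ((\<Prod>i<n. diff_coeff k J c i (l i)) * ?h l powr - (\<alpha> + 1))))"
      by (intro sum.cong refl) (simp only: p minus_add_distrib diff_conv_add_uminus)
    finally show "(\<Prod>i<n. c i (l i)) * (- \<alpha> * ?h l powr (- \<alpha> - of_nat 1) * (\<Sum>J\<in>Pow {..<n}. (\<Prod>j\<in>J. ?t l j) * dminor n m K J \<tau>))
      = (\<Sum>J\<in>Pow {..<n}. \<alpha> * (- dminor n m K J \<tau> * ((\<Prod>i<n. diff_coeff k J c i (l i)) * ?h l powr - (\<alpha> + 1))))" .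
  qed
  also have "\<dots> = \<alpha> * (\<Sum>J\<in>Pow {..<n}. - dminor n m K J \<tau> *
        expsum_lap n k md (diff_coeff k J c) (\<lambda>t. lapdet n (offscale m \<tau> K) t powr - (\<alpha> + 1)))"
    unfolding expsum_lap_def by (subst sum.swap) (simp add: sum_distrib_left)
  finally show ?thesis .
qed

definition dcut :: "nat \<Rightarrow> real \<Rightarrow> real \<Rightarrow> real" where
  "dcut k a x = real (cut_deg k a) * (1 - exp (- (real k * x))) ^ (cut_deg k a - 1) * (real k * exp (- (real k * x)))"

lemma cut_DERIV: "(soft_cut k a has_real_derivative - dcut k a x) (at x)"
  unfolding soft_cut_def[abs_def] dcut_def by (auto intro!: derivative_eq_intros)

lemma dcut_nonneg: "0 \<le> x \<Longrightarrow> 0 \<le> dcut k a x"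
  by (simp add: dcut_def)

text \<open>Two expressions for one derivative: the closed form shows the sign, the coefficients fit
  the transform. Uniqueness of derivatives identifies them without binomial identities.\<close>

lemma dcut_expsum: "dcut k a x = expsum k (cut_deg k a) (\<lambda>l. cut_coeff (cut_deg k a) l * (real k * real l)) x"
proof -
  let ?m = "cut_deg k a" and ?c = "cut_coeff (cut_deg k a)"
  have "((\<lambda>x. \<Sum>l\<le>?m. ?c l * exp (- (real k * real l * x))) has_real_derivative
      (\<Sum>l\<le>?m. ?c l * (exp (- (real k * real l * x)) * - (real k * real l)))) (at x)"
  proof (intro DERIV_sum DERIV_cmult)
    fix l
    show "((\<lambda>x. exp (- (real k * real l * x))) has_real_derivative exp (- (real k * real l * x)) * - (real k * real l)) (at x)"
      by (auto intro!: derivative_eq_intros)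
  qed
  hence "(soft_cut k a has_real_derivative (\<Sum>l\<le>?m. ?c l * (exp (- (real k * real l * x)) * - (real k * real l)))) (at x)"
    unfolding cut_expsum[abs_def] expsum_def .
  from DERIV_unique[OF this cut_DERIV]
  have "dcut k a x = - (\<Sum>l\<le>?m. ?c l * (exp (- (real k * real l * x)) * - (real k * real l)))" by simp
  thus ?thesis by (simp add: expsum_def sum_negf[symmetric] mult_ac)
qed

definition cut_part :: "nat \<Rightarrow> real \<Rightarrow> bool \<Rightarrow> real \<Rightarrow> real" where
  "cut_part k a b x = (if b then dcut k a x else soft_cut k a x)"

lemma cut_part_nonneg: "0 \<le> x \<Longrightarrow> 0 \<le> cut_part k a b x"
  by (simp add: cut_part_def dcut_nonneg cut_bounds)

lemma cut_part_expsum: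
  "expsum k (cut_deg k (a i)) (diff_coeff k J (\<lambda>i. cut_coeff (cut_deg k (a i))) i) x = cut_part k (a i) (i \<in> J) x"
  by (simp add: cut_part_def cut_expsum dcut_expsum diff_coeff_def[abs_def] expsum_def)

definition cut_diff_lap :: "nat \<Rightarrow> (nat \<Rightarrow> real) \<Rightarrow> nat \<Rightarrow> nat set \<Rightarrow> ((nat \<Rightarrow> real) \<Rightarrow> real) \<Rightarrow> real" where
  "cut_diff_lap n a k J L =
     expsum_lap n k (\<lambda>i. cut_deg k (a i)) (diff_coeff k J (\<lambda>i. cut_coeff (cut_deg k (a i)))) L"

text \<open>The number is an expectation of a product of nonnegative functions, the factors in J
  being negated derivatives of decreasing cut-offs. Here a distribution with this transform has to
  exist.\<close>

lemma cut_diff_lap_nonneg: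
  assumes X: "mgamma_rv n \<beta> Q P X"
  shows "0 \<le> cut_diff_lap n a k J (\<lambda>t. lapdet n Q t powr - \<beta>)"
proof -
  have "0 \<le> (\<integral>\<omega>. (\<Prod>i<n. cut_part k (a i) (i \<in> J) (X i \<omega>)) \<partial>P)"
    by (intro integral_nonneg_AE AE_I2 prod_nonneg) (use mgamma_rvD(3)[OF X] cut_part_nonneg in auto)
  thus ?thesis unfolding cut_diff_lap_def mgamma_rv_expsum[OF X, symmetric] cut_part_expsum .
qed

lemma cut_lap_DERIV:
  assumes "pos_def n K" "\<bar>\<tau>\<bar> \<le> 1"
  shows "((\<lambda>\<tau>. cut_lap n a k (\<lambda>t. lapdet n (offscale m \<tau> K) t powr - \<alpha>)) has_real_derivative
     \<alpha> * (\<Sum>J\<in>Pow {..<n}. - dminor n m K J \<tau> * cut_diff_lap n a k J (\<lambda>t. lapdet n (offscale m \<tau> K) t powr - (\<alpha> + 1)))) (at \<tau>)"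
  unfolding cut_lap_def cut_diff_lap_def by (rule expsum_lap_DERIV[OF assms])

section \<open>Lower bounds for the derivative\<close>

text \<open>A conditional expectation of \<psi> over a standard normal \<xi>: y stands for an
  independent gamma coordinate and z for what is left of a Gaussian coordinate after splitting off s
  \<xi>.\<close>

definition smooth :: "real \<Rightarrow> (real \<Rightarrow> real) \<Rightarrow> real \<Rightarrow> real \<Rightarrow> real" where
  "smooth s \<psi> y z = (\<integral>x. \<psi> (y + (z + s * x)\<^sup>2 / 2) \<partial>std_normal)"

lemma smooth_exp:
  assumes t: "0 \<le> t"
  shows "smooth s (\<lambda>x. exp (- (t * x))) y z =
     exp (- (t * y)) * ((1 + s\<^sup>2 * t) powr (- 1 / 2) * exp (- (t / (1 + s\<^sup>2 * t) * (z\<^sup>2 / 2))))"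
proof -
  have A: "0 \<le> s\<^sup>2 * t" using t by simp
  have e: "exp (- (t * (y + (z + s * x)\<^sup>2 / 2))) =
      exp (- (t * y)) * exp (- (s\<^sup>2 * t * x\<^sup>2 + 2 * (t * z * s) * x + t * z\<^sup>2) / 2)" for x
    unfolding exp_add[symmetric] by (intro arg_cong[where f=exp]) (simp add: power2_eq_square field_simps)
  have d: "t * z\<^sup>2 - (t * z * s)\<^sup>2 / (1 + s\<^sup>2 * t) = t / (1 + s\<^sup>2 * t) * z\<^sup>2"
    using A by (simp add: divide_simps) (simp add: power2_eq_square algebra_simps)
  have "smooth s (\<lambda>x. exp (- (t * x))) y z =
     exp (- (t * y)) * (\<integral>x. exp (- (s\<^sup>2 * t * x\<^sup>2 + 2 * (t * z * s) * x + t * z\<^sup>2) / 2) \<partial>std_normal)"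
    unfolding smooth_def e by (rule integral_mult_right_zero)
  thus ?thesis unfolding integral_std_normal_quadratic[OF A] d by simp
qed

lemma prod_sum_expsum_lap:
  "(\<Prod>i<n. \<Sum>l\<le>m i. c i l * e i (real k * real l)) = expsum_lap n k m c (\<lambda>t. \<Prod>i<n. e i (t i))"
  unfolding expsum_lap_def by (subst prod_sum_PiE) (auto simp: prod.distrib)

lemma smooth_expsum:
  "smooth s (expsum k m c) y z = (\<Sum>l\<le>m. c l * smooth s (\<lambda>x. exp (- (real k * real l * x))) y z)"
proof -
  interpret prob_space std_normal by (rule prob_space_std_normal)
  have "integrable std_normal (\<lambda>x. exp (- (real k * real l * (y + (z + s * x)\<^sup>2 / 2))))" for l
    by (rule integrable_const_bound[of _ "exp (- (real k * real l * y))"])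
      (auto intro!: AE_I2 mult_left_mono)
  thus ?thesis unfolding smooth_def expsum_def
    by (subst Bochner_Integration.integral_sum) auto
qed

text \<open>A Gaussian vector whose covariance exceeds \<open>s\<^sup>2 I\<close> splits off an independent isotropic part;
  integrating the latter out leaves a product of one-dimensional smoothings.\<close>

lemma
  assumes Y: "mgamma_rv n \<beta> Q P Y" and Z: "gaussian_rv n (\<lambda>i j. Q i j - s\<^sup>2 * of_bool (i = j)) PZ Z"
    and s: "0 < s"
  shows integrable_expsum_smooth:
      "integrable (P \<Otimes>\<^sub>M PZ) (\<lambda>\<omega>. \<Prod>i<n. smooth s (expsum k (md i) (c i)) (Y i (fst \<omega>)) (Z i (snd \<omega>)))"
    and integral_expsum_smooth:
      "(\<integral>\<omega>. (\<Prod>i<n. smooth s (expsum k (md i) (c i)) (Y i (fst \<omega>)) (Z i (snd \<omega>))) \<partial>(P \<Otimes>\<^sub>M PZ)) =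
        expsum_lap n k md c (\<lambda>t. lapdet n Q t powr - (\<beta> + 1 / 2))"
proof -
  have PZ: "prob_space PZ" and [measurable]: "\<And>i. i < n \<Longrightarrow> Z i \<in> borel_measurable PZ"
    using Z by (auto simp: gaussian_rv_def)
  note [measurable] = mgamma_rvD(2)[OF Y]
  note PP = prob_space_pair[OF mgamma_rvD(1)[OF Y] PZ]
  interpret PP: prob_space "P \<Otimes>\<^sub>M PZ" by (rule PP)
  define u where "u t i = t i / (1 + s\<^sup>2 * t i)" for t :: "nat \<Rightarrow> real" and i
  define e where "e t i y z = exp (- (t i * y)) * ((1 + s\<^sup>2 * t i) powr (- 1 / 2) * exp (- (u t i * (z\<^sup>2 / 2))))"
    for t i and y z :: real
  have eq: "(\<lambda>\<omega>. \<Prod>i<n. smooth s (expsum k (md i) (c i)) (Y i (fst \<omega>)) (Z i (snd \<omega>))) =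
      (\<lambda>\<omega>. expsum_lap n k md c (\<lambda>t. \<Prod>i<n. e t i (Y i (fst \<omega>)) (Z i (snd \<omega>))))"
    unfolding smooth_expsum prod_sum_expsum_lap[where e="\<lambda>i t. smooth s (\<lambda>x. exp (- (t * x))) (Y i (fst \<omega>)) (Z i (snd \<omega>))" for \<omega>]
    by (intro ext expsum_lap_cong prod.cong) (simp_all add: smooth_exp e_def u_def)
  have m: "(\<lambda>\<omega>. \<Prod>i<n. e t i (Y i (fst \<omega>)) (Z i (snd \<omega>))) \<in> borel_measurable (P \<Otimes>\<^sub>M PZ)" for t
    unfolding e_def by measurable
  have bd: "\<bar>\<Prod>i<n. e t i (Y i (fst \<omega>)) (Z i (snd \<omega>))\<bar> \<le> 1"
    if t: "\<And>i. i < n \<Longrightarrow> 0 \<le> t i" and \<omega>: "\<omega> \<in> space (P \<Otimes>\<^sub>M PZ)" for t \<omega>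
  proof -
    have "0 \<le> e t i (Y i (fst \<omega>)) (Z i (snd \<omega>)) \<and> e t i (Y i (fst \<omega>)) (Z i (snd \<omega>)) \<le> 1" if i: "i < n" for i
    proof -
      have "0 \<le> Y i (fst \<omega>)" using \<omega> i mgamma_rvD(3)[OF Y] by (auto simp: space_pair_measure)
      moreover have "(1 + s\<^sup>2 * t i) powr (- 1 / 2) \<le> 1 powr (- 1 / 2)"
        using t[OF i] by (intro powr_mono2') auto
      ultimately show ?thesis unfolding e_def u_def using t[OF i] by (auto intro!: mult_le_one)
    qed
    hence "(\<Prod>i<n. \<bar>e t i (Y i (fst \<omega>)) (Z i (snd \<omega>))\<bar>) \<le> 1" by (intro prod_le_1) auto
    thus ?thesis by (simp add: abs_prod)
  qed
  show "integrable (P \<Otimes>\<^sub>M PZ) (\<lambda>\<omega>. \<Prod>i<n. smooth s (expsum k (md i) (c i)) (Y i (fst \<omega>)) (Z i (snd \<omega>)))"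
    unfolding eq by (rule PP.integrable_expsum_lap[OF m bd])
  have "(\<integral>\<omega>. (\<Prod>i<n. smooth s (expsum k (md i) (c i)) (Y i (fst \<omega>)) (Z i (snd \<omega>))) \<partial>(P \<Otimes>\<^sub>M PZ)) =
      expsum_lap n k md c (\<lambda>t. \<integral>\<omega>. (\<Prod>i<n. e t i (Y i (fst \<omega>)) (Z i (snd \<omega>))) \<partial>(P \<Otimes>\<^sub>M PZ))"
    unfolding eq by (rule PP.integral_expsum_lap[OF m bd])
  also have "\<dots> = expsum_lap n k md c (\<lambda>t. lapdet n Q t powr - (\<beta> + 1 / 2))"
  proof (rule expsum_lap_cong)
    fix t :: "nat \<Rightarrow> real" assume t: "\<And>i. i < n \<Longrightarrow> 0 \<le> t i"
    have u: "0 \<le> u t i" if "i < n" for i using t[OF that] by (simp add: u_def)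
    define C where "C = (\<Prod>i<n. 1 + s\<^sup>2 * t i)"
    have C: "0 < C" unfolding C_def by (intro prod_pos) (use t in \<open>auto intro: add_pos_nonneg\<close>)
    have eC: "(\<Prod>i<n. e t i (y i) (z i)) = C powr (- 1 / 2) * (exp (- (\<Sum>i<n. t i * y i)) * exp (- (\<Sum>i<n. u t i * ((z i)\<^sup>2 / 2))))" for y z
      unfolding e_def C_def prod.distrib sum_negf[symmetric]
      by (subst prod_powr_distrib[symmetric]) (use t in \<open>auto simp: exp_sum intro!: add_nonneg_nonneg mult_nonneg_nonneg\<close>)
    let ?Q = "\<lambda>i j. Q i j - s\<^sup>2 * of_bool (i = j)"
    have "(\<integral>\<omega>. (\<Prod>i<n. e t i (Y i (fst \<omega>)) (Z i (snd \<omega>))) \<partial>(P \<Otimes>\<^sub>M PZ)) =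
      C powr (- 1 / 2) * (\<integral>\<omega>. exp (- (\<Sum>i<n. t i * Y i (fst \<omega>))) * exp (- (\<Sum>i<n. u t i * ((Z i (snd \<omega>))\<^sup>2 / 2))) \<partial>(P \<Otimes>\<^sub>M PZ))"
      unfolding eC by (rule integral_mult_right_zero)
    also have "(\<integral>\<omega>. exp (- (\<Sum>i<n. t i * Y i (fst \<omega>))) * exp (- (\<Sum>i<n. u t i * ((Z i (snd \<omega>))\<^sup>2 / 2))) \<partial>(P \<Otimes>\<^sub>M PZ)) =
      (\<integral>y. (\<integral>z. exp (- (\<Sum>i<n. t i * Y i (fst (y,z)))) * exp (- (\<Sum>i<n. u t i * ((Z i (snd (y,z)))\<^sup>2 / 2))) \<partial>PZ) \<partial>P)"
    proof (rule integral_pair_fst[OF mgamma_rvD(1)[OF Y] PZ, where C=1])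
      fix \<omega> assume \<omega>: "\<omega> \<in> space (P \<Otimes>\<^sub>M PZ)"
      have "0 \<le> (\<Sum>i<n. t i * Y i (fst \<omega>))" "0 \<le> (\<Sum>i<n. u t i * ((Z i (snd \<omega>))\<^sup>2 / 2))"
        using \<omega> t u mgamma_rvD(3)[OF Y]
        by (auto simp: space_pair_measure intro!: sum_nonneg mult_nonneg_nonneg)
      thus "\<bar>exp (- (\<Sum>i<n. t i * Y i (fst \<omega>))) * exp (- (\<Sum>i<n. u t i * ((Z i (snd \<omega>))\<^sup>2 / 2)))\<bar> \<le> 1"
        by (auto simp: abs_mult intro!: mult_le_one)
    qed measurable
    also have "\<dots> = lapdet n Q t powr - \<beta> * lapdet n ?Q (u t) powr - (1 / 2)"
      using mgamma_rvD(4)[OF Y t] mgamma_rvD(4)[OF mgamma_rv_half[OF Z] u] by simp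
    also have "C powr (- 1 / 2) * (lapdet n Q t powr - \<beta> * lapdet n ?Q (u t) powr - (1 / 2)) =
       lapdet n Q t powr - \<beta> * (C * lapdet n ?Q (u t)) powr - (1 / 2)"
      by (simp add: powr_mult)
    \<comment> \<open>The factors 1 + s^2 t_i left by the smoothing and the changed arguments
      recombine to the determinant of the full matrix.\<close>
    also have "C * lapdet n ?Q (u t) = lapdet n Q t"
      unfolding C_def u_def by (rule lapdet_shift_diag) (use t s in auto)
    also have "lapdet n Q t powr - \<beta> * lapdet n Q t powr - (1 / 2) = lapdet n Q t powr - (\<beta> + 1 / 2)"
      by (simp add: powr_add[symmetric])
    finally show "(\<integral>\<omega>. (\<Prod>i<n. e t i (Y i (fst \<omega>)) (Z i (snd \<omega>))) \<partial>(P \<Otimes>\<^sub>M PZ)) = lapdet n Q t powr - (\<beta> + 1 / 2)" .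
  qed
  finally show "(\<integral>\<omega>. (\<Prod>i<n. smooth s (expsum k (md i) (c i)) (Y i (fst \<omega>)) (Z i (snd \<omega>))) \<partial>(P \<Otimes>\<^sub>M PZ)) =
      expsum_lap n k md c (\<lambda>t. lapdet n Q t powr - (\<beta> + 1 / 2))" .
qed

text \<open>Only the x with v = z + s x in [0, V] are kept. There the normal density is at least its
  value at (V + K) / s, and \<psi> dominates h, whose integral is read off from F; so the bound is
  independent of C, however peaked \<psi> is.\<close>

lemma smooth_lower_bound:
  assumes \<psi>: "\<psi> \<in> borel_measurable borel" "\<And>x. 0 \<le> x \<Longrightarrow> 0 \<le> \<psi> x" "\<And>x. 0 \<le> x \<Longrightarrow> \<psi> x \<le> C"
    and y: "0 \<le> y" and z: "\<bar>z\<bar> \<le> K" and s: "0 < s" and V: "0 \<le> V"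
    and F: "\<And>x. (F has_real_derivative h x) (at x)" "continuous_on UNIV h"
    and h: "\<And>v. 0 \<le> v \<Longrightarrow> v \<le> V \<Longrightarrow> 0 \<le> h ((v - z) / s) \<and> h ((v - z) / s) \<le> \<psi> (y + v\<^sup>2 / 2)"
  shows "normal_density 0 1 ((V + K) / s) * (F ((V - z) / s) - F (- z / s)) \<le> smooth s \<psi> y z"
proof -
  let ?p = "- z / s" and ?q = "(V - z) / s" and ?\<phi> = "normal_density 0 1 ((V + K) / s)"
  interpret prob_space std_normal by (rule prob_space_std_normal)
  note [measurable] = \<psi>(1)
  have nn: "0 \<le> y + (z + s * x)\<^sup>2 / 2" for x using y by simp
  have pq: "?p \<le> ?q" using s V by (intro divide_right_mono) auto
  have int: "integrable std_normal (\<lambda>x. \<psi> (y + (z + s * x)\<^sup>2 / 2))"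
    by (rule integrable_const_bound[of _ C]) (use \<psi> nn in \<open>auto intro!: AE_I2\<close>)
  have int': "integrable lborel (\<lambda>x. normal_density 0 1 x * \<psi> (y + (z + s * x)\<^sup>2 / 2))"
    using int unfolding std_normal_def by (subst (asm) integrable_real_density) auto
  have FTC: "has_bochner_integral lborel (\<lambda>x. h x * indicator {?p..?q} x) (F ?q - F ?p)"
    by (rule has_bochner_integral_FTC_Icc_real[OF pq F(1)])
      (use F(2) in \<open>auto simp: continuous_on_eq_continuous_at\<close>)
  have "?\<phi> * (F ?q - F ?p) = (\<integral>x. ?\<phi> * (h x * indicator {?p..?q} x) \<partial>lborel)"
    using FTC by (simp add: has_bochner_integral_integral_eq)
  also have "\<dots> \<le> (\<integral>x. normal_density 0 1 x * \<psi> (y + (z + s * x)\<^sup>2 / 2) \<partial>lborel)"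
  proof (rule integral_mono[OF _ int'])
    show "integrable lborel (\<lambda>x. ?\<phi> * (h x * indicator {?p..?q} x))"
      using FTC by (intro integrable_mult_right) (auto simp: has_bochner_integral_iff)
    fix x
    show "?\<phi> * (h x * indicator {?p..?q} x) \<le> normal_density 0 1 x * \<psi> (y + (z + s * x)\<^sup>2 / 2)"
    proof (cases "x \<in> {?p..?q}")
      case True
      define v where "v = z + s * x"
      have x: "x = (v - z) / s" using s by (simp add: v_def)
      have v: "0 \<le> v" "v \<le> V" using True s by (auto simp: v_def field_simps)
      have "\<bar>x\<bar> \<le> (V + K) / s"
        unfolding x using v z s by (auto simp: abs_le_iff field_simps)
      hence "x\<^sup>2 \<le> ((V + K) / s)\<^sup>2" by (metis abs_ge_zero power2_abs power_mono)
      hence "?\<phi> \<le> normal_density 0 1 x"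
        by (simp add: normal_density_def divide_right_mono)
      moreover have "0 \<le> h x" "h x \<le> \<psi> (y + (z + s * x)\<^sup>2 / 2)"
        using h[OF v, folded x] by (auto simp: v_def)
      ultimately show ?thesis using True by (auto intro!: mult_mono)
    next
      case False
      thus ?thesis using \<psi>(2)[OF nn] by simp
    qed
  qed
  also have "\<dots> = smooth s \<psi> y z"
    unfolding smooth_def std_normal_def by (subst integral_real_density) auto
  finally show ?thesis .
qed

lemma dcut_le:
  assumes "0 \<le> x" shows "dcut k a x \<le> real (cut_deg k a) * real k"
proof -
  have "(1 - exp (- (real k * x))) ^ (cut_deg k a - 1) * (real k * exp (- (real k * x))) \<le> 1 * (real k * 1)"
    using assms by (intro mult_mono mult_left_mono power_le_one) auto
  thus ?thesis unfolding dcut_def mult.assoc by (intro mult_left_mono) auto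
qed

lemma smooth_cut_part_nonneg: "0 \<le> y \<Longrightarrow> 0 \<le> smooth s (cut_part k a b) y z"
  unfolding smooth_def by (intro integral_nonneg_AE AE_I2 cut_part_nonneg) simp

lemma smooth_cut_lower_bound:
  assumes y: "0 \<le> y" "y \<le> a / 4" and z: "\<bar>z\<bar> \<le> K" and s: "0 < s" and a: "0 < a"
  shows "normal_density 0 1 ((sqrt (a / 2) + K) / s) * (soft_cut k a (a / 2) * (sqrt (a / 2) / s)) \<le> smooth s (soft_cut k a) y z"
proof -
  \<comment> \<open>v \<le> V gives v^2 / 2 \<le> a / 4, so with y \<le> a / 4 the argument is at
    most a / 2, where the cut-off is close to 1.\<close>
  let ?V = "sqrt (a / 2)"
  have "normal_density 0 1 ((?V + K) / s) *
     ((\<lambda>x. soft_cut k a (a / 2) * x) ((?V - z) / s) - (\<lambda>x. soft_cut k a (a / 2) * x) (- z / s)) \<le> smooth s (soft_cut k a) y z"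
  proof (rule smooth_lower_bound[where h="\<lambda>_. soft_cut k a (a / 2)" and C=1, OF _ _ _ y(1) z s])
    show "soft_cut k a \<in> borel_measurable borel" unfolding soft_cut_def by measurable
    fix v assume v: "0 \<le> v" "v \<le> ?V"
    have "v\<^sup>2 \<le> ?V\<^sup>2" using v by (intro power_mono) auto
    hence "y + v\<^sup>2 / 2 \<le> a / 2" using y a by simp
    thus "0 \<le> soft_cut k a (a / 2) \<and> soft_cut k a (a / 2) \<le> soft_cut k a (y + v\<^sup>2 / 2)"
      using y a by (auto intro!: cut_bounds cut_antimono)
  qed (use a in \<open>auto intro!: cut_bounds derivative_eq_intros\<close>)
  also have "(\<lambda>x. soft_cut k a (a / 2) * x) ((?V - z) / s) - (\<lambda>x. soft_cut k a (a / 2) * x) (- z / s) = soft_cut k a (a / 2) * (?V / s)"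
    using s by (simp add: field_simps)
  finally show ?thesis .
qed

text \<open>With v = z + s x, the derivative of the cut-off at y + v^2 / 2 carries a factor v.
  Inserting v / V, which is at most 1, makes the integrand an exact derivative, and the integral
  becomes a difference of two cut-off values.\<close>

lemma smooth_dcut_lower_bound:
  assumes y: "0 \<le> y" "y \<le> a / 4" and z: "\<bar>z\<bar> \<le> K" and s: "0 < s" and a: "0 < a"
  defines "V \<equiv> sqrt (2 * (a + 1))"
  shows "normal_density 0 1 ((V + K) / s) * ((soft_cut k a (a / 2) - soft_cut k a (a + 1)) / (s * V)) \<le> smooth s (dcut k a) y z"
proof -
  have V: "0 < V" using a by (simp add: V_def)
  \<comment> \<open>V is chosen to carry the argument past the drop of the cut-off at a.\<close>
  have V2: "V\<^sup>2 / 2 = a + 1" using a by (simp add: V_def)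
  let ?F = "\<lambda>x. - (1 / (s * V)) * soft_cut k a (y + (z + s * x)\<^sup>2 / 2)"
  let ?h = "\<lambda>x. (z + s * x) / V * dcut k a (y + (z + s * x)\<^sup>2 / 2)"
  have "normal_density 0 1 ((V + K) / s) * (?F ((V - z) / s) - ?F (- z / s)) \<le> smooth s (dcut k a) y z"
  proof (rule smooth_lower_bound[where h="?h" and C="real (cut_deg k a) * real k", OF _ _ _ y(1) z s])
    show "dcut k a \<in> borel_measurable borel" unfolding dcut_def by measurable
    show "continuous_on UNIV ?h" unfolding dcut_def by (intro continuous_intros) (use V in auto)
    fix x
    have "((\<lambda>x. soft_cut k a (y + (z + s * x)\<^sup>2 / 2)) has_real_derivative
        - dcut k a (y + (z + s * x)\<^sup>2 / 2) * ((z + s * x) * s)) (at x)"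
      by (rule DERIV_chain2[OF cut_DERIV]) (auto intro!: derivative_eq_intros)
    moreover have "- (1 / (s * V)) * (- D * ((z + s * x) * s)) = (z + s * x) / V * D" for D
      using s V by (simp add: field_simps)
    ultimately show "(?F has_real_derivative ?h x) (at x)"
      using DERIV_cmult[of "\<lambda>x. soft_cut k a (y + (z + s * x)\<^sup>2 / 2)" _ x UNIV "- (1 / (s * V))"] by metis
  next
    fix v assume v: "0 \<le> v" "v \<le> V"
    have d: "0 \<le> dcut k a (y + v\<^sup>2 / 2)" using y by (intro dcut_nonneg) simp
    have "v / V * dcut k a (y + v\<^sup>2 / 2) \<le> 1 * dcut k a (y + v\<^sup>2 / 2)"
      using v V d by (intro mult_right_mono) auto
    thus "0 \<le> ?h ((v - z) / s) \<and> ?h ((v - z) / s) \<le> dcut k a (y + v\<^sup>2 / 2)"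
      using v V s d by simp
  qed (use V in \<open>auto intro: dcut_nonneg dcut_le\<close>)
  also have "?F ((V - z) / s) - ?F (- z / s) = (soft_cut k a y - soft_cut k a (y + (a + 1))) / (s * V)"
  proof -
    have "z + s * ((V - z) / s) = V" "z + s * (- z / s) = 0" using s by auto
    thus ?thesis by (simp only: V2) (simp add: diff_divide_distrib)
  qed
  finally have "normal_density 0 1 ((V + K) / s) * ((soft_cut k a y - soft_cut k a (y + (a + 1))) / (s * V)) \<le> smooth s (dcut k a) y z" .
  moreover have "soft_cut k a (a / 2) \<le> soft_cut k a y" "soft_cut k a (y + (a + 1)) \<le> soft_cut k a (a + 1)"
    using y a by (auto intro!: cut_antimono)
  hence "normal_density 0 1 ((V + K) / s) * ((soft_cut k a (a / 2) - soft_cut k a (a + 1)) / (s * V)) \<le>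
      normal_density 0 1 ((V + K) / s) * ((soft_cut k a y - soft_cut k a (y + (a + 1))) / (s * V))"
    using s V by (intro mult_left_mono divide_right_mono) auto
  ultimately show ?thesis by linarith
qed

lemma smooth_cut_part_eventually:
  assumes s: "0 < s" and a: "0 < a" and K: "0 \<le> K"
  shows "\<exists>c>0. \<forall>\<^sub>F k in sequentially. \<forall>y z b. 0 \<le> y \<longrightarrow> y \<le> a / 4 \<longrightarrow> \<bar>z\<bar> \<le> K \<longrightarrow> c \<le> smooth s (cut_part k a b) y z"
proof -
  let ?V = "sqrt (2 * (a + 1))" and ?W = "sqrt (a / 2)"
  let ?c1 = "normal_density 0 1 ((?W + K) / s) * (1 / 2 * (?W / s))"
  let ?c2 = "normal_density 0 1 ((?V + K) / s) * ((1 / 2) / (s * ?V))"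
  have V: "0 < ?V" "0 < ?W" using a by auto
  have "0 < normal_density 0 1 w" for w by (simp add: normal_density_pos)
  hence c: "0 < ?c1" "0 < ?c2" using V s a by (auto intro!: mult_pos_pos divide_pos_pos)
  have l1: "(\<lambda>k. soft_cut k a (a / 2)) \<longlonglongrightarrow> 1" using cut_limit[of "a / 2" a] a by simp
  have l2: "(\<lambda>k. soft_cut k a (a + 1)) \<longlonglongrightarrow> 0" using cut_limit[of "a + 1" a] a by simp
  \<comment> \<open>The difference 3/4 - 1/4 supplies the 1/2 in \<open>?c2\<close>, and 3/4 alone
    more than the 1/2 in \<open>?c1\<close>.\<close>
  have "\<forall>\<^sub>F k in sequentially. 3 / 4 < soft_cut k a (a / 2)" by (rule order_tendstoD(1)[OF l1]) simp
  moreover have "\<forall>\<^sub>F k in sequentially. soft_cut k a (a + 1) < 1 / 4" by (rule order_tendstoD(2)[OF l2]) simp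
  ultimately have "\<forall>\<^sub>F k in sequentially. \<forall>y z b. 0 \<le> y \<longrightarrow> y \<le> a / 4 \<longrightarrow> \<bar>z\<bar> \<le> K \<longrightarrow> min ?c1 ?c2 \<le> smooth s (cut_part k a b) y z"
  proof eventually_elim
    case (elim k)
    show ?case
    proof (intro allI impI)
      fix y z b assume yz: "0 \<le> y" "y \<le> a / 4" "\<bar>z\<bar> \<le> K"
      show "min ?c1 ?c2 \<le> smooth s (cut_part k a b) y z"
      proof (cases b)
        case True
        have "?c2 \<le> normal_density 0 1 ((?V + K) / s) * ((soft_cut k a (a / 2) - soft_cut k a (a + 1)) / (s * ?V))"
          using elim s V by (intro mult_left_mono divide_right_mono) auto
        also have "\<dots> \<le> smooth s (dcut k a) y z" by (rule smooth_dcut_lower_bound[OF yz s a])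
        finally show ?thesis using True by (simp add: cut_part_def[abs_def] min_le_iff_disj)
      next
        case False
        have "?c1 \<le> normal_density 0 1 ((?W + K) / s) * (soft_cut k a (a / 2) * (?W / s))"
          using elim s V by (intro mult_left_mono mult_right_mono) auto
        also have "\<dots> \<le> smooth s (soft_cut k a) y z" by (rule smooth_cut_lower_bound[OF yz s a])
        finally show ?thesis using False by (simp add: cut_part_def[abs_def] min_le_iff_disj)
      qed
    qed
  qed
  thus ?thesis using c by (intro exI[of _ "min ?c1 ?c2"]) simp
qed

section \<open>Mass of small boxes, uniformly along the path\<close>

lemma mgamma_rv_box_mass:
  assumes X: "mgamma_rv n \<beta> (offscale m \<tau> K) P X" and K: "pos_def n K" and \<tau>: "0 \<le> \<tau>" "\<tau> \<le> 1"
    and \<beta>: "0 \<le> \<beta>" and t: "0 \<le> t"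
  shows "lapdet n (offscale m 0 K) (\<lambda>_. t) powr - \<beta> - exp (- (t * \<delta>)) \<le> measure P {\<omega>\<in>space P. \<forall>i<n. X i \<omega> \<le> \<delta>}"
proof -
  interpret prob_space P by (rule mgamma_rvD(1)[OF X])
  note [measurable] = mgamma_rvD(2)[OF X]
  let ?A = "{\<omega>\<in>space P. \<forall>i<n. X i \<omega> \<le> \<delta>}"
  have A: "?A \<in> events" by measurable
  have "lapdet n (offscale m 0 K) (\<lambda>_. t) powr - \<beta> \<le> lapdet n (offscale m \<tau> K) (\<lambda>_. t) powr - \<beta>"
  proof (rule powr_mono2')
    have "1 \<le> lapdet n (offscale m \<tau> K) (\<lambda>_. t)"
      by (rule lapdet_ge_1[OF pos_def_offscale[OF K]]) (use t \<tau> in auto)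
    thus "0 < lapdet n (offscale m \<tau> K) (\<lambda>_. t)" by simp
    show "lapdet n (offscale m \<tau> K) (\<lambda>_. t) \<le> lapdet n (offscale m 0 K) (\<lambda>_. t)"
      by (rule lapdet_offscale_le[OF K _ \<tau>]) (use t in auto)
  qed (use \<beta> in auto)
  also have "\<dots> = (\<integral>\<omega>. exp (- (\<Sum>i<n. t * X i \<omega>)) \<partial>P)"
    by (rule mgamma_rvD(4)[OF X, symmetric]) (rule t)
  \<comment> \<open>Outside the box some coordinate exceeds \<delta>, so the exponential is at most
    exp (- t \<delta>) there; inside it is at most 1.\<close>
  also have "\<dots> \<le> (\<integral>\<omega>. indicator ?A \<omega> + exp (- (t * \<delta>)) \<partial>P)"
  proof (rule integral_mono)
    show "integrable P (\<lambda>\<omega>. exp (- (\<Sum>i<n. t * X i \<omega>)))"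
      by (rule integrable_const_bound[of _ 1])
        (use t mgamma_rvD(3)[OF X] in \<open>auto intro!: AE_I2 sum_nonneg mult_nonneg_nonneg\<close>)
    show "integrable P (\<lambda>\<omega>. indicator ?A \<omega> + exp (- (t * \<delta>)) :: real)"
      using A by (intro Bochner_Integration.integrable_add) (auto simp: integrable_indicator_iff less_top[symmetric])
    fix \<omega> assume \<omega>: "\<omega> \<in> space P"
    have nn: "0 \<le> t * X i \<omega>" if "i < n" for i using that t mgamma_rvD(3)[OF X that \<omega>] by simp
    show "exp (- (\<Sum>i<n. t * X i \<omega>)) \<le> indicator ?A \<omega> + exp (- (t * \<delta>))"
    proof (cases "\<omega> \<in> ?A")
      case True
      have "exp (- (\<Sum>i<n. t * X i \<omega>)) \<le> 1" using nn by (auto intro!: sum_nonneg)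
      moreover have "0 \<le> exp (- (t * \<delta>))" by simp
      ultimately show ?thesis using True by (auto intro: add_increasing2)
    next
      case False
      then obtain i where i: "i < n" "\<delta> < X i \<omega>" using \<omega> by auto
      have "t * \<delta> \<le> t * X i \<omega>" using i t by (intro mult_left_mono) auto
      also have "\<dots> \<le> (\<Sum>i<n. t * X i \<omega>)" by (rule member_le_sum) (use i nn in auto)
      finally show ?thesis using False by simp
    qed
  qed
  also have "\<dots> = measure P ?A + exp (- (t * \<delta>))"
    using A by (subst Bochner_Integration.integral_add) (auto simp: integrable_indicator_iff prob_space less_top[symmetric])
  finally show ?thesis by simp
qed

text \<open>The determinant grows at most polynomially in t, so its negative power decays more
  slowly than the exponential.\<close>

lemma lapdet_powr_dominates_exp:
  assumes Q: "pos_def n Q" and \<beta>: "0 < \<beta>" and \<delta>: "0 < \<delta>"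
  shows "\<exists>t\<ge>0. exp (- (t * \<delta>)) < lapdet n Q (\<lambda>_. t) powr - \<beta>"
proof -
  define C where "C = (\<Sum>J\<in>Pow {..<n}. fdet n (pmask J Q))"
  have C: "1 \<le> C"
    using lapdet_ge_1[OF Q, of "\<lambda>_. 1"] by (simp add: lapdet_expand C_def)
  \<comment> \<open>With t = u^2 one has 1 + t \<le> exp (2 u), and the claim becomes \<beta> (2 n u
    + ln C) < u^2 \<delta>, which this u \<ge> 1 ensures.\<close>
  define u where "u = (\<beta> * ln C + 2 * real n * \<beta> + 1) / \<delta> + 1"
  have lnC: "0 \<le> \<beta> * ln C" using C \<beta> by simp
  have u: "1 \<le> u" using lnC \<beta> \<delta> by (simp add: u_def)
  define t where "t = u\<^sup>2"
  have t: "0 \<le> t" by (simp add: t_def)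
  have "lapdet n Q (\<lambda>_. t) \<le> (\<Sum>J\<in>Pow {..<n}. (1 + t) ^ n * fdet n (pmask J Q))"
    unfolding lapdet_expand
  proof (rule sum_mono)
    fix J assume "J \<in> Pow {..<n}"
    hence J: "card J \<le> n" using card_mono[of "{..<n}" J] by auto
    have "(\<Prod>j\<in>J. t) = t ^ card J" by simp
    also have "\<dots> \<le> (1 + t) ^ card J" using t by (intro power_mono) auto
    also have "\<dots> \<le> (1 + t) ^ n" using t J by (intro power_increasing) auto
    finally show "(\<Prod>j\<in>J. t) * fdet n (pmask J Q) \<le> (1 + t) ^ n * fdet n (pmask J Q)"
      by (intro mult_right_mono less_imp_le[OF minor_pos[OF Q]])
  qed
  also have "\<dots> = (1 + t) ^ n * C" by (simp add: C_def sum_distrib_left)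
  also have "\<dots> \<le> exp (2 * u) ^ n * C"
  proof (intro mult_right_mono power_mono)
    have "1 + t \<le> (1 + u)\<^sup>2" using u by (simp add: t_def power2_eq_square algebra_simps)
    also have "\<dots> \<le> (exp u)\<^sup>2" using u exp_ge_add_one_self[of u] by (intro power_mono) auto
    also have "\<dots> = exp (2 * u)" by (simp add: exp_double)
    finally show "1 + t \<le> exp (2 * u)" .
  qed (use t C in auto)
  also have "\<dots> = exp (2 * u * real n + ln C)"
    using C by (simp add: exp_add exp_of_nat_mult[symmetric] mult_ac)
  finally have le: "lapdet n Q (\<lambda>_. t) \<le> exp (2 * u * real n + ln C)" .
  have pos: "0 < lapdet n Q (\<lambda>_. t)" using lapdet_ge_1[OF Q, of "\<lambda>_. t"] t by simp
  have "\<beta> * (2 * u * real n + ln C) < t * \<delta>"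
  proof -
    have "u * \<delta> = \<beta> * ln C + 2 * real n * \<beta> + 1 + \<delta>" using \<delta> by (simp add: u_def field_simps)
    hence "t * \<delta> = u * (\<beta> * ln C) + u * (2 * real n * \<beta>) + u * (1 + \<delta>)"
      by (simp add: t_def power2_eq_square mult.assoc) (simp add: algebra_simps)
    moreover have "1 * (\<beta> * ln C) \<le> u * (\<beta> * ln C)" using u lnC by (intro mult_right_mono) auto
    moreover have "0 < u * (1 + \<delta>)" using u \<delta> by simp
    ultimately show ?thesis by (simp add: algebra_simps)
  qed
  hence "exp (- (t * \<delta>)) < exp (2 * u * real n + ln C) powr - \<beta>"
    by (simp add: powr_def algebra_simps)
  also have "\<dots> \<le> lapdet n Q (\<lambda>_. t) powr - \<beta>"
    by (rule powr_mono2') (use \<beta> pos le in auto)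
  finally show ?thesis using t by blast
qed

lemma mgamma_rv_box_mass_uniform:
  assumes K: "pos_def n K" and \<beta>: "0 < \<beta>" and \<delta>: "0 < \<delta>"
  obtains p where "0 < p" "\<And>\<tau> (P :: 'a measure) X. mgamma_rv n \<beta> (offscale m \<tau> K) P X \<Longrightarrow> 0 \<le> \<tau> \<Longrightarrow> \<tau> \<le> 1 \<Longrightarrow>
      p \<le> measure P {\<omega>\<in>space P. \<forall>i<n. X i \<omega> \<le> \<delta>}"
proof -
  have "pos_def n (offscale m 0 K)" by (rule pos_def_offscale[OF K]) simp
  from lapdet_powr_dominates_exp[OF this \<beta> \<delta>] obtain t
    where t: "0 \<le> t" "exp (- (t * \<delta>)) < lapdet n (offscale m 0 K) (\<lambda>_. t) powr - \<beta>" by blast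
  show ?thesis
    by (rule that[of "lapdet n (offscale m 0 K) (\<lambda>_. t) powr - \<beta> - exp (- (t * \<delta>))"])
      (use t \<beta> in \<open>auto intro!: mgamma_rv_box_mass[OF _ K]\<close>)
qed

text \<open>\<Gamma>(\<alpha> + 1) is realised as \<Gamma>(\<alpha>) plus two independent vectors of
  half squares of Gaussians. One is added to the gamma part, giving Y; the Gaussian vector of the
  other is split into noise s \<xi> and a remainder Z. While Y and the half squares of Z stay below
  \<delta>, every smoothed factor is at least some c_i, and this event has probability at least p q
  for all \<tau>.\<close>

lemma cut_diff_lap_lower_bound:
  assumes K: "pos_def n K" and \<alpha>: "0 < \<alpha>" and a: "\<And>i. i < n \<Longrightarrow> 0 < a i"
    and ex: "\<And>\<tau>. 0 \<le> \<tau> \<Longrightarrow> \<tau> \<le> 1 \<Longrightarrow> \<exists>P :: (nat \<Rightarrow> real) measure. \<exists>X. mgamma_rv n \<alpha> (offscale m \<tau> K) P X"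
  shows "\<exists>c>0. \<forall>\<^sub>F k in sequentially. \<forall>\<tau>. 0 \<le> \<tau> \<longrightarrow> \<tau> \<le> 1 \<longrightarrow>
    c \<le> cut_diff_lap n a k J (\<lambda>t. lapdet n (offscale m \<tau> K) t powr - (\<alpha> + 1))"
proof -
  obtain \<epsilon> where \<epsilon>: "0 < \<epsilon>" and K': "pos_def n (\<lambda>i j. K i j - \<epsilon> * of_bool (i = j))"
    using pos_def_shrink[OF K] by blast
  let ?K' = "\<lambda>i j. K i j - \<epsilon> * of_bool (i = j)"
  define s where "s = sqrt \<epsilon>"
  have s: "0 < s" and s2: "s\<^sup>2 = \<epsilon>" using \<epsilon> by (auto simp: s_def)
  \<comment> \<open>The diagonal is untouched by the scaling, so a single \<epsilon> serves every
    \<tau>.\<close>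
  have off: "offscale m \<tau> ?K' = (\<lambda>i j. offscale m \<tau> K i j - s\<^sup>2 * of_bool (i = j))" for \<tau>
    by (auto simp: offscale_def s2 fun_eq_iff)
  \<comment> \<open>Small enough for all coordinates at once; the 1 keeps the set nonempty when n =
    0.\<close>
  define \<delta> where "\<delta> = Min (insert 1 ((\<lambda>i. a i / 4) ` {..<n}))"
  have \<delta>: "0 < \<delta>" unfolding \<delta>_def by (subst Min_gr_iff) (use a in auto)
  have \<delta>a: "\<delta> \<le> a i / 4" if "i < n" for i
    unfolding \<delta>_def using that by (intro Min_le) auto
  define z0 where "z0 = sqrt (2 * \<delta>)"
  have z0: "0 \<le> z0" using \<delta> by (simp add: z0_def)
  obtain p where p: "0 < p" "\<And>\<tau> (P :: ((nat \<Rightarrow> real) \<times> (nat \<Rightarrow> real)) measure) X.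
      mgamma_rv n (\<alpha> + 1 / 2) (offscale m \<tau> K) P X \<Longrightarrow> 0 \<le> \<tau> \<Longrightarrow> \<tau> \<le> 1 \<Longrightarrow> p \<le> measure P {\<omega>\<in>space P. \<forall>i<n. X i \<omega> \<le> \<delta>}"
    by (rule mgamma_rv_box_mass_uniform[OF K _ \<delta>, of "\<alpha> + 1 / 2"]) (use \<alpha> in auto)
  obtain q where q: "0 < q" "\<And>\<tau> (P :: (nat \<Rightarrow> real) measure) X.
      mgamma_rv n (1 / 2) (offscale m \<tau> ?K') P X \<Longrightarrow> 0 \<le> \<tau> \<Longrightarrow> \<tau> \<le> 1 \<Longrightarrow> q \<le> measure P {\<omega>\<in>space P. \<forall>i<n. X i \<omega> \<le> \<delta>}"
    by (rule mgamma_rv_box_mass_uniform[OF K' _ \<delta>, of "1 / 2"]) auto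
  have "\<forall>i\<in>{..<n}. \<exists>c>0. \<forall>\<^sub>F k in sequentially. \<forall>y z b. 0 \<le> y \<longrightarrow> y \<le> a i / 4 \<longrightarrow> \<bar>z\<bar> \<le> z0 \<longrightarrow> c \<le> smooth s (cut_part k (a i) b) y z"
    using smooth_cut_part_eventually[OF s a z0] by auto
  from bchoice[OF this] obtain c where c0: "\<And>i. i < n \<Longrightarrow> 0 < c i"
    and c: "\<And>i. i < n \<Longrightarrow> \<forall>\<^sub>F k in sequentially. \<forall>y z b. 0 \<le> y \<longrightarrow> y \<le> a i / 4 \<longrightarrow> \<bar>z\<bar> \<le> z0 \<longrightarrow> c i \<le> smooth s (cut_part k (a i) b) y z"
    by auto
  define C where "C = (\<Prod>i<n. c i)"
  have C: "0 < C" unfolding C_def using c0 by (intro prod_pos) auto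
  have "\<forall>\<^sub>F k in sequentially. \<forall>i\<in>{..<n}. \<forall>y z b. 0 \<le> y \<longrightarrow> y \<le> a i / 4 \<longrightarrow> \<bar>z\<bar> \<le> z0 \<longrightarrow> c i \<le> smooth s (cut_part k (a i) b) y z"
    by (rule eventually_ball_finite) (use c in auto)
  hence "\<forall>\<^sub>F k in sequentially. \<forall>\<tau>. 0 \<le> \<tau> \<longrightarrow> \<tau> \<le> 1 \<longrightarrow>
    C * (p * q) \<le> cut_diff_lap n a k J (\<lambda>t. lapdet n (offscale m \<tau> K) t powr - (\<alpha> + 1))"
  proof eventually_elim
    case (elim k)
    show ?case
    proof (intro allI impI)
      fix \<tau> :: real assume \<tau>: "0 \<le> \<tau>" "\<tau> \<le> 1"
      obtain P0 :: "(nat \<Rightarrow> real) measure" and X0 where X0: "mgamma_rv n \<alpha> (offscale m \<tau> K) P0 X0"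
        using ex[OF \<tau>] by blast
      have pd1: "pos_def n (offscale m \<tau> K)" and pd2: "pos_def n (offscale m \<tau> ?K')"
        using \<tau> by (auto intro!: pos_def_offscale K K')
      obtain P1 :: "(nat \<Rightarrow> real) measure" and Z1 where Z1: "gaussian_rv n (offscale m \<tau> K) P1 Z1"
        using gaussian_rv_exists[OF pd1] by blast
      obtain PZ :: "(nat \<Rightarrow> real) measure" and Z where Z: "gaussian_rv n (offscale m \<tau> ?K') PZ Z"
        using gaussian_rv_exists[OF pd2] by blast
      define P where "P = P0 \<Otimes>\<^sub>M P1"
      obtain Y where Y: "mgamma_rv n (\<alpha> + 1 / 2) (offscale m \<tau> K) P Y"
        using mgamma_rv_convolve[OF X0 mgamma_rv_half[OF Z1]] unfolding P_def by blast
      have PZ: "prob_space PZ" and [measurable]: "\<And>i. i < n \<Longrightarrow> Z i \<in> borel_measurable PZ"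
        using Z by (auto simp: gaussian_rv_def)
      note [measurable] = mgamma_rvD(2)[OF Y]
      define A where "A = {\<omega>\<in>space P. \<forall>i<n. Y i \<omega> \<le> \<delta>}"
      define B where "B = {\<omega>\<in>space PZ. \<forall>i<n. (Z i \<omega>)\<^sup>2 / 2 \<le> \<delta>}"
      have [measurable]: "A \<in> sets P" "B \<in> sets PZ" unfolding A_def B_def by measurable
      have pA: "p \<le> measure P A" unfolding A_def P_def by (rule p(2)[OF Y[unfolded P_def] \<tau>])
      have qB: "q \<le> measure PZ B" unfolding B_def by (rule q(2)[OF mgamma_rv_half[OF Z] \<tau>])
      have cp: "expsum k (cut_deg k (a i)) (diff_coeff k J (\<lambda>i. cut_coeff (cut_deg k (a i))) i) = cut_part k (a i) (i \<in> J)" for i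
        by (rule ext) (rule cut_part_expsum)
      note ZZ = Z[unfolded off]
      let ?f = "\<lambda>\<omega>. \<Prod>i<n. smooth s (cut_part k (a i) (i \<in> J)) (Y i (fst \<omega>)) (Z i (snd \<omega>))"
      let ?g = "\<lambda>\<omega>. C * (indicator A (fst \<omega>) * indicator B (snd \<omega>)) :: real"
      interpret PP: prob_space "P \<Otimes>\<^sub>M PZ" by (rule prob_space_pair[OF mgamma_rvD(1)[OF Y] PZ])
      have int: "integrable (P \<Otimes>\<^sub>M PZ) ?f"
        using integrable_expsum_smooth[OF Y ZZ s, of k "\<lambda>i. cut_deg k (a i)" "diff_coeff k J (\<lambda>i. cut_coeff (cut_deg k (a i)))"]
        unfolding cp .
      have eq: "cut_diff_lap n a k J (\<lambda>t. lapdet n (offscale m \<tau> K) t powr - (\<alpha> + 1)) = (\<integral>\<omega>. ?f \<omega> \<partial>(P \<Otimes>\<^sub>M PZ))"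
        using integral_expsum_smooth[OF Y ZZ s, of k "\<lambda>i. cut_deg k (a i)" "diff_coeff k J (\<lambda>i. cut_coeff (cut_deg k (a i)))"]
        unfolding cp cut_diff_lap_def by (simp add: add.assoc)
      have "(\<integral>\<omega>. ?g \<omega> \<partial>(P \<Otimes>\<^sub>M PZ)) = C * (\<integral>\<omega>. indicator A (fst \<omega>) * indicator B (snd \<omega>) \<partial>(P \<Otimes>\<^sub>M PZ))"
        by (rule integral_mult_right_zero)
      also have "(\<integral>\<omega>. indicator A (fst \<omega>) * indicator B (snd \<omega>) \<partial>(P \<Otimes>\<^sub>M PZ)) =
          (\<integral>x. (\<integral>y. indicator A (fst (x,y)) * indicator B (snd (x,y)) \<partial>PZ) \<partial>P :: real)"
        by (rule integral_pair_fst[OF mgamma_rvD(1)[OF Y] PZ, where C=1]) (measurable, auto simp: indicator_def)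
      also have "\<dots> = measure P A * measure PZ B" by simp
      finally have g: "(\<integral>\<omega>. ?g \<omega> \<partial>(P \<Otimes>\<^sub>M PZ)) = C * (measure P A * measure PZ B)" .
      have "C * (p * q) \<le> C * (measure P A * measure PZ B)"
        using C p(1) q(1) pA qB by (intro mult_left_mono mult_mono) auto
      also have "\<dots> = (\<integral>\<omega>. ?g \<omega> \<partial>(P \<Otimes>\<^sub>M PZ))" by (rule g[symmetric])
      also have "\<dots> \<le> (\<integral>\<omega>. ?f \<omega> \<partial>(P \<Otimes>\<^sub>M PZ))"
      proof (rule integral_mono[OF _ int])
        show "integrable (P \<Otimes>\<^sub>M PZ) ?g"
          by (rule PP.integrable_const_bound[of _ C]) (use C in \<open>auto intro!: AE_I2 simp: indicator_def\<close>)
        fix \<omega> assume \<omega>: "\<omega> \<in> space (P \<Otimes>\<^sub>M PZ)"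
        have Y0: "0 \<le> Y i (fst \<omega>)" if "i < n" for i
          using \<omega> that mgamma_rvD(3)[OF Y] by (auto simp: space_pair_measure)
        show "?g \<omega> \<le> ?f \<omega>"
        proof (cases "fst \<omega> \<in> A \<and> snd \<omega> \<in> B")
          case True
          have "c i \<le> smooth s (cut_part k (a i) (i \<in> J)) (Y i (fst \<omega>)) (Z i (snd \<omega>))" if i: "i < n" for i
          proof -
            have "Y i (fst \<omega>) \<le> a i / 4" using True i \<delta>a[OF i] by (auto simp: A_def)
            moreover have "(Z i (snd \<omega>))\<^sup>2 \<le> 2 * \<delta>" using True i by (auto simp: B_def)
            hence "\<bar>Z i (snd \<omega>)\<bar> \<le> z0" unfolding z0_def by (rule real_le_rsqrt[OF _, of "\<bar>Z i (snd \<omega>)\<bar>", simplified])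
            ultimately show ?thesis using elim i Y0[OF i] by auto
          qed
          hence "C \<le> ?f \<omega>" unfolding C_def by (intro prod_mono) (use c0 in \<open>auto intro: less_imp_le\<close>)
          thus ?thesis using True by simp
        next
          case False
          have "0 \<le> ?f \<omega>" by (intro prod_nonneg smooth_cut_part_nonneg) (use Y0 in auto)
          thus ?thesis using False by auto
        qed
      qed
      finally show "C * (p * q) \<le> cut_diff_lap n a k J (\<lambda>t. lapdet n (offscale m \<tau> K) t powr - (\<alpha> + 1))"
        unfolding eq .
    qed
  qed
  thus ?thesis using C p(1) q(1) by (intro exI[of _ "C * (p * q)"]) auto
qed

section \<open>Marginals, products and the main inequality\<close>

lemma sum_lessThan_add:
  fixes f :: "nat \<Rightarrow> real"
  shows "(\<Sum>i<k + m. f i) = (\<Sum>i<k. f i) + (\<Sum>i<m. f (k + i))"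
  by (induction m) (simp_all add: add.assoc)

lemma mgamma_rv_left:
  assumes X: "mgamma_rv (k + m) \<alpha> Q P X"
  shows "mgamma_rv k \<alpha> Q P X"
  unfolding mgamma_rv_def
proof (intro conjI allI impI ballI)
  fix t :: "nat \<Rightarrow> real" assume t: "\<forall>i<k. 0 \<le> t i"
  let ?t = "\<lambda>i. if i < k then t i else 0"
  have "(\<integral>\<omega>. exp (- (\<Sum>i<k. t i * X i \<omega>)) \<partial>P) = (\<integral>\<omega>. exp (- (\<Sum>i<k + m. ?t i * X i \<omega>)) \<partial>P)"
    by (simp add: sum_lessThan_add)
  also have "\<dots> = lapdet (k + m) Q ?t powr - \<alpha>"
    by (rule mgamma_rvD(4)[OF X]) (use t in auto)
  also have "lapdet (k + m) Q ?t = lapdet k Q ?t" by (rule lapdet_restrict_left) simp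
  also have "\<dots> = lapdet k Q t" by (rule lapdet_cong) auto
  finally show "(\<integral>\<omega>. exp (- (\<Sum>i<k. t i * X i \<omega>)) \<partial>P) = lapdet k Q t powr - \<alpha>" .
qed (use mgamma_rvD(1-3)[OF X] in auto)

lemma mgamma_rv_right:
  assumes X: "mgamma_rv (k + m) \<alpha> Q P X"
  shows "mgamma_rv m \<alpha> (\<lambda>i j. Q (k + i) (k + j)) P (\<lambda>i. X (k + i))"
  unfolding mgamma_rv_def
proof (intro conjI allI impI ballI)
  fix t :: "nat \<Rightarrow> real" assume t: "\<forall>i<m. 0 \<le> t i"
  let ?t = "\<lambda>i. if i < k then 0 else t (i - k)"
  have "(\<integral>\<omega>. exp (- (\<Sum>i<m. t i * X (k + i) \<omega>)) \<partial>P) = (\<integral>\<omega>. exp (- (\<Sum>i<k + m. ?t i * X i \<omega>)) \<partial>P)"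
    by (simp add: sum_lessThan_add)
  also have "\<dots> = lapdet (k + m) Q ?t powr - \<alpha>"
    by (rule mgamma_rvD(4)[OF X]) (use t in auto)
  also have "lapdet (k + m) Q ?t = lapdet m (\<lambda>i j. Q (k + i) (k + j)) (\<lambda>j. ?t (k + j))"
    by (rule lapdet_restrict_right) simp
  finally show "(\<integral>\<omega>. exp (- (\<Sum>i<m. t i * X (k + i) \<omega>)) \<partial>P) =
      lapdet m (\<lambda>i j. Q (k + i) (k + j)) t powr - \<alpha>" by simp
qed (use mgamma_rvD(1-3)[OF X] in auto)

text \<open>Independent blocks realise the end \<tau> = 0 of the path: the transforms multiply, and
  so do the determinants by \<open>lapdet_offscale_0\<close>.\<close>

lemma mgamma_rv_product:
  assumes X: "mgamma_rv k \<alpha> Q P X" and Y: "mgamma_rv m \<alpha> (\<lambda>i j. Q (k + i) (k + j)) P' Y"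
  shows "mgamma_rv (k + m) \<alpha> (offscale k 0 Q) (P \<Otimes>\<^sub>M P') (\<lambda>i \<omega>. if i < k then X i (fst \<omega>) else Y (i - k) (snd \<omega>))"
    (is "mgamma_rv _ _ _ _ ?Z")
  unfolding mgamma_rv_def
proof (intro conjI allI impI ballI)
  note [measurable] = mgamma_rvD(2)[OF X] mgamma_rvD(2)[OF Y]
  show "prob_space (P \<Otimes>\<^sub>M P')" by (intro prob_space_pair mgamma_rvD(1)[OF X] mgamma_rvD(1)[OF Y])
  show "?Z i \<in> borel_measurable (P \<Otimes>\<^sub>M P')" if "i < k + m" for i
    using that by (cases "i < k") (simp_all, measurable)
  show "0 \<le> ?Z i \<omega>" if "i < k + m" "\<omega> \<in> space (P \<Otimes>\<^sub>M P')" for i \<omega>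
    using that mgamma_rvD(3)[OF X] mgamma_rvD(3)[OF Y] by (auto simp: space_pair_measure)
  fix t :: "nat \<Rightarrow> real" assume t: "\<forall>i<k + m. 0 \<le> t i"
  have s: "(\<Sum>i<k + m. t i * ?Z i \<omega>) = (\<Sum>i<k. t i * X i (fst \<omega>)) + (\<Sum>i<m. t (k + i) * Y i (snd \<omega>))" for \<omega>
    by (simp add: sum_lessThan_add)
  have "(\<integral>\<omega>. exp (- (\<Sum>i<k + m. t i * ?Z i \<omega>)) \<partial>(P \<Otimes>\<^sub>M P')) =
      (\<integral>\<omega>. exp (- (\<Sum>i<k. t i * X i (fst \<omega>))) * exp (- (\<Sum>i<m. t (k + i) * Y i (snd \<omega>))) \<partial>(P \<Otimes>\<^sub>M P'))"
    unfolding s minus_add_distrib exp_add ..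
  also have "\<dots> = (\<integral>x. (\<integral>y. exp (- (\<Sum>i<k. t i * X i (fst (x,y)))) * exp (- (\<Sum>i<m. t (k + i) * Y i (snd (x,y)))) \<partial>P') \<partial>P)"
  proof (rule integral_pair_fst[OF mgamma_rvD(1)[OF X] mgamma_rvD(1)[OF Y], where C=1])
    fix \<omega> assume "\<omega> \<in> space (P \<Otimes>\<^sub>M P')"
    hence "0 \<le> (\<Sum>i<k. t i * X i (fst \<omega>))" "0 \<le> (\<Sum>i<m. t (k + i) * Y i (snd \<omega>))"
      using t mgamma_rvD(3)[OF X] mgamma_rvD(3)[OF Y]
      by (auto simp: space_pair_measure intro!: sum_nonneg mult_nonneg_nonneg)
    thus "\<bar>exp (- (\<Sum>i<k. t i * X i (fst \<omega>))) * exp (- (\<Sum>i<m. t (k + i) * Y i (snd \<omega>)))\<bar> \<le> 1"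
      by (auto simp: abs_mult intro!: mult_le_one)
  qed measurable
  also have "\<dots> = lapdet k Q t powr - \<alpha> * lapdet m (\<lambda>i j. Q (k + i) (k + j)) (\<lambda>i. t (k + i)) powr - \<alpha>"
    using mgamma_rvD(4)[OF X, of t] mgamma_rvD(4)[OF Y, of "\<lambda>i. t (k + i)"] t by simp
  also have "\<dots> = lapdet (k + m) (offscale k 0 Q) t powr - \<alpha>"
    by (simp add: lapdet_offscale_0 powr_mult)
  finally show "(\<integral>\<omega>. exp (- (\<Sum>i<k + m. t i * ?Z i \<omega>)) \<partial>(P \<Otimes>\<^sub>M P')) = lapdet (k + m) (offscale k 0 Q) t powr - \<alpha>" .
qed

lemma measure_pair_boxes:
  assumes X: "mgamma_rv k \<alpha> Q P X" and Y: "mgamma_rv m \<beta> Q' P' Y"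
  shows "measure (P \<Otimes>\<^sub>M P') {\<omega>\<in>space (P \<Otimes>\<^sub>M P'). \<forall>i<k + m. (if i < k then X i (fst \<omega>) else Y (i - k) (snd \<omega>)) \<le> a i} =
    measure P {\<omega>\<in>space P. \<forall>i<k. X i \<omega> \<le> a i} * measure P' {\<omega>\<in>space P'. \<forall>i<m. Y i \<omega> \<le> a (k + i)}"
proof -
  note [measurable] = mgamma_rvD(2)[OF X] mgamma_rvD(2)[OF Y]
  interpret P: prob_space P by (rule mgamma_rvD(1)[OF X])
  interpret P': prob_space P' by (rule mgamma_rvD(1)[OF Y])
  interpret PP: pair_prob_space P P' ..
  let ?A = "{\<omega>\<in>space P. \<forall>i<k. X i \<omega> \<le> a i}" and ?B = "{\<omega>\<in>space P'. \<forall>i<m. Y i \<omega> \<le> a (k + i)}"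
  have "(\<forall>i<k + m. (if i < k then X i x else Y (i - k) y) \<le> a i) \<longleftrightarrow>
      (\<forall>i<k. X i x \<le> a i) \<and> (\<forall>i<m. Y i y \<le> a (k + i))" for x y
  proof safe
    fix i assume h: "\<forall>i<k + m. (if i < k then X i x else Y (i - k) y) \<le> a i" and i: "i < m"
    show "Y i y \<le> a (k + i)" using h[rule_format, of "k + i"] i by simp
  next
    fix i assume h: "\<forall>i<m. Y i y \<le> a (k + i)" "\<forall>i<k. X i x \<le> a i" and i: "i < k + m"
    show "(if i < k then X i x else Y (i - k) y) \<le> a i"
      using h(1)[rule_format, of "i - k"] h(2) i by auto
  qed (metis trans_less_add1)
  hence "{\<omega>\<in>space (P \<Otimes>\<^sub>M P'). \<forall>i<k + m. (if i < k then X i (fst \<omega>) else Y (i - k) (snd \<omega>)) \<le> a i} = ?A \<times> ?B"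
    by (auto simp: space_pair_measure)
  moreover have "emeasure (P \<Otimes>\<^sub>M P') (?A \<times> ?B) = emeasure P ?A * emeasure P' ?B"
    by (rule P'.emeasure_pair_measure_Times) measurable
  ultimately show ?thesis by (simp add: measure_def enn2real_mult)
qed

text \<open>The cut-off version is shown with a gap d independent of k and then passed to the limit.
  The derivative of the minor on {i, j} is a multiple of \<tau>, so the gap is collected on
  [1/2, 1], while [0, 1/2] contributes monotonicity.\<close>

lemma box_probability_offscale_less:
  assumes K: "pos_def n K" and n: "2 \<le> n" and \<alpha>: "0 < \<alpha>" "2 * \<alpha> \<in> \<nat> \<or> real n - 2 < 2 * \<alpha>"
    and a: "\<And>i. i < n \<Longrightarrow> 0 < a i"
    and ij: "i < m" "m \<le> j" "j < n" "K i j \<noteq> 0"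
    and X: "mgamma_rv n \<alpha> K P X" and Y: "mgamma_rv n \<alpha> (offscale m 0 K) P' Y"
  shows "measure P' {\<omega>\<in>space P'. \<forall>i<n. Y i \<omega> \<le> a i} < measure P {\<omega>\<in>space P. \<forall>i<n. X i \<omega> \<le> a i}"
proof -
  have ex: "\<exists>P :: (nat \<Rightarrow> real) measure. \<exists>X. mgamma_rv n \<beta> (offscale m \<tau> K) P X"
    if "0 \<le> \<tau>" "\<tau> \<le> 1" "0 < \<beta>" "2 * \<beta> \<in> \<nat> \<or> real n - 2 < 2 * \<beta>" for \<tau> \<beta>
    using that by (intro mgamma_rv_exists[OF pos_def_offscale[OF K] n]) auto
  \<comment> \<open>The alternative for \<alpha> is stable under adding 1, so the distributions
    behind the differentiated terms exist along the whole path.\<close>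
  have \<alpha>1: "0 < \<alpha> + 1" "2 * (\<alpha> + 1) \<in> \<nat> \<or> real n - 2 < 2 * (\<alpha> + 1)"
  proof -
    have "2 * (\<alpha> + 1) = 2 * \<alpha> + 2" by simp
    moreover have "2 * \<alpha> + 2 \<in> \<nat>" if "2 * \<alpha> \<in> \<nat>" using that by (intro Nats_add) auto
    ultimately show "2 * (\<alpha> + 1) \<in> \<nat> \<or> real n - 2 < 2 * (\<alpha> + 1)" using \<alpha> by auto
  qed (use \<alpha> in simp)
  define f where "f k \<tau> = cut_lap n a k (\<lambda>t. lapdet n (offscale m \<tau> K) t powr - \<alpha>)" for k \<tau>
  define D where "D k J \<tau> = cut_diff_lap n a k J (\<lambda>t. lapdet n (offscale m \<tau> K) t powr - (\<alpha> + 1))" for k J \<tau>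
  define f' where "f' k \<tau> = \<alpha> * (\<Sum>J\<in>Pow {..<n}. - dminor n m K J \<tau> * D k J \<tau>)" for k \<tau>
  have der: "(f k has_real_derivative f' k \<tau>) (at \<tau>)" if "\<bar>\<tau>\<bar> \<le> 1" for k \<tau>
    unfolding f_def[abs_def] f'_def D_def by (rule cut_lap_DERIV[OF K that])
  have D0: "0 \<le> D k J \<tau>" if "0 \<le> \<tau>" "\<tau> \<le> 1" for k J \<tau>
    using ex[OF that \<alpha>1] cut_diff_lap_nonneg unfolding D_def by blast
  have term0: "0 \<le> - dminor n m K J \<tau> * D k J \<tau>" if "0 < \<tau>" "\<tau> < 1" for k J \<tau>
    using dminor_nonpos[OF K that, of m J] D0[of \<tau> k J] that by (intro mult_nonneg_nonneg) auto
  have f'0: "0 \<le> f' k \<tau>" if "0 < \<tau>" "\<tau> < 1" for k \<tau>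
    unfolding f'_def using \<alpha>(1) by (intro mult_nonneg_nonneg[OF _ sum_nonneg[OF term0[OF that]]]) simp
  have "\<exists>c>0. \<forall>\<^sub>F k in sequentially. \<forall>\<tau>. 0 \<le> \<tau> \<longrightarrow> \<tau> \<le> 1 \<longrightarrow> c \<le> D k {i,j} \<tau>"
    unfolding D_def by (rule cut_diff_lap_lower_bound[OF K \<alpha>(1)]) (use a ex[OF _ _ \<alpha>] in auto)
  then obtain c where c: "0 < c" "\<forall>\<^sub>F k in sequentially. \<forall>\<tau>. 0 \<le> \<tau> \<longrightarrow> \<tau> \<le> 1 \<longrightarrow> c \<le> D k {i,j} \<tau>"
    by blast
  \<comment> \<open>On (1/2, 1) the set {i, j} contributes at least \<alpha> (K i j)^2 c to the
    derivative, since 2 \<eta> \<ge> 1 there; the 1/2 is the length of the interval.\<close>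
  define d where "d = \<alpha> * ((K i j)\<^sup>2 * c) / 2"
  have d: "0 < d" using \<alpha>(1) ij(4) c(1) by (simp add: d_def)
  have low: "f k 0 + d \<le> f k 1" if ck: "\<forall>\<tau>. 0 \<le> \<tau> \<longrightarrow> \<tau> \<le> 1 \<longrightarrow> c \<le> D k {i,j} \<tau>" for k
  proof -
    \<comment> \<open>The mean value theorem yields an interior point, as the strict bounds in
      \<open>dminor_nonpos\<close> require.\<close>
    obtain \<xi> where "0 < \<xi>" "\<xi> < 1 / 2" "f k (1 / 2) - f k 0 = (1 / 2 - 0) * f' k \<xi>"
      using MVT2[of 0 "1 / 2" "f k" "f' k"] der by force
    hence 1: "f k 0 \<le> f k (1 / 2)" using f'0[of \<xi> k] by simp
    obtain \<eta> where \<eta>: "1 / 2 < \<eta>" "\<eta> < 1" "f k 1 - f k (1 / 2) = (1 - 1 / 2) * f' k \<eta>"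
      using MVT2[of "1 / 2" 1 "f k" "f' k"] der by force
    have "(K i j)\<^sup>2 * c \<le> (2 * \<eta> * (K i j)\<^sup>2) * D k {i,j} \<eta>"
      using \<eta> c(1) ck by (intro mult_mono) (auto intro: mult_le_cancel_right1[THEN iffD2])
    also have "\<dots> = - dminor n m K {i,j} \<eta> * D k {i,j} \<eta>"
      using ij pos_def_sym[OF K, of j i] by (subst dminor_pair) auto
    also have "\<dots> \<le> (\<Sum>J\<in>Pow {..<n}. - dminor n m K J \<eta> * D k J \<eta>)"
      by (rule member_le_sum) (use ij \<eta> term0 in auto)
    finally have "\<alpha> * ((K i j)\<^sup>2 * c) \<le> f' k \<eta>"
      unfolding f'_def using \<alpha>(1) by (intro mult_left_mono) auto
    thus ?thesis using 1 \<eta>(3) by (simp add: d_def)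
  qed
  have off1: "offscale m 1 K = K" by (auto simp: offscale_def fun_eq_iff)
  have l1: "(\<lambda>k. f k 1) \<longlonglongrightarrow> measure P {\<omega>\<in>space P. \<forall>i<n. X i \<omega> \<le> a i}"
    unfolding f_def off1 by (rule cut_lap_limit[OF X]) (use a in \<open>auto intro: less_imp_le\<close>)
  have l0: "(\<lambda>k. f k 0) \<longlonglongrightarrow> measure P' {\<omega>\<in>space P'. \<forall>i<n. Y i \<omega> \<le> a i}"
    unfolding f_def by (rule cut_lap_limit[OF Y]) (use a in \<open>auto intro: less_imp_le\<close>)
  have "measure P' {\<omega>\<in>space P'. \<forall>i<n. Y i \<omega> \<le> a i} + d \<le> measure P {\<omega>\<in>space P. \<forall>i<n. X i \<omega> \<le> a i}"
  proof (rule tendsto_le[OF sequentially_bot l1])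
    show "(\<lambda>k. f k 0 + d) \<longlonglongrightarrow> measure P' {\<omega>\<in>space P'. \<forall>i<n. Y i \<omega> \<le> a i} + d"
      by (intro tendsto_add l0 tendsto_const)
    show "\<forall>\<^sub>F k in sequentially. f k 0 + d \<le> f k 1"
      using c(2) by eventually_elim (rule low)
  qed
  thus ?thesis using d by simp
qed

theorem theorem1:
  fixes n n1 n2 :: nat and R :: "real mat" and \<alpha> :: real and x :: "nat \<Rightarrow> real"
  assumes "n \<ge> 2" and "n = n1 + n2" and "n1 \<ge> 1" and "n2 \<ge> 1"
    and "correlation_matrix n R" and "det R \<noteq> 0"
    and "\<exists>i<n1. \<exists>j<n2. R $$ (i, n1 + j) \<noteq> 0"
    and "\<alpha> > 0" and "2 * \<alpha> \<in> \<nat> \<or> 2 * \<alpha> > real n - 2"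
    and "\<forall>i<n. x i > 0"
  shows "mgamma_cdf n \<alpha> R x >
           mgamma_cdf n1 \<alpha> (mat n1 n1 (\<lambda>(i,j). R $$ (i,j))) x *
           mgamma_cdf n2 \<alpha> (mat n2 n2 (\<lambda>(i,j). R $$ (n1 + i, n1 + j))) (\<lambda>i. x (n1 + i))"
proof -
  let ?K = "\<lambda>i j. R $$ (i,j)"
  let ?R1 = "mat n1 n1 (\<lambda>(i,j). R $$ (i,j))" and ?R2 = "mat n2 n2 (\<lambda>(i,j). R $$ (n1 + i, n1 + j))"
  have n: "n = n1 + n2" and x0: "\<And>i. i < n \<Longrightarrow> 0 \<le> x i" using assms(2,10) by (auto intro: less_imp_le)
  have R: "R \<in> carrier_mat n n" using assms(5) by (simp add: correlation_matrix_def)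
  have K: "pos_def n ?K" by (rule correlation_pos_def[OF assms(5,6)])
  obtain P :: "(nat \<Rightarrow> real) measure" and X where X: "mgamma_rv n \<alpha> ?K P X"
    using mgamma_rv_exists[OF K assms(1,8)] assms(9) by blast
  \<comment> \<open>Both marginals live on P, so existence for the diagonal blocks comes from that
    for R. The product of P with itself makes them independent.\<close>
  note X1 = mgamma_rv_left[OF X[unfolded n]] and X2 = mgamma_rv_right[OF X[unfolded n]]
  let ?X2 = "\<lambda>i. X (n1 + i)"
  note XX = mgamma_rv_product[OF X1 X2]
  obtain i j where ij: "i < n1" "j < n2" "R $$ (i, n1 + j) \<noteq> 0" using assms(7) by blast
  have F: "mgamma_cdf n \<alpha> R x = measure P {\<omega>\<in>space P. \<forall>i<n. X i \<omega> \<le> x i}"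
    by (rule mgamma_cdf_eq[OF X R x0])
  have F1: "mgamma_cdf n1 \<alpha> ?R1 x = measure P {\<omega>\<in>space P. \<forall>i<n1. X i \<omega> \<le> x i}"
    by (rule mgamma_cdf_eq) (use mgamma_rv_cong[OF X1, of "\<lambda>i j. ?R1 $$ (i,j)"] x0 n in auto)
  have F2: "mgamma_cdf n2 \<alpha> ?R2 (\<lambda>i. x (n1 + i)) = measure P {\<omega>\<in>space P. \<forall>i<n2. ?X2 i \<omega> \<le> x (n1 + i)}"
    by (rule mgamma_cdf_eq) (use mgamma_rv_cong[OF X2, of "\<lambda>i j. ?R2 $$ (i,j)"] x0 n in auto)
  have "measure (P \<Otimes>\<^sub>M P) {\<omega>\<in>space (P \<Otimes>\<^sub>M P). \<forall>i<n. (if i < n1 then X i (fst \<omega>) else ?X2 (i - n1) (snd \<omega>)) \<le> x i} <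
      measure P {\<omega>\<in>space P. \<forall>i<n. X i \<omega> \<le> x i}"
    by (rule box_probability_offscale_less[OF K assms(1,8,9), where i=i and j="n1 + j" and m=n1])
      (use ij n assms(10) X XX in auto)
  also have "measure (P \<Otimes>\<^sub>M P) {\<omega>\<in>space (P \<Otimes>\<^sub>M P). \<forall>i<n. (if i < n1 then X i (fst \<omega>) else ?X2 (i - n1) (snd \<omega>)) \<le> x i} =
      measure P {\<omega>\<in>space P. \<forall>i<n1. X i \<omega> \<le> x i} * measure P {\<omega>\<in>space P. \<forall>i<n2. ?X2 i \<omega> \<le> x (n1 + i)}"
    unfolding n by (rule measure_pair_boxes[OF X1 X2])
  finally show ?thesis unfolding F F1 F2 .
qed

end
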